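(* Let $\Omega\subset\mathbb{R}^2$ be a bounded domain with smooth boundary, let $f\in C^1(\mathbb{R})$ and $\alpha\in\mathbb{R}$. Let $u\in C^2(\overline{\Omega})$ be a solution of $$\Delta u+f(u)=0\ \text{ in }\Omega,\qquad \partial_\nu u+\alpha u=0\ \text{ on }\partial\Omega .$$ Suppose that $$\int_{\partial\Omega}\alpha^2u^2\Big(\frac{f(u)}{\alpha u}-\kappa+\alpha\Big)\,d\sigma<0\qquad\text{and}\qquad \alpha+\kappa\ge0\ \text{ on }\partial\Omega,$$ where $\kappa$ is the curvature of $\partial\Omega$. Then $u$ is unstable.
   Context: $\nu$ is the external unit normal to $\partial\Omega$ and $\sigma$ is arc-length measure on $\partial\Omega$. The curvature $\kappa$ is signed so that it is positive for the boundary of a disk. The integrand $\alpha^2u^2\big(\frac{f(u)}{\alpha u}-\kappa+\alpha\big)$ is understood as $\alpha\,u\,f(u)-\kappa\,\alpha^2u^2+\alpha^3u^2$ (in particular where $\alpha u=0$). The solution $u$ is stable if $$\int_\Omega|\nabla\varphi|^2\,dx+\alpha\int_{\partial\Omega}\varphi^2\,d\sigma-\int_\Omega f'(u)\varphi^2\,dx\ge0\quad\text{for all }\varphi\in C^1(\overline\Omega),$$ and unstable if it is not stable. *)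

theory Defs
  imports "HOL-Analysis.Analysis"
begin

definition partial_deriv :: "'a::euclidean_space \<Rightarrow> ('a \<Rightarrow> real) \<Rightarrow> 'a \<Rightarrow> real" where
  "partial_deriv b u x = frechet_derivative u (at x) b"

definition grad :: "('a::euclidean_space \<Rightarrow> real) \<Rightarrow> 'a \<Rightarrow> 'a" where
  "grad u x = (\<Sum>b\<in>Basis. partial_deriv b u x *\<^sub>R b)"

definition laplacian :: "('a::euclidean_space \<Rightarrow> real) \<Rightarrow> 'a \<Rightarrow> real" where
  "laplacian u x = (\<Sum>b\<in>Basis. partial_deriv b (partial_deriv b u) x)"

text \<open>All derivatives of \<open>u\<close> of order at most \<open>k\<close> exist in the open set \<open>\<Omega>\<close> and have
  continuous extensions to its closure. Only the values of \<open>u\<close> in \<open>\<Omega>\<close> matter here.\<close>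

primrec derivs_extend :: "nat \<Rightarrow> 'a::euclidean_space set \<Rightarrow> ('a \<Rightarrow> real) \<Rightarrow> bool" where
  "derivs_extend 0 \<Omega> u \<longleftrightarrow>
     (\<exists>v. continuous_on (closure \<Omega>) v \<and> (\<forall>x\<in>\<Omega>. v x = u x))"
| "derivs_extend (Suc k) \<Omega> u \<longleftrightarrow>
     (\<exists>v. continuous_on (closure \<Omega>) v \<and> (\<forall>x\<in>\<Omega>. v x = u x)) \<and>
     (\<forall>x\<in>\<Omega>. u differentiable (at x)) \<and>
     (\<forall>b\<in>Basis. derivs_extend k \<Omega> (partial_deriv b u))"

text \<open>The space \<open>C\<^sup>k\<close> of the closure of an open set. A member is represented by a total function
  whose values off the closure are irrelevant and whose values on the boundary are the continuous
  extension of those in \<open>\<Omega>\<close>.\<close>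

definition C_closure :: "nat \<Rightarrow> 'a::euclidean_space set \<Rightarrow> ('a \<Rightarrow> real) \<Rightarrow> bool" where
  "C_closure k \<Omega> u \<longleftrightarrow> continuous_on (closure \<Omega>) u \<and> derivs_extend k \<Omega> u"

text \<open>The boundary is smooth if, near each of its points and in suitable Cartesian coordinates
  (the coordinates along the orthonormal vectors \<open>e\<close> and \<open>n\<close>), the domain is the region below the
  graph of a \<open>C\<^sup>\<infinity>\<close> function.\<close>

definition smooth_boundary :: "(real \<times> real) set \<Rightarrow> bool" where
  "smooth_boundary \<Omega> \<longleftrightarrow>
     (\<forall>p\<in>frontier \<Omega>. \<exists>r>0. \<exists>e n. \<exists>h :: real \<Rightarrow> real.
        norm e = 1 \<and> norm n = 1 \<and> e \<bullet> n = 0 \<and>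
        (\<forall>k. (deriv ^^ k) h differentiable_on UNIV) \<and>
        \<Omega> \<inter> ball p r = {x \<in> ball p r. x \<bullet> n < h (x \<bullet> e)})"

definition bounded_smooth_domain :: "(real \<times> real) set \<Rightarrow> bool" where
  "bounded_smooth_domain \<Omega> \<longleftrightarrow>
     \<Omega> \<noteq> {} \<and> open \<Omega> \<and> connected \<Omega> \<and> bounded \<Omega> \<and> smooth_boundary \<Omega>"

text \<open>The unit vector that is orthogonal to all velocities at \<open>p\<close> of curves in the boundary and
  that points out of \<open>\<Omega>\<close>.\<close>

definition outer_normal :: "(real \<times> real) set \<Rightarrow> real \<times> real \<Rightarrow> real \<times> real" where
  "outer_normal \<Omega> p = (THE \<nu>.
     norm \<nu> = 1 \<and>
     (\<forall>\<gamma> v. \<gamma> 0 = p \<and> (\<forall>\<^sub>F t in at 0. \<gamma> t \<in> frontier \<Omega>) \<and>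
        (\<gamma> has_vector_derivative v) (at 0) \<longrightarrow> v \<bullet> \<nu> = 0) \<and>
     (\<exists>\<epsilon>>0. \<forall>t\<in>{0<..<\<epsilon>}. p + t *\<^sub>R \<nu> \<notin> \<Omega> \<and> p - t *\<^sub>R \<nu> \<in> \<Omega>))"

text \<open>The normal derivative on the boundary of a function in \<open>C\<^sup>1\<close> of the closure: the gradient at
  a boundary point is the value of its continuous extension from \<open>\<Omega>\<close>.\<close>

definition normal_deriv :: "(real \<times> real) set \<Rightarrow> (real \<times> real \<Rightarrow> real) \<Rightarrow> real \<times> real \<Rightarrow> real" where
  "normal_deriv \<Omega> u p = Lim (at p within \<Omega>) (grad u) \<bullet> outer_normal \<Omega> p"

text \<open>For a unit-speed local parametrization \<open>\<gamma>\<close> of the boundary the signed curvature is given by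
  \<open>\<gamma>'' = - \<kappa> \<nu>\<close>; for a regular one, the normal component of \<open>\<gamma>''\<close> is divided by the squared speed.
  With \<open>\<nu>\<close> the outer normal, this does not depend on the direction of \<open>\<gamma>\<close> and gives \<open>1 / R\<close> for a
  disk of radius \<open>R\<close>.\<close>

definition curvature :: "(real \<times> real) set \<Rightarrow> real \<times> real \<Rightarrow> real" where
  "curvature \<Omega> p = (THE k. \<exists>\<gamma> \<gamma>' a. \<exists>\<epsilon>>0.
     \<gamma> 0 = p \<and>
     (\<forall>t\<in>{-\<epsilon><..<\<epsilon>}. \<gamma> t \<in> frontier \<Omega> \<and> (\<gamma> has_vector_derivative \<gamma>' t) (at t)) \<and>
     \<gamma>' 0 \<noteq> 0 \<and> (\<gamma>' has_vector_derivative a) (at 0) \<and>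
     k = - (a \<bullet> outer_normal \<Omega> p) / (norm (\<gamma>' 0))\<^sup>2)"

text \<open>Arc-length measure on the trace \<open>\<Gamma>\<close> of finitely many smooth closed curves: the Borel measure
  carried by \<open>\<Gamma>\<close> that gives every \<open>C\<^sup>1\<close> arc in \<open>\<Gamma>\<close> its length. It is unique, because the arcs
  generate the Borel sets of \<open>\<Gamma>\<close>, and it exists, being the restriction to \<open>\<Gamma>\<close> of the
  one-dimensional Hausdorff measure.\<close>

definition arc_length_measure :: "(real \<times> real) set \<Rightarrow> (real \<times> real) measure \<Rightarrow> bool" where
  "arc_length_measure \<Gamma> \<sigma> \<longleftrightarrow>
     sets \<sigma> = sets borel \<and> emeasure \<sigma> (- \<Gamma>) = 0 \<and>
     (\<forall>\<gamma>. arc \<gamma> \<and> \<gamma> C1_differentiable_on {0..1} \<and> path_image \<gamma> \<subseteq> \<Gamma> \<longrightarrow>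
        emeasure \<sigma> (path_image \<gamma>)
          = ennreal (integral {0..1} (\<lambda>t. norm (vector_derivative \<gamma> (at t)))))"

definition stable ::
  "(real \<times> real) set \<Rightarrow> (real \<times> real) measure \<Rightarrow> (real \<Rightarrow> real) \<Rightarrow> real \<Rightarrow> (real \<times> real \<Rightarrow> real) \<Rightarrow> bool"
where
  "stable \<Omega> \<sigma> f \<alpha> u \<longleftrightarrow>
     (\<forall>\<phi>. C_closure 1 \<Omega> \<phi> \<longrightarrow>
        (LINT x:\<Omega>|lborel. (norm (grad \<phi> x))\<^sup>2)
        + \<alpha> * (LINT x:frontier \<Omega>|\<sigma>. (\<phi> x)\<^sup>2)
        - (LINT x:\<Omega>|lborel. deriv f (u x) * (\<phi> x)\<^sup>2) \<ge> 0)"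

abbreviation unstable where
  "unstable \<Omega> \<sigma> f \<alpha> u \<equiv> \<not> stable \<Omega> \<sigma> f \<alpha> u"

end

theory Submission
  imports Defs
begin

text \<open>The two partial derivatives \<open>w\<^sub>1\<close>, \<open>w\<^sub>2\<close> of \<open>u\<close> serve as test functions. On a smooth domain, Green's
  formula \<open>\<integral>\<^sub>\<Omega> dP \<and> dq = \<integral>\<^sub>\<partial>\<^sub>\<Omega> P \<partial>\<^sub>T q\<close> holds for \<open>P\<close> and \<open>q\<close> that are merely \<open>C\<^sup>1\<close> up to the boundary
  (\<open>T\<close> is the unit tangent), so no third derivatives of \<open>u\<close> are needed. Applied to \<open>f(u) w\<close>, and to
  \<open>w\<^sub>1\<close> and \<open>w\<^sub>2\<close> in order to express \<open>norm (D\<^sup>2u)\<^sup>2 - (\<Delta>u)\<^sup>2 = - 2 det D\<^sup>2u\<close>, it turns the sum of the two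
  quadratic forms into a boundary integral. There \<open>w \<bullet> N = - \<alpha> u\<close>, whose tangential derivative
  brings in the curvature through \<open>\<partial>\<^sub>T N = \<kappa> T\<close>, and one more integration by parts along the boundary
  shows that the sum equals the integral assumed to be negative minus
  \<open>\<integral>\<^sub>\<partial>\<^sub>\<Omega> (\<alpha> + \<kappa>) (w \<bullet> T)\<^sup>2\<close>. Hence one of the two forms is negative.\<close>

section \<open>Green's formula on a rectangle\<close>

text \<open>The boundary is given only through local graphs, \<open>\<sigma>\<close> only through
  lengths of arcs, and normal and curvature only through definite descriptions that speak of curves
  in the frontier. Each has to be made explicit in a chart before the integrals can be compared.
  Graph coordinates are a shear followed by a rotation, so they preserve area and no Jacobian
  occurs. The local formulas are glued by a C1 partition of unity, which matches the regularity that
  Green's formula asks for. The same gluing extends the outer normal to a C1 field \<open>N\<close>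
  near the closure, so that its derivative along \<open>T\<close> is an ordinary derivative. The two
  forms are added because the sum is invariant under rotations: on the boundary the gradient can be
  split along \<open>N\<close> and \<open>T\<close>, which a single partial derivative does not
  allow. The boundary terms then contain the derivative of the gradient along \<open>T\<close>,
  about whose two components nothing is known. The differentiated boundary condition removes the
  component along \<open>N\<close>; the vanishing integral of the tangential derivative of
  \<open>u (w \<bullet> T)\<close> removes the one along \<open>T\<close>.\<close>

text \<open>The left-hand side is obtained by differentiating \<open>\<integral> P q\<^sub>s ds\<close> in \<open>t\<close>. As \<open>q\<^sub>s\<close> need not be
  differentiable, its increment is moved to \<open>P\<close> by integration by parts in \<open>s\<close>; what remains is
  the integral \<open>R\<close> of a product of two increments, which is of order \<open>o(t - t0)\<close>.\<close>

lemma box_green: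
  fixes P Ps Pt q qs qt :: "real \<times> real \<Rightarrow> real"
  assumes ab: "a \<le> b" and cd: "c \<le> d"
    and cont: "continuous_on (cbox (a,c) (b,d)) P" "continuous_on (cbox (a,c) (b,d)) Ps"
      "continuous_on (cbox (a,c) (b,d)) Pt" "continuous_on (cbox (a,c) (b,d)) q"
      "continuous_on (cbox (a,c) (b,d)) qs" "continuous_on (cbox (a,c) (b,d)) qt"
    and Ps: "\<And>s t. s \<in> {a..b} \<Longrightarrow> t \<in> {c<..<d} \<Longrightarrow>
      ((\<lambda>s. P (s,t)) has_real_derivative Ps (s,t)) (at s within {a..b})"
    and Pt: "\<And>s t. s \<in> {a..b} \<Longrightarrow> t \<in> {c<..<d} \<Longrightarrow>
      ((\<lambda>t. P (s,t)) has_real_derivative Pt (s,t)) (at t)"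
    and qs: "\<And>s t. s \<in> {a..b} \<Longrightarrow> t \<in> {c<..<d} \<Longrightarrow>
      ((\<lambda>s. q (s,t)) has_real_derivative qs (s,t)) (at s within {a..b})"
    and qt: "\<And>s t. s \<in> {a..b} \<Longrightarrow> t \<in> {c<..<d} \<Longrightarrow>
      ((\<lambda>t. q (s,t)) has_real_derivative qt (s,t)) (at t)"
    and sides: "\<And>t. t \<in> {c<..<d} \<Longrightarrow> P (a,t) = 0" "\<And>t. t \<in> {c<..<d} \<Longrightarrow> P (b,t) = 0"
    and bottom: "\<And>s. s \<in> {a..b} \<Longrightarrow> P (s,c) = 0"
  shows "integral (cbox (a,c) (b,d)) (\<lambda>z. Ps z * qt z - Pt z * qs z)
    = - integral {a..b} (\<lambda>s. P (s,d) * qs (s,d))"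
proof -
  define I where "I = (\<lambda>t. integral {a..b} (\<lambda>s. P (s,t) * qs (s,t)))"
  define D where "D = (\<lambda>t. integral {a..b} (\<lambda>s. Pt (s,t) * qs (s,t) - Ps (s,t) * qt (s,t)))"
  have sl: "continuous_on {a..b} (\<lambda>s. F (s,t))"
    if "continuous_on (cbox (a,c) (b,d)) F" "t \<in> {c..d}" for F :: "real \<times> real \<Rightarrow> real" and t
    by (rule continuous_on_compose2[OF that(1)]) (use that in \<open>auto intro!: continuous_intros\<close>)
  have sw: "continuous_on ({c..d} \<times> cbox a b) (\<lambda>(t,s). F (s,t))"
    if "continuous_on (cbox (a,c) (b,d)) F" for F :: "real \<times> real \<Rightarrow> real"
    unfolding case_prod_unfold
    by (rule continuous_on_compose2[OF that(1)]) (use that in \<open>auto intro!: continuous_intros\<close>)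
  have contI: "continuous_on {c..d} I"
  proof -
    have "continuous_on {c..d} (\<lambda>t. integral (cbox a b) (\<lambda>s. P (s,t) * qs (s,t)))"
      by (rule integral_continuous_on_param)
        (use sw[of "\<lambda>z. P z * qs z"] cont in \<open>auto intro!: continuous_intros\<close>)
    then show ?thesis unfolding I_def by simp
  qed
  have derI: "(I has_real_derivative D t0) (at t0)" if t0: "t0 \<in> {c<..<d}" for t0
  proof -
    \<comment> \<open>The factors not known to be differentiable in \<open>t\<close>, namely
      \<open>qs\<close> and \<open>Ps\<close>, are frozen at \<open>t0\<close>, so that
      \<open>K\<close> can be differentiated under the integral sign; its derivative at
      \<open>t0\<close> is \<open>D t0\<close>.\<close>
    define K where "K = (\<lambda>t. integral (cbox a b) (\<lambda>s. P (s,t) * qs (s,t0) - Ps (s,t0) * q (s,t)))"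
    define R where "R = (\<lambda>t. integral {a..b} (\<lambda>s. (P (s,t) - P (s,t0)) * (qs (s,t) - qs (s,t0))))"
    have t0': "t0 \<in> {c..d}" using t0 by auto
    have derK: "(K has_real_derivative D t0) (at t0 within {c<..<d})"
    proof -
      have cf: "continuous_on ({c<..<d} \<times> cbox a b) (\<lambda>(t,s). F (s,t0))"
        if "continuous_on (cbox (a,c) (b,d)) F" for F :: "real \<times> real \<Rightarrow> real"
        unfolding case_prod_unfold
        by (rule continuous_on_compose2[OF that(1)]) (use t0 in \<open>auto intro!: continuous_intros\<close>)
      have sw': "continuous_on ({c<..<d} \<times> cbox a b) (\<lambda>(t,s). F (s,t))"
        if "continuous_on (cbox (a,c) (b,d)) F" for F :: "real \<times> real \<Rightarrow> real"
        by (rule continuous_on_subset[OF sw[OF that]]) auto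
      have "(K has_real_derivative
          integral (cbox a b) (\<lambda>s. Pt (s,t0) * qs (s,t0) - Ps (s,t0) * qt (s,t0)))
          (at t0 within {c<..<d})"
        unfolding K_def
      proof (rule leibniz_rule_field_derivative
          [where fx = "\<lambda>t s. Pt (s,t) * qs (s,t0) - Ps (s,t0) * qt (s,t)"])
        fix t s assume "t \<in> {c<..<d}" "s \<in> cbox a b"
        then show "((\<lambda>t. P (s, t) * qs (s, t0) - Ps (s, t0) * q (s, t)) has_real_derivative
            Pt (s, t) * qs (s, t0) - Ps (s, t0) * qt (s, t)) (at t within {c<..<d})"
          by (auto intro!: derivative_eq_intros has_field_derivative_at_within[OF Pt]
              has_field_derivative_at_within[OF qt])
      next
        fix t assume "t \<in> {c<..<d}"
        then show "(\<lambda>s. P (s, t) * qs (s, t0) - Ps (s, t0) * q (s, t)) integrable_on cbox a b"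
          using t0 cont
          by (intro integrable_continuous) (auto intro!: continuous_intros sl)
      next
        show "continuous_on ({c<..<d} \<times> cbox a b)
            (\<lambda>(t, s). Pt (s, t) * qs (s, t0) - Ps (s, t0) * qt (s, t))"
          using sw'[OF cont(3)] sw'[OF cont(6)] cf[OF cont(5)] cf[OF cont(2)]
          unfolding case_prod_unfold by (intro continuous_intros)
      qed (use t0 in auto)
      then show ?thesis by (simp add: D_def)
    qed
    have IKR: "I t = K t + (R t - I t0)" if t: "t \<in> {c<..<d}" for t
    proof -
      have t': "t \<in> {c..d}" using t by auto
      have "((\<lambda>s. P (s,t0) * q (s,t)) has_vector_derivative
          (P (s,t0) * qs (s,t) + Ps (s,t0) * q (s,t))) (at s within {a..b})" if "s \<in> {a..b}" for s
        unfolding has_real_derivative_iff_has_vector_derivative[symmetric]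
        using Ps[OF that t0] qs[OF that t] by (auto intro!: derivative_eq_intros)
      then have "((\<lambda>s. P (s,t0) * qs (s,t) + Ps (s,t0) * q (s,t)) has_integral
          (P (b,t0) * q (b,t) - P (a,t0) * q (a,t))) {a..b}"
        by (rule fundamental_theorem_of_calculus[OF ab])
      then have parts: "integral {a..b} (\<lambda>s. P (s,t0) * qs (s,t) + Ps (s,t0) * q (s,t)) = 0"
        using sides t0 by (simp add: integral_unique)
      have "K t + (R t - I t0) = K t + (R t - I t0) +
          integral {a..b} (\<lambda>s. P (s,t0) * qs (s,t) + Ps (s,t0) * q (s,t))"
        using parts by simp
      also have "\<dots> = integral {a..b} (\<lambda>s. (P (s,t) * qs (s,t0) - Ps (s,t0) * q (s,t)) +
           ((P (s,t) - P (s,t0)) * (qs (s,t) - qs (s,t0)) - P (s,t0) * qs (s,t0)) +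
           (P (s,t0) * qs (s,t) + Ps (s,t0) * q (s,t)))"
        unfolding K_def R_def I_def using t' t0' cont
        by (subst integral_add integral_diff; 
            (intro integrable_continuous_interval continuous_intros sl)?; simp?)+
      also have "\<dots> = I t"
        unfolding I_def by (rule integral_cong) (auto simp: algebra_simps)
      finally show ?thesis by simp
    qed
    obtain B where B: "\<And>z. z \<in> cbox (a,c) (b,d) \<Longrightarrow> \<bar>Pt z\<bar> \<le> B"
      using compact_imp_bounded[OF compact_continuous_image[OF cont(3) compact_cbox]]
      unfolding bounded_iff by auto
    then have B0: "B \<ge> 0" using order_trans[OF abs_ge_zero B[of "(a,c)"]] ab cd by simp
    have lipP: "\<bar>P (s,t) - P (s,t0)\<bar> \<le> B * \<bar>t - t0\<bar>" if "s \<in> {a..b}" "t \<in> {c<..<d}" for s t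
    proof -
      have "norm (P (s,t) - P (s,t0)) \<le> B * norm (t - t0)"
      proof (rule field_differentiable_bound[of "{c<..<d}" "\<lambda>t. P (s,t)" "\<lambda>t. Pt (s,t)"])
        show "((\<lambda>t. P (s, t)) has_real_derivative Pt (s, z)) (at z within {c<..<d})"
          if "z \<in> {c<..<d}" for z
          using Pt[OF \<open>s \<in> {a..b}\<close> that] by (rule has_field_derivative_at_within)
        show "norm (Pt (s,z)) \<le> B" if "z \<in> {c<..<d}" for z
          using B[of "(s,z)"] that \<open>s \<in> {a..b}\<close> by auto
      qed (use that t0 in auto)
      then show ?thesis by simp
    qed
    have derR: "(R has_real_derivative 0) (at t0 within {c<..<d})"
    proof -
      have R0: "R t0 = 0" by (simp add: R_def)
      have "((\<lambda>t. (R t - R t0) / (t - t0)) \<longlongrightarrow> 0) (at t0 within {c<..<d})"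
      proof (rule tendstoI)
        fix \<epsilon> :: real assume \<epsilon>: "\<epsilon> > 0"
        \<comment> \<open>The summands \<open>+ 1\<close> keep the denominator positive when
          \<open>B = 0\<close> or \<open>a = b\<close>; the factor 2 turns the final weak estimate
          into a strict one.\<close>
        define \<epsilon>' where "\<epsilon>' = \<epsilon> / (2 * (B + 1) * (b - a + 1))"
        have \<epsilon>': "\<epsilon>' > 0" using \<epsilon> B0 ab by (simp add: \<epsilon>'_def)
        have "uniformly_continuous_on (cbox (a,c) (b,d)) qs"
          by (rule compact_uniformly_continuous[OF cont(5) compact_cbox])
        then obtain \<delta> where \<delta>: "\<delta> > 0" and uc: "\<And>z z'. z \<in> cbox (a,c) (b,d) \<Longrightarrow>
            z' \<in> cbox (a,c) (b,d) \<Longrightarrow> dist z' z < \<delta> \<Longrightarrow> dist (qs z') (qs z) < \<epsilon>'"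
          unfolding uniformly_continuous_on_def using \<epsilon>' by metis
        have "dist ((R t - R t0) / (t - t0)) 0 < \<epsilon>"
          if t: "t \<in> {c<..<d}" "t \<noteq> t0" "dist t t0 < \<delta>" for t
        proof -
          have t': "t \<in> {c..d}" using t by auto
          have "norm (R t) \<le> integral {a..b} (\<lambda>s. B * \<bar>t - t0\<bar> * \<epsilon>')"
            unfolding R_def
          proof (rule integral_norm_bound_integral)
            show "(\<lambda>s. (P (s, t) - P (s, t0)) * (qs (s, t) - qs (s, t0))) integrable_on {a..b}"
              by (intro integrable_continuous_interval continuous_intros sl cont t' t0')
            fix s assume s: "s \<in> {a..b}"
            have "\<bar>qs (s,t) - qs (s,t0)\<bar> \<le> \<epsilon>'"
              using uc[of "(s,t0)" "(s,t)"] s t t0 by (auto simp: dist_Pair_Pair dist_real_def)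
            then show "norm ((P (s, t) - P (s, t0)) * (qs (s, t) - qs (s, t0))) \<le> B * \<bar>t - t0\<bar> * \<epsilon>'"
              using lipP[OF s t(1)] unfolding real_norm_def abs_mult by (intro mult_mono) auto
          qed auto
          also have "\<dots> = (b - a) * (B * \<bar>t - t0\<bar> * \<epsilon>')" using ab by simp
          finally have "\<bar>R t / (t - t0)\<bar> \<le> (b - a) * B * \<epsilon>'"
            using t(2) by (simp add: field_simps)
          also have "\<dots> \<le> (b - a + 1) * (B + 1) * \<epsilon>'"
            using ab B0 \<epsilon>' by (intro mult_mono) auto
          also have "\<dots> = \<epsilon> / 2"
          proof -
            have "x * y * (\<epsilon> / (2 * y * x)) = \<epsilon> / 2" if "x \<noteq> 0" "y \<noteq> 0" for x y
              using that by (simp add: field_simps)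
            then show ?thesis
              unfolding \<epsilon>'_def by this (use ab B0 in auto)
          qed
          finally have "\<bar>R t / (t - t0)\<bar> < \<epsilon>" using \<epsilon> by linarith
          then show ?thesis using R0 by (simp add: dist_real_def)
        qed
        then show "\<forall>\<^sub>F t in at t0 within {c<..<d}. dist ((R t - R t0) / (t - t0)) 0 < \<epsilon>"
          unfolding eventually_at using \<delta> by blast
      qed
      then show ?thesis by (simp add: has_field_derivative_iff)
    qed
    have "((\<lambda>t. K t + (R t - I t0)) has_real_derivative D t0 + (0 - 0)) (at t0 within {c<..<d})"
      by (intro derivative_intros derK derR)
    then have "(I has_real_derivative D t0) (at t0 within {c<..<d})"
      using has_derivative_transform[OF t0 IKR] unfolding has_field_derivative_def by simp
    then show ?thesis using t0 at_within_open[of t0 "{c<..<d}"] by simp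
  qed
  \<comment> \<open>\<open>I\<close> is differentiated at interior heights and merely continuous at
    the ends: on the top edge the functions will be known only as continuous extensions.\<close>
  have "(D has_integral (I d - I c)) {c..d}"
    using derI contI has_real_derivative_iff_has_vector_derivative
    by (intro fundamental_theorem_of_calculus_interior[OF cd]) auto
  moreover have "I c = 0"
    unfolding I_def using bottom by (subst integral_cong[where g = "\<lambda>_. 0"]) auto
  ultimately have "integral {c..d} D = I d" by (simp add: integral_unique)
  moreover have "integral (cbox (a,c) (b,d)) (\<lambda>z. Ps z * qt z - Pt z * qs z) = - integral {c..d} D"
  proof -
    have c1: "continuous_on (cbox (a,c) (b,d)) (\<lambda>z. Ps z * qt z - Pt z * qs z)"
      by (intro continuous_intros cont)
    then have "integral (cbox (a,c) (b,d)) (\<lambda>z. Ps z * qt z - Pt z * qs z) =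
        integral (cbox a b) (\<lambda>s. integral (cbox c d) (\<lambda>t. Ps (s,t) * qt (s,t) - Pt (s,t) * qs (s,t)))"
      by (subst integral_prod_continuous) auto
    also have "\<dots> = integral (cbox c d) (\<lambda>t. integral (cbox a b) (\<lambda>s. Ps (s,t) * qt (s,t) - Pt (s,t) * qs (s,t)))"
      by (rule integral_swap_continuous) (use c1 in \<open>simp add: case_prod_unfold\<close>)
    also have "\<dots> = integral {c..d} (\<lambda>t. - D t)"
      unfolding D_def by (simp flip: integral_neg)
    finally show ?thesis by simp
  qed
  ultimately show ?thesis by (simp add: I_def)
qed

section \<open>Area preserving maps\<close>

text \<open>Expressed by push-forward of Lebesgue measure, the notion is closed under composition
  and gives the substitution rule for integrals without a Jacobian.\<close>

definition area_preserving :: "(real \<times> real \<Rightarrow> real \<times> real) \<Rightarrow> bool" where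
  "area_preserving F \<longleftrightarrow> F \<in> borel_measurable borel \<and> distr lborel borel F = lborel"

lemma area_preserving_compose:
  assumes "area_preserving F" "area_preserving G"
  shows "area_preserving (\<lambda>z. F (G z))"
proof -
  have m: "F \<in> borel_measurable borel" "G \<in> borel_measurable borel"
    using assms by (auto simp: area_preserving_def)
  have "distr lborel borel (\<lambda>z. F (G z)) = distr (distr lborel borel G) borel F"
    using m by (subst distr_distr) (auto simp: o_def)
  then show ?thesis
    using assms m by (auto simp: area_preserving_def)
qed

lemma area_preserving_swap: "area_preserving (\<lambda>z. (snd z, fst z))"
proof -
  have "distr (lborel \<Otimes>\<^sub>M lborel) (lborel \<Otimes>\<^sub>M lborel) (\<lambda>z. (snd z, fst z)) =
      (lborel \<Otimes>\<^sub>M lborel :: (real \<times> real) measure)"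
    using lborel_pair.distr_pair_swap[where ?'a = real and ?'b = real] by (simp add: case_prod_unfold)
  then have "distr lborel lborel (\<lambda>z. (snd z, fst z)) = (lborel :: (real \<times> real) measure)"
    by (simp add: lborel_prod)
  moreover have "distr lborel lborel (\<lambda>z. (snd z, fst z)) =
      distr (lborel :: (real \<times> real) measure) (borel :: (real \<times> real) measure) (\<lambda>z. (snd z, fst z))"
    by (rule distr_cong) auto
  ultimately show ?thesis
    unfolding area_preserving_def by (auto intro!: borel_measurable_continuous_onI continuous_intros)
qed

text \<open>By Fubini it suffices to look at the vertical lines, on each of which the map is a
  translation; hence measurability of \<open>g\<close> is enough.\<close>

lemma area_preserving_shear:
  fixes g :: "real \<Rightarrow> real"
  assumes [measurable]: "g \<in> borel_measurable borel"
  shows "area_preserving (\<lambda>z. (fst z, g (fst z) + snd z))"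
proof -
  have m[measurable]: "(\<lambda>z::real\<times>real. (fst z, g (fst z) + snd z)) \<in> borel_measurable borel"
    unfolding borel_prod[symmetric] by measurable
  have "distr lborel borel (\<lambda>z::real\<times>real. (fst z, g (fst z) + snd z)) = lborel"
  proof (rule measure_eqI)
    fix A :: "(real \<times> real) set"
    assume "A \<in> sets (distr lborel borel (\<lambda>z::real\<times>real. (fst z, g (fst z) + snd z)))"
    then have A: "A \<in> sets borel" by simp
    have A'[measurable]: "A \<in> sets ((borel :: real measure) \<Otimes>\<^sub>M (borel :: real measure))"
      using A by (subst borel_prod)
    have "emeasure (distr lborel borel (\<lambda>z. (fst z, g (fst z) + snd z))) A =
        (\<integral>\<^sup>+z. indicator A z \<partial>distr lborel borel (\<lambda>z. (fst z, g (fst z) + snd z)))"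
      using A by (subst nn_integral_indicator) auto
    also have "\<dots> = (\<integral>\<^sup>+z. indicator A (fst z, g (fst z) + snd z) \<partial>lborel)"
      using A by (intro nn_integral_distr) auto
    also have "\<dots> = (\<integral>\<^sup>+z. indicator A (fst z, g (fst z) + snd z) \<partial>(lborel \<Otimes>\<^sub>M lborel))"
      unfolding lborel_prod ..
    also have "\<dots> = (\<integral>\<^sup>+s. \<integral>\<^sup>+t. indicator A (s, g s + t) \<partial>lborel \<partial>lborel)"
      by (subst lborel.nn_integral_fst[symmetric]) simp_all
    also have "\<dots> = (\<integral>\<^sup>+s. \<integral>\<^sup>+t. indicator A (s, t) \<partial>lborel \<partial>lborel)"
    proof (rule nn_integral_cong)
      fix s :: real
      show "(\<integral>\<^sup>+t. indicator A (s, g s + t) \<partial>lborel) = (\<integral>\<^sup>+t. indicator A (s, t) \<partial>lborel)"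
        using nn_integral_real_affine[of "\<lambda>t. indicator A (s, t)" 1 "g s"] by simp
    qed
    also have "\<dots> = emeasure (lborel \<Otimes>\<^sub>M lborel) A"
      by (subst lborel.nn_integral_fst) simp_all
    finally show "emeasure (distr lborel borel (\<lambda>z. (fst z, g (fst z) + snd z))) A = emeasure lborel A"
      by (simp add: lborel_prod)
  qed simp
  then show ?thesis by (simp add: area_preserving_def)
qed

lemma area_preserving_horizontal_shear:
  "area_preserving (\<lambda>z. (fst z + m * snd z, snd z))"
proof -
  have "area_preserving (\<lambda>z. (fst z, m * fst z + snd z))"
    by (rule area_preserving_shear) auto
  from area_preserving_compose[OF area_preserving_swap
      area_preserving_compose[OF this area_preserving_swap]]
  show ?thesis by (simp add: add.commute)
qed

text \<open>A rotation is a product of three shears, unless it is the identity or a half turn.\<close>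

lemma area_preserving_rotation:
  fixes c d :: real
  assumes "c\<^sup>2 + d\<^sup>2 = 1"
  shows "area_preserving (\<lambda>z. (fst z * c - snd z * d, fst z * d + snd z * c))"
proof -
  have main: "area_preserving (\<lambda>z. (fst z * c - snd z * d, fst z * d + snd z * c))"
    if cd: "c\<^sup>2 + d\<^sup>2 = 1" and d: "d \<noteq> 0" for c d :: real
  proof -
    \<comment> \<open>For \<open>c = cos \<theta>\<close> and \<open>d = sin \<theta>\<close> this
      is \<open>- tan (\<theta> / 2)\<close>, the slope for which a horizontal, a vertical and a
      horizontal shear with slopes \<open>m\<close>, \<open>d\<close>, \<open>m\<close> compose to
      the rotation.\<close>
    define m where "m = (c - 1) / d"
    have md: "m * d = c - 1" using d by (simp add: m_def)
    have mc: "m + m * c = - d"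
    proof -
      have "(c - 1) * (1 + c) = - (d * d)" using cd by (simp add: power2_eq_square algebra_simps)
      then have "(c - 1) * (1 + c) / d = - d" using d by simp
      then show ?thesis by (simp add: m_def distrib_left algebra_simps add_divide_distrib diff_divide_distrib)
    qed
    have "area_preserving (\<lambda>z. (fst z, d * fst z + snd z))"
      by (rule area_preserving_shear) auto
    from area_preserving_compose[OF area_preserving_horizontal_shear[of m]
        area_preserving_compose[OF this area_preserving_horizontal_shear[of m]]]
    have "area_preserving (\<lambda>z. (fst z + m * snd z + m * (d * (fst z + m * snd z) + snd z),
        d * (fst z + m * snd z) + snd z))" by simp
    also have "(\<lambda>z. (fst z + m * snd z + m * (d * (fst z + m * snd z) + snd z),
        d * (fst z + m * snd z) + snd z)) = (\<lambda>z. (fst z * c - snd z * d, fst z * d + snd z * c))"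
    proof (rule ext)
      fix z :: "real \<times> real"
      have 2: "d * (fst z + m * snd z) + snd z = fst z * d + snd z * c"
      proof -
        have "d * (fst z + m * snd z) + snd z = fst z * d + (m * d + 1) * snd z"
          by (simp add: algebra_simps)
        then show ?thesis by (simp add: md)
      qed
      have 1: "fst z + m * snd z + m * (fst z * d + snd z * c) = fst z * c - snd z * d"
      proof -
        have "fst z + m * snd z + m * (fst z * d + snd z * c) =
            fst z * (1 + m * d) + snd z * (m + m * c)"
          by (simp add: algebra_simps)
        then show ?thesis by (simp add: md mc)
      qed
      show "(fst z + m * snd z + m * (d * (fst z + m * snd z) + snd z),
        d * (fst z + m * snd z) + snd z) = (fst z * c - snd z * d, fst z * d + snd z * c)"
        unfolding 2 1 ..
    qed
    finally show ?thesis .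
  qed
  show ?thesis
  proof (cases "d = 0")
    case True
    then have "c = 1 \<or> c = -1" using assms by (simp add: power2_eq_1_iff)
    moreover have "area_preserving (\<lambda>z. z)"
      by (simp add: area_preserving_def distr_id2)
    \<comment> \<open>A half turn is two quarter turns, each of which is covered by the three
      shears.\<close>
    moreover have "area_preserving (\<lambda>z. (- fst z, - snd z))"
      using area_preserving_compose[OF main[of 0 1] main[of 0 1]] by simp
    ultimately show ?thesis using True by auto
  qed (use main assms in blast)
qed

text \<open>The counterclockwise quarter turn. It takes the outer normal to the unit tangent with
  the domain on the left, and \<open>rot90 x \<bullet> y\<close> is the determinant of
  \<open>x\<close> and \<open>y\<close>, so \<open>rot90 (gP x) \<bullet> gq x\<close> is the
  density of the form in Green's formula.\<close>

definition rot90 :: "real \<times> real \<Rightarrow> real \<times> real" where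
  "rot90 v = (- snd v, fst v)"

text \<open>These coordinates flatten the boundary: the graph of \<open>h\<close> in the frame
  \<open>e\<close>, \<open>rot90 e\<close> becomes the line of height 0. They consist of a vertical
  shear followed by the rotation that takes the first axis to \<open>e\<close>.\<close>

lemma area_preserving_graph_coordinates:
  assumes e: "norm e = 1" and h: "h \<in> borel_measurable borel"
  shows "area_preserving (\<lambda>z. fst z *\<^sub>R e + (h (fst z) + snd z) *\<^sub>R rot90 e)"
proof -
  obtain c d where cd: "e = (c, d)" by (cases e)
  have "c\<^sup>2 + d\<^sup>2 = 1" using e by (simp add: cd norm_Pair)
  from area_preserving_compose[OF area_preserving_rotation[OF this] area_preserving_shear[OF h]]
  show ?thesis by (simp add: cd rot90_def algebra_simps)
qed

section \<open>Integrals with respect to arc length\<close>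

text \<open>\<open>arc_length_measure\<close> speaks of arcs over \<open>{0..1}\<close>; an affine
  substitution carries the length formula to any nondegenerate parameter interval.\<close>

lemma arc_length_measure_subinterval:
  fixes \<gamma> :: "real \<Rightarrow> real \<times> real"
  assumes \<sigma>: "arc_length_measure \<Gamma> \<sigma>"
    and \<gamma>: "\<And>s. (\<gamma> has_vector_derivative \<gamma>' s) (at s)" "continuous_on UNIV \<gamma>'"
    and "inj \<gamma>" "c < d" "\<gamma> ` {c..d} \<subseteq> \<Gamma>"
  shows "emeasure \<sigma> (\<gamma> ` {c..d}) = ennreal (integral {c..d} (\<lambda>s. norm (\<gamma>' s)))"
proof -
  define l where "l = (\<lambda>t. (d - c) * t + c)"
  define g where "g = (\<lambda>t. \<gamma> (l t))"
  have l01: "l ` {0..1} = {c..d}"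
    unfolding l_def using \<open>c < d\<close> by (subst image_affinity_atLeastAtMost) auto
  have der: "(g has_vector_derivative (d - c) *\<^sub>R \<gamma>' (l t)) (at t)" for t
  proof -
    have "(l has_vector_derivative (d - c)) (at t)"
      unfolding l_def has_real_derivative_iff_has_vector_derivative[symmetric]
      by (auto intro!: derivative_eq_intros)
    from vector_diff_chain_at[OF this \<gamma>(1)] show ?thesis by (simp add: g_def o_def)
  qed
  have cont: "continuous_on S (\<lambda>t. \<gamma>' (l t))" for S
    unfolding l_def by (intro continuous_on_compose2[OF \<gamma>(2)] continuous_intros) auto
  have C1: "g C1_differentiable_on {0..1}"
    unfolding C1_differentiable_on_def using der
    by (intro exI[of _ "\<lambda>t. (d - c) *\<^sub>R \<gamma>' (l t)"]) (auto intro!: continuous_intros cont)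
  have "continuous_on {0..1} g"
    using der by (meson continuous_at_imp_continuous_on has_vector_derivative_continuous)
  moreover have "inj_on g {0..1}"
    using \<open>c < d\<close> by (auto simp: inj_on_def g_def l_def dest!: injD[OF \<open>inj \<gamma>\<close>])
  ultimately have "arc g" by (simp add: arc_def path_def)
  moreover have pi: "path_image g = \<gamma> ` {c..d}"
    unfolding path_image_def g_def l01[symmetric] by auto
  ultimately have "emeasure \<sigma> (\<gamma> ` {c..d}) =
      ennreal (integral {0..1} (\<lambda>t. norm (vector_derivative g (at t))))"
    using \<sigma> C1 assms(6) unfolding arc_length_measure_def by metis
  also have "integral {0..1} (\<lambda>t. norm (vector_derivative g (at t))) =
      integral {0..1} (\<lambda>t. (d - c) *\<^sub>R norm (\<gamma>' (l t)))"
    using der \<open>c < d\<close> by (intro integral_cong) (simp add: vector_derivative_at[OF der])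
  also have "\<dots> = integral {l 0..l 1} (\<lambda>s. norm (\<gamma>' s))"
  proof (rule integral_unique)
    have c: "continuous_on S (\<lambda>s. norm (\<gamma>' s))" for S
      by (intro continuous_intros continuous_on_subset[OF \<gamma>(2)]) auto
    show "((\<lambda>t. (d - c) *\<^sub>R norm (\<gamma>' (l t))) has_integral integral {l 0..l 1} (\<lambda>s. norm (\<gamma>' s))) {0..1}"
      using \<open>c < d\<close> c l01
      by (intro has_integral_substitution[where c = c and d = d])
        (auto simp: l_def intro!: derivative_eq_intros)
  qed
  finally show ?thesis by (simp add: l_def)
qed

text \<open>As \<open>\<sigma>\<close> is known only on arcs, it is transported to the line.
  \<open>L\<close> inverts \<open>\<gamma>\<close>, and the image under \<open>L\<close> of
  \<open>\<sigma>\<close> restricted to the arc is compared with the measure of density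
  \<open>norm (\<gamma>' s)\<close> on \<open>{a..b}\<close>. Closed rays correspond to subarcs, so
  the two measures agree on them, and therefore everywhere.\<close>

lemma arc_length_measure_integral:
  fixes \<gamma> :: "real \<Rightarrow> real \<times> real" and g :: "real \<times> real \<Rightarrow> real"
  assumes \<sigma>: "arc_length_measure \<Gamma> \<sigma>"
    and \<gamma>: "\<And>s. (\<gamma> has_vector_derivative \<gamma>' s) (at s)" "continuous_on UNIV \<gamma>'"
    and L: "continuous_on UNIV L" "\<And>s. L (\<gamma> s) = s"
    and ab: "a < b" and sub: "\<gamma> ` {a..b} \<subseteq> \<Gamma>"
    and g: "continuous_on (\<gamma> ` {a..b}) g"
  shows "set_integrable \<sigma> (\<gamma> ` {a..b}) g"
    and "(LINT x:\<gamma> ` {a..b}|\<sigma>. g x) = integral {a..b} (\<lambda>s. g (\<gamma> s) * norm (\<gamma>' s))"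
proof -
  define C where "C = \<gamma> ` {a..b}"
  define M where "M = distr (density \<sigma> (indicator C)) borel L"
  define N where "N = density lborel (\<lambda>s. ennreal (indicator {a..b} s * norm (\<gamma>' s)))"
  define G where "G = (\<lambda>s. indicator {a..b} s *\<^sub>R g (\<gamma> s))"
  have contg: "continuous_on S \<gamma>" for S
    using \<gamma>(1) by (meson continuous_at_imp_continuous_on has_vector_derivative_continuous)
  have "compact C" unfolding C_def by (intro compact_continuous_image contg) auto
  then have C[measurable]: "C \<in> sets borel" by (simp add: borel_compact)
  have s\<sigma>[measurable_cong]: "sets \<sigma> = sets borel" using \<sigma> by (simp add: arc_length_measure_def)
  have L'[measurable]: "L \<in> borel_measurable borel" by (rule borel_measurable_continuous_onI[OF L(1)])
  have \<gamma>''[measurable]: "\<gamma>' \<in> borel_measurable borel"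
    by (rule borel_measurable_continuous_onI[OF \<gamma>(2)])
  have "inj \<gamma>" using L(2) by (metis injI)
  have eM: "emeasure M A = emeasure \<sigma> (C \<inter> L -` A)" if [measurable]: "A \<in> sets borel" for A
  proof -
    have "emeasure M A = emeasure (density \<sigma> (indicator C)) (L -` A \<inter> space \<sigma>)"
      unfolding M_def by (subst emeasure_distr) auto
    also have "\<dots> = emeasure \<sigma> (C \<inter> (L -` A \<inter> space \<sigma>))"
      by (subst emeasure_density) (simp_all add: indicator_inter_arith[symmetric])
    finally show ?thesis using sets_eq_imp_space_eq[OF s\<sigma>] by simp
  qed
  have M: "emeasure M {c..} = ennreal (integral {max a c..b} (\<lambda>s. norm (\<gamma>' s)))" if "c < b" for c
  proof -
    have "emeasure M {c..} = emeasure \<sigma> (C \<inter> L -` {c..})" by (simp add: eM)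
    also have "C \<inter> L -` {c..} = \<gamma> ` {max a c..b}" using L(2) by (auto simp: C_def)
    also have "emeasure \<sigma> \<dots> = ennreal (integral {max a c..b} (\<lambda>s. norm (\<gamma>' s)))"
      by (rule arc_length_measure_subinterval[OF \<sigma> \<gamma> \<open>inj \<gamma>\<close>]) (use ab that sub in auto)
    finally show ?thesis .
  qed
  have N: "emeasure N {c..} = ennreal (integral {max a c..b} (\<lambda>s. norm (\<gamma>' s)))" for c
  proof -
    have "emeasure N {c..} = (\<integral>\<^sup>+s. ennreal (indicator {max a c..b} s * norm (\<gamma>' s)) \<partial>lborel)"
      unfolding N_def by (subst emeasure_density) (auto intro!: nn_integral_cong simp: indicator_def)
    also have "\<dots> = ennreal (integral {max a c..b} (\<lambda>s. norm (\<gamma>' s)))"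
    proof (rule nn_integral_has_integral_lborel)
      have "continuous_on {max a c..b} (\<lambda>s. norm (\<gamma>' s))"
        by (intro continuous_intros continuous_on_subset[OF \<gamma>(2)]) auto
      then have "((\<lambda>s. norm (\<gamma>' s)) has_integral integral {max a c..b} (\<lambda>s. norm (\<gamma>' s))) {max a c..b}"
        by (intro integrable_integral integrable_continuous_interval)
      then have "((\<lambda>s. if s \<in> {max a c..b} then norm (\<gamma>' s) else 0) has_integral
          integral {max a c..b} (\<lambda>s. norm (\<gamma>' s))) UNIV"
        by (subst has_integral_restrict_UNIV)
      then show "((\<lambda>s. indicator {max a c..b} s * norm (\<gamma>' s)) has_integral
          integral {max a c..b} (\<lambda>s. norm (\<gamma>' s))) UNIV"
        by (rule has_integral_eq[rotated]) (auto simp: indicator_def)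
    qed auto
    finally show ?thesis .
  qed
  have MN: "M = N"
  proof (rule measure_eqI_lessThan)
    show sM: "sets M = sets borel" and sN: "sets N = sets borel" by (simp_all add: M_def N_def)
    fix x
    have "emeasure M {x<..} \<le> emeasure M UNIV"
      by (intro emeasure_mono) (auto simp: sM)
    also have "emeasure M UNIV = emeasure M {a..}"
    proof -
      have "emeasure M UNIV = emeasure \<sigma> C"
        by (simp add: eM)
      also have "\<dots> = emeasure M {a..}"
        unfolding M[OF ab] C_def using arc_length_measure_subinterval[OF \<sigma> \<gamma> \<open>inj \<gamma>\<close> ab sub] by simp
      finally show ?thesis .
    qed
    also have "\<dots> < \<infinity>" by (simp add: M[OF ab])
    finally show "emeasure M {x<..} < \<infinity>" .
    show "emeasure M {x<..} = emeasure N {x<..}"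
    proof (cases "x < b")
      case True
      \<comment> \<open>The closed rays from \<open>c k\<close> exhaust \<open>{x<..}\<close>. The
        offset 2 keeps \<open>c k\<close> strictly below \<open>b\<close>, where the ray cuts out a
        nondegenerate subarc and its measure is known.\<close>
      define c where "c = (\<lambda>k. x + (b - x) / (real k + 2))"
      have c: "c k < b" for k
      proof -
        have "(b - x) / (real k + 2) \<le> (b - x) / 2" using True by (intro divide_left_mono) auto
        then show ?thesis using True by (simp add: c_def field_simps)
      qed
      have U: "{x<..} = (\<Union>k. {c k..})"
      proof (intro equalityI subsetI)
        fix y assume "y \<in> {x<..}"
        then have "y > x" by simp
        obtain k where "(b - x) / (y - x) < real k" using reals_Archimedean2 by blast
        then have "b - x < real k * (y - x)" using \<open>y > x\<close> by (simp add: field_simps)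
        also have "\<dots> \<le> (real k + 2) * (y - x)" using \<open>y > x\<close> by (intro mult_right_mono) auto
        finally have "(b - x) / (real k + 2) < y - x" by (subst pos_divide_less_eq) (auto simp: mult.commute)
        then show "y \<in> (\<Union>k. {c k..})" by (auto simp: c_def intro!: exI[of _ k])
      next
        fix y assume "y \<in> (\<Union>k. {c k..})"
        then obtain k where "c k \<le> y" by auto
        moreover have "x < c k" using True by (auto simp: c_def)
        ultimately show "y \<in> {x<..}" by simp
      qed
      have inc: "incseq (\<lambda>k. {c k..})"
        using True by (auto simp: incseq_def c_def intro!: divide_left_mono elim!: order_trans[rotated])
      have "emeasure M {x<..} = (SUP k. emeasure M {c k..})"
        unfolding U using inc by (subst SUP_emeasure_incseq) (auto simp: sM)
      also have "\<dots> = (SUP k. emeasure N {c k..})"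
        using M[OF c] N by simp
      also have "\<dots> = emeasure N {x<..}"
        unfolding U using inc by (subst SUP_emeasure_incseq) (auto simp: sN)
      finally show ?thesis .
    next
      case False
      have "emeasure M {x<..} = emeasure \<sigma> {}"
      proof -
        have "C \<inter> L -` {x<..} = {}" using False L(2) by (auto simp: C_def)
        then show ?thesis by (simp add: eM)
      qed
      moreover have "emeasure N {x<..} = 0"
        unfolding N_def using False
        by (subst emeasure_density)
           (auto simp: indicator_def intro!: nn_integral_0_iff_AE[THEN iffD2])
      ultimately show ?thesis by simp
    qed
  qed
  have Gm[measurable]: "G \<in> borel_measurable borel"
    unfolding G_def
    by (intro borel_measurable_continuous_on_indicator continuous_on_compose2[OF g contg]) auto
  have GL: "indicator C x *\<^sub>R G (L x) = indicator C x *\<^sub>R g x" for x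
    using L(2) by (auto simp: C_def G_def indicator_def)
  have intN: "integrable N G" and valN: "integral\<^sup>L N G = integral {a..b} (\<lambda>s. g (\<gamma> s) * norm (\<gamma>' s))"
  proof -
    have c: "continuous_on {a..b} (\<lambda>s. g (\<gamma> s) * norm (\<gamma>' s))"
      by (intro continuous_intros continuous_on_compose2[OF g contg] continuous_on_subset[OF \<gamma>(2)]) auto
    have eq: "(\<lambda>s. (indicator {a..b} s * norm (\<gamma>' s)) *\<^sub>R G s) =
        (\<lambda>s. indicator {a..b} s *\<^sub>R (g (\<gamma> s) * norm (\<gamma>' s)))"
      by (auto simp: G_def indicator_def)
    have i: "set_integrable lborel {a..b} (\<lambda>s. g (\<gamma> s) * norm (\<gamma>' s))"
      by (rule borel_integrable_atLeastAtMost'[OF c])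
    show "integrable N G"
      unfolding N_def using i by (subst integrable_density) (auto simp: eq[unfolded real_scaleR_def] set_integrable_def)
    have "integral\<^sup>L N G = (LINT s:{a..b}|lborel. g (\<gamma> s) * norm (\<gamma>' s))"
      unfolding N_def set_lebesgue_integral_def by (subst integral_density) (auto simp: eq[unfolded real_scaleR_def])
    then show "integral\<^sup>L N G = integral {a..b} (\<lambda>s. g (\<gamma> s) * norm (\<gamma>' s))"
      using set_borel_integral_eq_integral[OF i] by simp
  qed
  have "integrable (density \<sigma> (indicator C)) (\<lambda>x. G (L x))"
    using intN unfolding MN[symmetric] M_def by (subst (asm) integrable_distr_eq) auto
  then have "integrable \<sigma> (\<lambda>x. indicator C x *\<^sub>R G (L x))"
    using integrable_density[of "\<lambda>x. G (L x)" \<sigma> "indicator C"] by (simp add: ennreal_indicator)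
  then show "set_integrable \<sigma> (\<gamma> ` {a..b}) g"
    unfolding set_integrable_def GL by (simp add: C_def)
  have "(LINT x:\<gamma> ` {a..b}|\<sigma>. g x) = (LINT x|\<sigma>. indicator C x *\<^sub>R G (L x))"
    unfolding set_lebesgue_integral_def GL by (simp add: C_def)
  also have "\<dots> = (LINT x|density \<sigma> (indicator C). G (L x))"
    using integral_density[of "\<lambda>x. G (L x)" \<sigma> "indicator C"] by (simp add: ennreal_indicator)
  also have "\<dots> = integral\<^sup>L M G"
    unfolding M_def by (subst integral_distr) auto
  finally show "(LINT x:\<gamma> ` {a..b}|\<sigma>. g x) = integral {a..b} (\<lambda>s. g (\<gamma> s) * norm (\<gamma>' s))"
    by (simp add: MN valN)
qed

section \<open>Green's formula near a boundary point\<close>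

lemma inner_rot90 [simp]: "rot90 x \<bullet> rot90 y = x \<bullet> y" "x \<bullet> rot90 x = 0" "rot90 x \<bullet> x = 0"
  by (cases x; cases y; simp add: rot90_def)+

lemma norm_rot90 [simp]: "norm (rot90 x) = norm x"
  by (simp add: norm_eq_sqrt_inner)

lemma rot90_simps [simp]:
  "rot90 0 = 0" "rot90 (x + y) = rot90 x + rot90 y" "rot90 (r *\<^sub>R x) = r *\<^sub>R rot90 x"
  "rot90 (- x) = - rot90 x" "rot90 (x - y) = rot90 x - rot90 y" "rot90 (rot90 x) = - x"
  by (simp_all add: rot90_def prod_eq_iff)

text \<open>The determinant of two vectors is the same in every positively oriented orthonormal
  frame.\<close>

lemma inner_rot90_rotated_basis:
  assumes "norm e = 1"
  shows "rot90 x \<bullet> y = (x \<bullet> e) * (y \<bullet> rot90 e) - (x \<bullet> rot90 e) * (y \<bullet> e)"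
proof -
  obtain e1 e2 x1 x2 y1 y2 where [simp]: "e = (e1, e2)" "x = (x1, x2)" "y = (y1, y2)"
    by (cases e; cases x; cases y)
  have 1: "e1\<^sup>2 + e2\<^sup>2 = 1" using assms by (simp add: norm_Pair)
  have "(x1 * e1 + x2 * e2) * (- (y1 * e2) + y2 * e1) - (- (x1 * e2) + x2 * e1) * (y1 * e1 + y2 * e2)
     = (x1 * y2 - x2 * y1) * (e1\<^sup>2 + e2\<^sup>2)"
    by (simp add: algebra_simps power2_eq_square)
  then show ?thesis by (simp add: rot90_def 1)
qed

text \<open>\<open>g\<close> extends the gradient of \<open>p\<close> in the open set \<open>A\<close> continuously to \<open>C\<close>.\<close>

definition C1_on :: "'a::euclidean_space set \<Rightarrow> 'a set \<Rightarrow> ('a \<Rightarrow> real) \<Rightarrow> ('a \<Rightarrow> 'a) \<Rightarrow> bool" where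
  "C1_on C A p g \<longleftrightarrow> continuous_on C p \<and> continuous_on C g \<and>
     (\<forall>x\<in>A. (p has_derivative (\<lambda>v. g x \<bullet> v)) (at x))"

lemma mem_box_Pair_real:
  fixes a b c d :: real
  shows "z \<in> box (a,c) (b,d) \<longleftrightarrow> fst z \<in> {a<..<b} \<and> snd z \<in> {c<..<d}"
  by (cases z) (auto simp: box_def Basis_prod_def)

lemma has_real_derivative_along_curve:
  fixes p :: "'a::real_inner \<Rightarrow> real" and c :: "real \<Rightarrow> 'a"
  assumes "(p has_derivative (\<lambda>v. g \<bullet> v)) (at (c t))" "(c has_vector_derivative w) (at t)"
  shows "((\<lambda>t. p (c t)) has_real_derivative g \<bullet> w) (at t)"
proof -
  have "(\<lambda>v. g \<bullet> v) \<circ> (\<lambda>r. r *\<^sub>R w) = (*) (g \<bullet> w)" by (auto simp: fun_eq_iff)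
  then show ?thesis
    using diff_chain_at[OF assms(2)[unfolded has_vector_derivative_def] assms(1)]
    by (simp add: has_field_derivative_def o_def)
qed

text \<open>An open set \<open>V\<close> that meets \<open>\<Omega>\<close> only in the region of height \<open>- c\<close> below a graph. The second
  alternative in \<open>edge\<close> is for interior points, where the region is a square and \<open>V\<close> the
  inscribed disk.\<close>

locale graph_patch =
  fixes \<Omega> V :: "(real \<times> real) set" and e :: "real \<times> real"
    and h h' :: "real \<Rightarrow> real" and a b c :: real
  assumes open_dom: "open \<Omega>" and e: "norm e = 1"
    and h: "\<And>s. (h has_real_derivative h' s) (at s)" and h': "continuous_on UNIV h'"
    and ab: "a < b" and c: "c < 0"
    and inside: "\<And>s t. s \<in> {a..b} \<Longrightarrow> t \<in> {c..<0} \<Longrightarrow> s *\<^sub>R e + (h s + t) *\<^sub>R rot90 e \<in> \<Omega>"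
    and cover: "\<And>x. x \<in> V \<Longrightarrow> x \<in> \<Omega> \<Longrightarrow>
      \<exists>s\<in>{a<..<b}. \<exists>t\<in>{c<..<0}. x = s *\<^sub>R e + (h s + t) *\<^sub>R rot90 e"
    and cover_frontier: "\<And>x. x \<in> V \<Longrightarrow> x \<in> frontier \<Omega> \<Longrightarrow>
      \<exists>s\<in>{a<..<b}. x = s *\<^sub>R e + h s *\<^sub>R rot90 e"
    and edge: "(\<lambda>s. s *\<^sub>R e + h s *\<^sub>R rot90 e) ` {a..b} \<subseteq> frontier \<Omega> \<or>
      V \<inter> (\<lambda>s. s *\<^sub>R e + h s *\<^sub>R rot90 e) ` {a..b} = {}"
begin

definition \<Phi> :: "real \<times> real \<Rightarrow> real \<times> real" where
  "\<Phi> z = fst z *\<^sub>R e + (h (fst z) + snd z) *\<^sub>R rot90 e"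

definition \<gamma> :: "real \<Rightarrow> real \<times> real" where
  "\<gamma> s = s *\<^sub>R e + h s *\<^sub>R rot90 e"

definition \<gamma>' :: "real \<Rightarrow> real \<times> real" where
  "\<gamma>' s = e + h' s *\<^sub>R rot90 e"

lemma ee: "e \<bullet> e = 1"
  using e by (simp add: norm_eq_1)

lemma conth: "continuous_on S h"
  using h by (meson DERIV_isCont continuous_at_imp_continuous_on)

lemma \<Phi>_coords: "\<Phi> z \<bullet> e = fst z" "\<Phi> z \<bullet> rot90 e = h (fst z) + snd z"
  by (simp_all add: \<Phi>_def inner_add_left ee)

lemma inj_\<Phi>: "\<Phi> z = \<Phi> w \<Longrightarrow> z = w"
  by (metis \<Phi>_coords add_left_cancel prod.expand)

lemma cont_\<Phi>: "continuous_on S \<Phi>"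
  unfolding \<Phi>_def by (intro continuous_intros continuous_on_compose2[OF conth[of UNIV]]) auto

lemma \<gamma>_eq: "\<gamma> s = \<Phi> (s, 0)"
  by (simp add: \<gamma>_def \<Phi>_def)

lemma \<Phi>_closure: "z \<in> cbox (a,c) (b,0) \<Longrightarrow> \<Phi> z \<in> closure \<Omega>"
proof -
  assume z: "z \<in> cbox (a,c) (b,0)"
  have "\<Phi> ` closure (box (a,c) (b,0)) \<subseteq> closure \<Omega>"
  proof (rule image_closure_subset)
    show "\<Phi> ` box (a,c) (b,0) \<subseteq> closure \<Omega>"
      using inside closure_subset[of \<Omega>] by (auto simp: \<Phi>_def mem_box_Pair_real) 
  qed (auto intro: cont_\<Phi>)
  moreover have "closure (box (a,c) (b,0)) = cbox (a,c) (b,0)"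
    using ab c by (intro closure_box) (auto simp: box_ne_empty Basis_prod_def)
  ultimately show ?thesis using z by blast
qed

lemma \<Phi>_notin: "\<Phi> z \<notin> V \<inter> \<Omega>" if "z \<notin> box (a,c) (b,0)"
proof
  assume "\<Phi> z \<in> V \<inter> \<Omega>"
  then obtain s t where "s \<in> {a<..<b}" "t \<in> {c<..<0}" "\<Phi> z = \<Phi> (s,t)"
    using cover[of "\<Phi> z"] by (auto simp: \<Phi>_def)
  then show False using that inj_\<Phi>[of z "(s,t)"] by (auto simp: mem_box_Pair_real)
qed

lemma \<gamma>_deriv: "(\<gamma> has_vector_derivative \<gamma>' s) (at s)"
  unfolding \<gamma>_def \<gamma>'_def has_vector_derivative_def
  using h[of s, unfolded has_field_derivative_def]
  by (auto intro!: derivative_eq_intros simp: algebra_simps)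

lemma cont_\<gamma>': "continuous_on S \<gamma>'"
  unfolding \<gamma>'_def by (intro continuous_intros continuous_on_subset[OF h']) auto

lemma norm_\<gamma>': "norm (\<gamma>' s) = sqrt (1 + (h' s)\<^sup>2)"
  unfolding norm_eq_sqrt_inner \<gamma>'_def
  by (simp add: inner_add_left inner_add_right ee power2_eq_square inner_commute)

text \<open>As \<open>P\<close> and its gradient vanish off \<open>V\<close>, only the image of the
  box contributes. There \<open>\<Phi>\<close> preserves area and \<open>P\<close> vanishes on the
  sides and the bottom, so \<open>box_green\<close> leaves the integral over the top edge, which
  \<open>\<Phi>\<close> maps to the graph.\<close>

lemma green_graph_coordinates:
  assumes P: "C1_on (closure \<Omega>) \<Omega> P gP" and q: "C1_on (closure \<Omega>) \<Omega> q gq"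
    and P0: "\<And>x. x \<in> closure \<Omega> \<Longrightarrow> x \<notin> V \<Longrightarrow> P x = 0"
    and gP0: "\<And>x. x \<in> \<Omega> \<Longrightarrow> x \<notin> V \<Longrightarrow> gP x = 0"
  shows "(LINT x:\<Omega>|lborel. rot90 (gP x) \<bullet> gq x) = - integral {a..b} (\<lambda>s. P (\<gamma> s) * (gq (\<gamma> s) \<bullet> \<gamma>' s))"
proof -
  define W where "W = (\<lambda>x. rot90 (gP x) \<bullet> gq x)"
  define F where "F = (\<lambda>x. indicator \<Omega> x *\<^sub>R W x)"
  have contP: "continuous_on (closure \<Omega>) P" "continuous_on (closure \<Omega>) gP"
    and contq: "continuous_on (closure \<Omega>) q" "continuous_on (closure \<Omega>) gq"
    using P q by (auto simp: C1_on_def)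
  have contW: "continuous_on (closure \<Omega>) W"
    unfolding W_def rot90_def using contP contq by (intro continuous_intros)
  have \<Phi>c: "continuous_on (cbox (a,c) (b,0)) (\<lambda>z. G (\<Phi> z))" if "continuous_on (closure \<Omega>) G"
    for G :: "real \<times> real \<Rightarrow> 'z::topological_space"
    by (rule continuous_on_compose2[OF that cont_\<Phi>]) (use \<Phi>_closure in auto)
  have Fm[measurable]: "F \<in> borel_measurable borel"
    unfolding F_def using open_dom
    by (intro borel_measurable_continuous_on_indicator continuous_on_subset[OF contW] closure_subset) auto
  have ap: "area_preserving \<Phi>"
    unfolding \<Phi>_def
    by (rule area_preserving_graph_coordinates[OF e]) (intro borel_measurable_continuous_onI conth)
  then have [measurable]: "\<Phi> \<in> borel_measurable borel" by (simp add: area_preserving_def)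
  have "(LINT x:\<Omega>|lborel. rot90 (gP x) \<bullet> gq x) = integral\<^sup>L lborel F"
    by (simp add: set_lebesgue_integral_def F_def W_def)
  also have "\<dots> = integral\<^sup>L (distr lborel borel \<Phi>) F"
    using ap by (simp add: area_preserving_def)
  also have "\<dots> = (LINT z|lborel. F (\<Phi> z))"
    by (subst integral_distr) auto
  also have "\<dots> = (LINT z:box (a,c) (b,0)|lborel. W (\<Phi> z))"
    unfolding set_lebesgue_integral_def
  proof (rule Bochner_Integration.integral_cong)
    fix z
    show "F (\<Phi> z) = indicator (box (a,c) (b,0)) z *\<^sub>R W (\<Phi> z)"
    proof (cases "z \<in> box (a,c) (b,0)")
      case True
      then have "\<Phi> z \<in> \<Omega>" using inside[of "fst z" "snd z"] by (auto simp: \<Phi>_def mem_box_Pair_real)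
      then show ?thesis using True by (simp add: F_def)
    next
      case False
      from \<Phi>_notin[OF this] show ?thesis
        using False gP0[of "\<Phi> z"] by (auto simp: F_def W_def indicator_def)
    qed
  qed simp
  also have "\<dots> = integral (box (a,c) (b,0)) (\<lambda>z. W (\<Phi> z))"
  proof (rule set_borel_integral_eq_integral)
    have "set_integrable lborel (cbox (a,c) (b,0)) (\<lambda>z. W (\<Phi> z))"
      unfolding set_integrable_def by (rule borel_integrable_compact[OF compact_cbox \<Phi>c[OF contW]])
    then show "set_integrable lborel (box (a,c) (b,0)) (\<lambda>z. W (\<Phi> z))"
      by (rule set_integrable_subset) (auto simp: mem_box_Pair_real)
  qed
  also have "\<dots> = integral (cbox (a,c) (b,0)) (\<lambda>z. W (\<Phi> z))"
    by (rule integral_open_interval)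
  \<comment> \<open>The frame \<open>\<gamma>'\<close>, \<open>rot90 e\<close> is a shear of
    \<open>e\<close>, \<open>rot90 e\<close>, so the terms with \<open>h'\<close> cancel in the
    determinant. The components of the gradients in this frame are the derivatives in graph
    coordinates.\<close>
  also have "\<dots> = integral (cbox (a,c) (b,0)) (\<lambda>z.
      (gP (\<Phi> z) \<bullet> \<gamma>' (fst z)) * (gq (\<Phi> z) \<bullet> rot90 e) - (gP (\<Phi> z) \<bullet> rot90 e) * (gq (\<Phi> z) \<bullet> \<gamma>' (fst z)))"
  proof (rule arg_cong[where f = "integral _"], rule ext)
    fix z
    show "W (\<Phi> z) = (gP (\<Phi> z) \<bullet> \<gamma>' (fst z)) * (gq (\<Phi> z) \<bullet> rot90 e) -
        (gP (\<Phi> z) \<bullet> rot90 e) * (gq (\<Phi> z) \<bullet> \<gamma>' (fst z))"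
      unfolding W_def inner_rot90_rotated_basis[OF e, of "gP (\<Phi> z)"] \<gamma>'_def
      by (simp add: inner_add_right algebra_simps)
  qed
  also have "\<dots> = - integral {a..b} (\<lambda>s. P (\<Phi> (s,0)) * (gq (\<Phi> (s,0)) \<bullet> \<gamma>' (fst (s,0::real))))"
  proof (rule box_green[where P = "\<lambda>z. P (\<Phi> z)" and q = "\<lambda>z. q (\<Phi> z)"])
    have in\<Omega>: "\<Phi> (s,t) \<in> \<Omega>" if "s \<in> {a..b}" "t \<in> {c..<0}" for s t
      using inside[OF that] by (simp add: \<Phi>_def)
    have g'c: "continuous_on (cbox (a,c) (b,0)) (\<lambda>z. \<gamma>' (fst z))"
      by (intro continuous_on_compose2[OF cont_\<gamma>'[of UNIV]] continuous_intros) auto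
    show "continuous_on (cbox (a,c) (b,0)) (\<lambda>z. P (\<Phi> z))" by (rule \<Phi>c[OF contP(1)])
    show "continuous_on (cbox (a,c) (b,0)) (\<lambda>z. q (\<Phi> z))" by (rule \<Phi>c[OF contq(1)])
    show "continuous_on (cbox (a,c) (b,0)) (\<lambda>z. gP (\<Phi> z) \<bullet> \<gamma>' (fst z))"
      "continuous_on (cbox (a,c) (b,0)) (\<lambda>z. gq (\<Phi> z) \<bullet> \<gamma>' (fst z))"
      "continuous_on (cbox (a,c) (b,0)) (\<lambda>z. gP (\<Phi> z) \<bullet> rot90 e)"
      "continuous_on (cbox (a,c) (b,0)) (\<lambda>z. gq (\<Phi> z) \<bullet> rot90 e)"
      by (intro continuous_intros g'c \<Phi>c[OF contP(2)] \<Phi>c[OF contq(2)])+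
    have ders: "((\<lambda>s. p (\<Phi> (s,t))) has_real_derivative g (\<Phi> (s,t)) \<bullet> \<gamma>' (fst (s,t))) (at s within {a..b})"
      "((\<lambda>t. p (\<Phi> (s,t))) has_real_derivative g (\<Phi> (s,t)) \<bullet> rot90 e) (at t)"
      if "C1_on (closure \<Omega>) \<Omega> p g" "s \<in> {a..b}" "t \<in> {c<..<0}" for p g s t
    proof -
      have d: "(p has_derivative (\<lambda>v. g (\<Phi> (s,t)) \<bullet> v)) (at (\<Phi> (s,t)))"
        using that in\<Omega>[of s t] by (auto simp: C1_on_def)
      have "((\<lambda>s. \<Phi> (s,t)) has_vector_derivative \<gamma>' s) (at s)"
        unfolding \<Phi>_def \<gamma>'_def has_vector_derivative_def using h[of s, unfolded has_field_derivative_def]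
        by (auto intro!: derivative_eq_intros simp: algebra_simps)
      from has_real_derivative_along_curve[of p _ "\<lambda>s. \<Phi> (s,t)", OF d this]
      show "((\<lambda>s. p (\<Phi> (s,t))) has_real_derivative g (\<Phi> (s,t)) \<bullet> \<gamma>' (fst (s,t))) (at s within {a..b})"
        by (simp add: has_field_derivative_at_within)
      have "((\<lambda>t. \<Phi> (s,t)) has_vector_derivative rot90 e) (at t)"
        unfolding \<Phi>_def has_vector_derivative_def by (auto intro!: derivative_eq_intros simp: algebra_simps)
      from has_real_derivative_along_curve[of p _ "\<lambda>t. \<Phi> (s,t)", OF d this]
      show "((\<lambda>t. p (\<Phi> (s,t))) has_real_derivative g (\<Phi> (s,t)) \<bullet> rot90 e) (at t)" .
    qed
    show "((\<lambda>s. P (\<Phi> (s,t))) has_real_derivative gP (\<Phi> (s,t)) \<bullet> \<gamma>' (fst (s,t))) (at s within {a..b})"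
      "((\<lambda>t. P (\<Phi> (s,t))) has_real_derivative gP (\<Phi> (s,t)) \<bullet> rot90 e) (at t)"
      "((\<lambda>s. q (\<Phi> (s,t))) has_real_derivative gq (\<Phi> (s,t)) \<bullet> \<gamma>' (fst (s,t))) (at s within {a..b})"
      "((\<lambda>t. q (\<Phi> (s,t))) has_real_derivative gq (\<Phi> (s,t)) \<bullet> rot90 e) (at t)"
      if "s \<in> {a..b}" "t \<in> {c<..<0}" for s t
      using that ders[OF P] ders[OF q] by blast+
    \<comment> \<open>The sides and the bottom are mapped into \<open>\<Omega>\<close> but not into
      \<open>V\<close>, because \<open>cover\<close> places \<open>V \<inter> \<Omega>\<close> in
      the image of the open box.\<close>
    have zero: "P (\<Phi> z) = 0" if "z \<in> {a..b} \<times> {c..<0}" "z \<notin> box (a,c) (b,0)" for z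
    proof -
      have "\<Phi> z \<in> \<Omega>" using that in\<Omega>[of "fst z" "snd z"] by auto
      then show ?thesis
        using \<Phi>_notin[OF that(2)] P0[of "\<Phi> z"] closure_subset[of \<Omega>] by blast
    qed
    show "P (\<Phi> (a,t)) = 0" "P (\<Phi> (b,t)) = 0" if "t \<in> {c<..<0}" for t
      using zero[of "(a,t)"] zero[of "(b,t)"] that ab by (auto simp: mem_box_Pair_real)
    show "P (\<Phi> (s,c)) = 0" if "s \<in> {a..b}" for s
      using zero[of "(s,c)"] that c by (auto simp: mem_box_Pair_real)
  qed (use ab c in auto)
  finally show ?thesis by (simp add: \<gamma>_eq)
qed

text \<open>The coordinate along \<open>e\<close> is a continuous left inverse of
  \<open>\<gamma>\<close>, so the formula for arcs applies to the graph. In the other case of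
  \<open>edge\<close>, \<open>V\<close> contains no frontier point and the integrand vanishes on the
  whole frontier.\<close>

lemma boundary_integral:
  fixes g :: "real \<times> real \<Rightarrow> real"
  assumes \<sigma>: "arc_length_measure (frontier \<Omega>) \<sigma>"
    and g: "continuous_on (frontier \<Omega>) g" "\<And>x. x \<in> frontier \<Omega> \<Longrightarrow> x \<notin> V \<Longrightarrow> g x = 0"
  shows "set_integrable \<sigma> (frontier \<Omega>) g"
    and "\<gamma> ` {a..b} \<subseteq> frontier \<Omega> \<Longrightarrow>
      (LINT x:frontier \<Omega>|\<sigma>. g x) = integral {a..b} (\<lambda>s. g (\<gamma> s) * norm (\<gamma>' s))"
proof -
  have ind: "indicator (frontier \<Omega>) x *\<^sub>R g x = indicator (\<gamma> ` {a..b}) x *\<^sub>R g x"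
    if "\<gamma> ` {a..b} \<subseteq> frontier \<Omega>" for x
  proof (cases "x \<in> frontier \<Omega> \<and> x \<in> V")
    case True
    then have "x \<in> \<gamma> ` {a..b}" using cover_frontier[of x] by (auto simp: \<gamma>_def)
    then show ?thesis using True by (auto simp: indicator_def)
  next
    case False
    then show ?thesis using that g(2)[of x] by (auto simp: indicator_def)
  qed
  have arc: "set_integrable \<sigma> (\<gamma> ` {a..b}) g"
    "(LINT x:\<gamma> ` {a..b}|\<sigma>. g x) = integral {a..b} (\<lambda>s. g (\<gamma> s) * norm (\<gamma>' s))"
    if "\<gamma> ` {a..b} \<subseteq> frontier \<Omega>"
    using that
    by (intro arc_length_measure_integral[OF \<sigma> \<gamma>_deriv cont_\<gamma>', where L = "\<lambda>x. x \<bullet> e"] ab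
        continuous_on_subset[OF g(1)] continuous_intros; simp add: \<gamma>_eq \<Phi>_coords)+
  show "(LINT x:frontier \<Omega>|\<sigma>. g x) = integral {a..b} (\<lambda>s. g (\<gamma> s) * norm (\<gamma>' s))"
    if "\<gamma> ` {a..b} \<subseteq> frontier \<Omega>"
    unfolding arc(2)[OF that, symmetric] set_lebesgue_integral_def ind[OF that] ..
  show "set_integrable \<sigma> (frontier \<Omega>) g"
  proof (cases "\<gamma> ` {a..b} \<subseteq> frontier \<Omega>")
    case True
    have "(\<lambda>x. indicator (frontier \<Omega>) x *\<^sub>R g x) = (\<lambda>x. indicator (\<gamma> ` {a..b}) x *\<^sub>R g x)"
      by (rule ext) (rule ind[OF True])
    then show ?thesis using arc(1)[OF True] by (simp only: set_integrable_def)
  next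
    case False
    have "g x = 0" if "x \<in> frontier \<Omega>" for x
      using False g(2)[OF that] edge cover_frontier[OF _ that]
      by (force simp: \<gamma>_def[abs_def])
    then have "(\<lambda>x. indicator (frontier \<Omega>) x *\<^sub>R g x) = (\<lambda>_. 0)"
      by (auto simp: indicator_def)
    then show ?thesis by (simp add: set_integrable_def)
  qed
qed

text \<open>The domain lies below the graph, so \<open>\<gamma>\<close> runs against the positive
  orientation: \<open>rot90 N = - \<gamma>' / norm \<gamma>'\<close>. This sign cancels the one in
  \<open>green_graph_coordinates\<close>, and the speed is absorbed by arc length.\<close>

lemma green_patch:
  assumes \<sigma>: "arc_length_measure (frontier \<Omega>) \<sigma>"
    and P: "C1_on (closure \<Omega>) \<Omega> P gP" and q: "C1_on (closure \<Omega>) \<Omega> q gq"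
    and P0: "\<And>x. x \<in> closure \<Omega> \<Longrightarrow> x \<notin> V \<Longrightarrow> P x = 0"
    and gP0: "\<And>x. x \<in> \<Omega> \<Longrightarrow> x \<notin> V \<Longrightarrow> gP x = 0"
    and N: "continuous_on (frontier \<Omega>) N" "\<And>s. s \<in> {a..b} \<Longrightarrow> \<gamma> s \<in> V \<Longrightarrow> \<gamma> s \<in> frontier \<Omega> \<Longrightarrow>
      N (\<gamma> s) = (1 / sqrt (1 + (h' s)\<^sup>2)) *\<^sub>R (rot90 e - h' s *\<^sub>R e)"
  shows "(LINT x:\<Omega>|lborel. rot90 (gP x) \<bullet> gq x) = (LINT x:frontier \<Omega>|\<sigma>. P x * (gq x \<bullet> rot90 (N x)))"
proof -
  have fc: "frontier \<Omega> \<subseteq> closure \<Omega>" by (simp add: frontier_def)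
  have cg: "continuous_on (frontier \<Omega>) (\<lambda>x. P x * (gq x \<bullet> rot90 (N x)))"
    unfolding rot90_def using P q N(1) unfolding C1_on_def
    by (intro continuous_intros) (auto intro: continuous_on_subset[OF _ fc])
  have z: "P x * (gq x \<bullet> rot90 (N x)) = 0" if "x \<in> frontier \<Omega>" "x \<notin> V" for x
    using P0[of x] that fc by auto
  have \<gamma>cl: "\<gamma> s \<in> closure \<Omega>" if "s \<in> {a..b}" for s
    unfolding \<gamma>_eq using that c by (intro \<Phi>_closure) auto
  show ?thesis
  proof (cases "\<gamma> ` {a..b} \<subseteq> frontier \<Omega>")
    case True
    have "P (\<gamma> s) * (gq (\<gamma> s) \<bullet> rot90 (N (\<gamma> s))) * norm (\<gamma>' s) = - (P (\<gamma> s) * (gq (\<gamma> s) \<bullet> \<gamma>' s))"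
      if s: "s \<in> {a..b}" for s
    proof (cases "\<gamma> s \<in> V")
      case True
      have "N (\<gamma> s) = (1 / sqrt (1 + (h' s)\<^sup>2)) *\<^sub>R (rot90 e - h' s *\<^sub>R e)"
        using N(2)[OF s True] \<open>\<gamma> ` {a..b} \<subseteq> frontier \<Omega>\<close> s by blast
      then have "norm (\<gamma>' s) *\<^sub>R N (\<gamma> s) = rot90 e - h' s *\<^sub>R e"
        by (simp add: norm_\<gamma>') (smt (verit) zero_le_power2)
      moreover have "rot90 (norm (\<gamma>' s) *\<^sub>R N (\<gamma> s)) = norm (\<gamma>' s) *\<^sub>R rot90 (N (\<gamma> s))"
        by (simp add: rot90_def)
      ultimately have "norm (\<gamma>' s) *\<^sub>R rot90 (N (\<gamma> s)) = - \<gamma>' s"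
        by (simp add: \<gamma>'_def rot90_def prod_eq_iff)
      then have "gq (\<gamma> s) \<bullet> (norm (\<gamma>' s) *\<^sub>R rot90 (N (\<gamma> s))) = - (gq (\<gamma> s) \<bullet> \<gamma>' s)"
        by simp
      then show ?thesis by (simp add: algebra_simps) 
    next
      case False
      then show ?thesis using P0[OF \<gamma>cl[OF s]] by simp
    qed
    then have "integral {a..b} (\<lambda>s. P (\<gamma> s) * (gq (\<gamma> s) \<bullet> rot90 (N (\<gamma> s))) * norm (\<gamma>' s)) =
        integral {a..b} (\<lambda>s. - (P (\<gamma> s) * (gq (\<gamma> s) \<bullet> \<gamma>' s)))"
      by (intro integral_cong) auto
    then show ?thesis
      using boundary_integral(2)[OF \<sigma> cg z True] green_graph_coordinates[OF P q P0 gP0] by simp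
  next
    case False
    then have V: "V \<inter> \<gamma> ` {a..b} = {}" using edge by (auto simp: \<gamma>_def[abs_def])
    have "integral {a..b} (\<lambda>s. P (\<gamma> s) * (gq (\<gamma> s) \<bullet> \<gamma>' s)) = integral {a..b} (\<lambda>s. 0)"
      using V P0[OF \<gamma>cl] by (intro integral_cong) (metis IntI empty_iff imageI mult_zero_left)
    moreover have "P x = 0" if "x \<in> frontier \<Omega>" for x
      using V P0[of x] that fc cover_frontier[OF _ that]
      by (force simp: \<gamma>_def[abs_def])
    then have "(LINT x:frontier \<Omega>|\<sigma>. P x * (gq x \<bullet> rot90 (N x))) = (LINT x:frontier \<Omega>|\<sigma>. 0)"
      unfolding set_lebesgue_integral_def
      by (intro Bochner_Integration.integral_cong) (auto simp: indicator_def)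
    ultimately show ?thesis
      using green_graph_coordinates[OF P q P0 gP0] by simp
  qed
qed

end

section \<open>Outer normal and curvature\<close>

lemma rotated_basis_expansion:
  assumes "norm e = 1"
  shows "x = (x \<bullet> e) *\<^sub>R e + (x \<bullet> rot90 e) *\<^sub>R rot90 e"
proof -
  obtain e1 e2 x1 x2 where [simp]: "e = (e1, e2)" "x = (x1, x2)" by (cases e; cases x)
  have 1: "e1\<^sup>2 + e2\<^sup>2 = 1" using assms by (simp add: norm_Pair)
  have "(x1 * e1 + x2 * e2) * e1 - (- (x1 * e2) + x2 * e1) * e2 = x1 * (e1\<^sup>2 + e2\<^sup>2)"
    "(x1 * e1 + x2 * e2) * e2 + (- (x1 * e2) + x2 * e1) * e1 = x2 * (e1\<^sup>2 + e2\<^sup>2)"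
    by (simp_all add: algebra_simps power2_eq_square)
  then show ?thesis by (simp add: rot90_def 1)
qed

lemma orthogonal_unit_cases:
  assumes "norm e = 1" "norm n = 1" "e \<bullet> n = 0"
  shows "n = rot90 e \<or> n = - rot90 e"
proof -
  have n: "n = (n \<bullet> rot90 e) *\<^sub>R rot90 e"
    using rotated_basis_expansion[OF assms(1), of n] assms(3) by (simp add: inner_commute)
  then have "norm n = \<bar>n \<bullet> rot90 e\<bar> * norm (rot90 e)" by (metis norm_scaleR)
  then have "\<bar>n \<bullet> rot90 e\<bar> = 1" using assms by simp
  then have "n \<bullet> rot90 e = 1 \<or> n \<bullet> rot90 e = -1" by linarith
  then show ?thesis using n by (metis scaleR_minus1_left scaleR_one)
qed

text \<open>The upper unit normal of the graph, extended so as to be constant in the direction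
  \<open>rot90 e\<close>. Being defined in the whole plane, it can be multiplied by a bump function
  and glued.\<close>

definition graph_normal :: "real \<times> real \<Rightarrow> (real \<Rightarrow> real) \<Rightarrow> real \<times> real \<Rightarrow> real \<times> real" where
  "graph_normal e h' x = (1 / sqrt (1 + (h' (x \<bullet> e))\<^sup>2)) *\<^sub>R (rot90 e - h' (x \<bullet> e) *\<^sub>R e)"

locale boundary_chart =
  fixes \<Omega> :: "(real \<times> real) set" and p :: "real \<times> real" and r :: real
    and e :: "real \<times> real" and h h' h'' :: "real \<Rightarrow> real"
  assumes open_dom: "open \<Omega>" and p: "p \<in> frontier \<Omega>" and r: "r > 0" and e: "norm e = 1"
    and h: "\<And>s. (h has_real_derivative h' s) (at s)"
    and h': "\<And>s. (h' has_real_derivative h'' s) (at s)" and h'': "continuous_on UNIV h''"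
    and dom: "\<Omega> \<inter> ball p r = {x \<in> ball p r. x \<bullet> rot90 e < h (x \<bullet> e)}"

text \<open>\<open>smooth_boundary\<close> leaves the orientation of the frame open. If
  \<open>n = - rot90 e\<close>, reversing \<open>e\<close> and reflecting the argument of
  \<open>h\<close> describes the same graph in a positively oriented frame.\<close>

lemma boundary_chart_exists:
  assumes "open \<Omega>" "smooth_boundary \<Omega>" "p \<in> frontier \<Omega>"
  shows "\<exists>r e h h' h''. boundary_chart \<Omega> p r e h h' h''"
proof -
  obtain r e n and h :: "real \<Rightarrow> real" where r: "r > 0" and e: "norm e = 1" "norm n = 1" "e \<bullet> n = 0"
    and sm: "\<And>k. (deriv ^^ k) h differentiable_on UNIV"
    and dom: "\<Omega> \<inter> ball p r = {x \<in> ball p r. x \<bullet> n < h (x \<bullet> e)}"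
    using assms(2,3) unfolding smooth_boundary_def by blast
  have d: "((deriv ^^ k) h has_real_derivative (deriv ^^ Suc k) h s) (at s)" for k s
    using sm[of k] by (simp add: differentiable_on_def DERIV_deriv_iff_real_differentiable)
  have h: "(h has_real_derivative deriv h s) (at s)" for s using d[of 0] by simp
  have h': "(deriv h has_real_derivative deriv (deriv h) s) (at s)" for s using d[of 1] by simp
  have h'': "continuous_on UNIV (deriv (deriv h))"
    using differentiable_imp_continuous_on[OF sm[of 2]] by (simp add: numeral_2_eq_2)
  from orthogonal_unit_cases[OF e] show ?thesis
  proof
    assume "n = rot90 e"
    then have "boundary_chart \<Omega> p r e h (deriv h) (deriv (deriv h))"
      using assms r e h h' h'' dom by unfold_locales auto
    then show ?thesis by blast
  next
    assume n: "n = - rot90 e"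
    have "boundary_chart \<Omega> p r (- e) (\<lambda>s. h (- s)) (\<lambda>s. - deriv h (- s)) (\<lambda>s. deriv (deriv h) (- s))"
    proof
      show "((\<lambda>s. h (- s)) has_real_derivative - deriv h (- s)) (at s)" for s
        using DERIV_chain2[OF h DERIV_minus[OF DERIV_ident], of s] by simp
      show "((\<lambda>s. - deriv h (- s)) has_real_derivative deriv (deriv h) (- s)) (at s)" for s
        using DERIV_minus[OF DERIV_chain2[OF h' DERIV_minus[OF DERIV_ident], of s]] by simp
      show "continuous_on UNIV (\<lambda>s. deriv (deriv h) (- s))"
        by (intro continuous_on_compose2[OF h''] continuous_intros) auto
    qed (use assms r e dom n in auto)
    then show ?thesis by blast
  qed
qed

context boundary_chart
begin

lemma ee: "e \<bullet> e = 1"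
  using e by (simp add: norm_eq_1)

lemma conth: "continuous_on S h"
  using h by (meson DERIV_isCont continuous_at_imp_continuous_on)

lemma conth': "continuous_on S h'"
  using h' by (meson DERIV_isCont continuous_at_imp_continuous_on)

lemma cont_height: "continuous_on S (\<lambda>x. x \<bullet> rot90 e - h (x \<bullet> e))"
  by (intro continuous_intros continuous_on_compose2[OF conth[of UNIV]]) auto

lemma dom_iff: "x \<in> ball p r \<Longrightarrow> x \<in> \<Omega> \<longleftrightarrow> x \<bullet> rot90 e < h (x \<bullet> e)"
  using dom by blast

text \<open>Lying strictly above the graph is an open condition that excludes
  \<open>\<Omega>\<close>; from a point of the graph a small step along \<open>- rot90 e\<close>
  enters \<open>\<Omega>\<close>.\<close>

lemma frontier_iff:
  assumes x: "x \<in> ball p r"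
  shows "x \<in> frontier \<Omega> \<longleftrightarrow> x \<bullet> rot90 e = h (x \<bullet> e)"
proof
  assume "x \<in> frontier \<Omega>"
  then have xcl: "x \<in> closure \<Omega>" and "x \<notin> \<Omega>"
    using open_dom by (auto simp: frontier_def interior_open)
  then have ge: "x \<bullet> rot90 e \<ge> h (x \<bullet> e)" using dom_iff[OF x] by simp
  show "x \<bullet> rot90 e = h (x \<bullet> e)"
  proof (rule ccontr)
    assume "x \<bullet> rot90 e \<noteq> h (x \<bullet> e)"
    define U where "U = ball p r \<inter> {x. 0 < x \<bullet> rot90 e - h (x \<bullet> e)}"
    have "open U"
      unfolding U_def by (intro open_Int open_ball open_Collect_less continuous_intros cont_height)
    moreover have "x \<in> U" using x ge \<open>x \<bullet> rot90 e \<noteq> h (x \<bullet> e)\<close> by (auto simp: U_def)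
    ultimately have "U \<inter> \<Omega> \<noteq> {}" using xcl open_Int_closure_eq_empty[of U \<Omega>] by blast
    then obtain y where "y \<in> U" "y \<in> \<Omega>" by blast
    then have "y \<in> \<Omega> \<inter> ball p r" by (auto simp: U_def)
    then show False using dom_iff[of y] \<open>y \<in> U\<close> by (auto simp: U_def)
  qed
next
  assume eq: "x \<bullet> rot90 e = h (x \<bullet> e)"
  then have "x \<notin> \<Omega>" using dom_iff[OF x] by simp
  moreover have "x \<in> closure \<Omega>"
  proof (rule closure_approachable[THEN iffD2], intro allI impI)
    fix \<epsilon> :: real assume "\<epsilon> > 0"
    define t where "t = min \<epsilon> (r - dist p x) / 2"
    have t: "0 < t" "t < \<epsilon>" "t < r - dist p x" using \<open>\<epsilon> > 0\<close> x by (auto simp: t_def min_def)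
    define y where "y = x - t *\<^sub>R rot90 e"
    have dyx: "dist y x = t" using t e by (simp add: y_def dist_norm)
    then have "y \<in> ball p r" using t dist_triangle[of p y x] by (simp add: dist_commute)
    moreover have "y \<bullet> rot90 e < h (y \<bullet> e)"
      using t eq by (simp add: y_def inner_diff_left ee)
    ultimately have "y \<in> \<Omega>" using dom_iff by blast
    then show "\<exists>y\<in>\<Omega>. dist y x < \<epsilon>" using dyx t by auto
  qed
  ultimately show "x \<in> frontier \<Omega>" using open_dom by (simp add: frontier_def interior_open)
qed

lemma graph_curve_deriv:
  "((\<lambda>s. s *\<^sub>R e + h s *\<^sub>R rot90 e) has_vector_derivative (e + h' s *\<^sub>R rot90 e)) (at s)"
  unfolding has_vector_derivative_def
  using h[of s, unfolded has_field_derivative_def]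
  by (auto intro!: derivative_eq_intros simp: algebra_simps)

lemma graph_curve_frontier:
  assumes x: "x \<in> frontier \<Omega>" "x \<in> ball p r"
  shows "(x \<bullet> e) *\<^sub>R e + h (x \<bullet> e) *\<^sub>R rot90 e = x"
    "\<exists>\<epsilon>>0. \<forall>s. \<bar>s - x \<bullet> e\<bar> < \<epsilon> \<longrightarrow> s *\<^sub>R e + h s *\<^sub>R rot90 e \<in> frontier \<Omega>"
proof -
  let ?g = "\<lambda>s. s *\<^sub>R e + h s *\<^sub>R rot90 e"
  show eq: "?g (x \<bullet> e) = x"
    using rotated_basis_expansion[OF e, of x] frontier_iff[OF x(2)] x(1) by simp
  have "open (?g -` ball p r)"
    by (intro open_vimage continuous_intros conth) auto
  moreover have "x \<bullet> e \<in> ?g -` ball p r" using x eq by simp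
  ultimately obtain \<epsilon> where "\<epsilon> > 0" "ball (x \<bullet> e) \<epsilon> \<subseteq> ?g -` ball p r"
    by (meson open_contains_ball)
  then show "\<exists>\<epsilon>>0. \<forall>s. \<bar>s - x \<bullet> e\<bar> < \<epsilon> \<longrightarrow> ?g s \<in> frontier \<Omega>"
    by (intro exI[of _ \<epsilon>])
      (auto simp: subset_iff dist_real_def abs_minus_commute frontier_iff inner_add_left ee)
qed

lemma norm_graph_normal: "norm (graph_normal e h' x) = 1"
proof -
  define k where "k = h' (x \<bullet> e)"
  have "norm (rot90 e - k *\<^sub>R e) = sqrt (1 + k\<^sup>2)"
    unfolding norm_eq_sqrt_inner
    by (simp add: inner_diff_left inner_diff_right ee power2_eq_square)
  moreover have "1 + k\<^sup>2 > 0" by (simp add: add_pos_nonneg)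
  ultimately show ?thesis by (simp add: graph_normal_def k_def)
qed

text \<open>Evaluates the definite description. Curves in the frontier satisfy the graph equation,
  whose derivative gives orthogonality. Conversely, the graph itself is such a curve and leaves two
  opposite unit vectors, of which the side condition selects one.\<close>

lemma outer_normal_eq:
  assumes x: "x \<in> frontier \<Omega>" "x \<in> ball p r"
  shows "outer_normal \<Omega> x = graph_normal e h' x"
    and "\<gamma> 0 = x \<Longrightarrow> \<forall>\<^sub>F t in at 0. \<gamma> t \<in> frontier \<Omega> \<Longrightarrow> (\<gamma> has_vector_derivative v) (at 0) \<Longrightarrow>
      v \<bullet> graph_normal e h' x = 0"
proof -
  define k where "k = h' (x \<bullet> e)"
  define m where "m = sqrt (1 + k\<^sup>2)"
  define \<nu> where "\<nu> = graph_normal e h' x"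
  have m: "m > 0" by (simp add: m_def add_pos_nonneg)
  have \<nu>: "\<nu> = (1 / m) *\<^sub>R (rot90 e - k *\<^sub>R e)" by (simp add: \<nu>_def graph_normal_def k_def m_def)
  have tangent: "v \<bullet> \<nu> = 0"
    if \<gamma>: "\<gamma> 0 = x" "\<forall>\<^sub>F t in at 0. \<gamma> t \<in> frontier \<Omega>" "(\<gamma> has_vector_derivative v) (at 0)" for \<gamma> v
  proof -
    have "continuous (at 0) \<gamma>" using \<gamma>(3) by (rule has_vector_derivative_continuous)
    then have "\<forall>\<^sub>F t in at 0. \<gamma> t \<in> ball p r"
      using topological_tendstoD[of \<gamma> "\<gamma> 0" "at 0" "ball p r"] \<gamma>(1) x(2) by (simp add: continuous_at)
    then have "\<forall>\<^sub>F t in at 0. \<gamma> t \<bullet> rot90 e = h (\<gamma> t \<bullet> e)"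
      using \<gamma>(2) by eventually_elim (simp add: frontier_iff)
    then have ev: "\<forall>\<^sub>F t in nhds 0. \<gamma> t \<bullet> rot90 e = h (\<gamma> t \<bullet> e)"
      using x \<gamma>(1) by (simp add: eventually_nhds_conv_at frontier_iff)
    have 1: "((\<lambda>t. \<gamma> t \<bullet> w) has_real_derivative v \<bullet> w) (at 0)" for w
      using has_real_derivative_along_curve[of "\<lambda>x. w \<bullet> x" w \<gamma> 0,
          OF has_derivative_inner_right[OF has_derivative_ident] \<gamma>(3)]
      by (simp add: inner_commute)
    have "((\<lambda>t. h (\<gamma> t \<bullet> e)) has_real_derivative k * (v \<bullet> e)) (at 0)"
      using DERIV_chain2[OF h 1[of e]] \<gamma>(1) by (simp add: k_def)
    then have "((\<lambda>t. \<gamma> t \<bullet> rot90 e) has_real_derivative k * (v \<bullet> e)) (at 0)"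
      using DERIV_cong_ev[OF refl ev refl] by simp
    then have "v \<bullet> rot90 e = k * (v \<bullet> e)" using 1[of "rot90 e"] DERIV_unique by blast
    then show ?thesis by (simp add: \<nu> inner_diff_right)
  qed
  then show "\<gamma> 0 = x \<Longrightarrow> \<forall>\<^sub>F t in at 0. \<gamma> t \<in> frontier \<Omega> \<Longrightarrow> (\<gamma> has_vector_derivative v) (at 0) \<Longrightarrow>
      v \<bullet> graph_normal e h' x = 0" unfolding \<nu>_def by blast
  have sides: "\<exists>\<epsilon>>0. \<forall>t\<in>{0<..<\<epsilon>}. x + t *\<^sub>R \<nu> \<notin> \<Omega> \<and> x - t *\<^sub>R \<nu> \<in> \<Omega>"
  proof -
    \<comment> \<open>The height above the graph along the normal line. Its derivative at 0 is
      \<open>(1 + k\<^sup>2) / m\<close>, which is positive, so its sign tells the two sides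
      apart.\<close>
    define F where "F = (\<lambda>t. (x + t *\<^sub>R \<nu>) \<bullet> rot90 e - h ((x + t *\<^sub>R \<nu>) \<bullet> e))"
    have i: "\<nu> \<bullet> rot90 e = 1 / m" "\<nu> \<bullet> e = - k / m"
      by (simp_all add: \<nu> inner_diff_left ee)
    have F: "F = (\<lambda>t. x \<bullet> rot90 e + t / m - h (x \<bullet> e + t * (- k / m)))"
      by (auto simp: F_def inner_add_left i)
    have "((\<lambda>t. x \<bullet> e + t * (- k / m)) has_real_derivative (- k / m)) (at 0)"
      using m by (auto intro!: derivative_eq_intros)
    from DERIV_chain2[of h "h' (x \<bullet> e)", OF _ this] h
    have sh: "((\<lambda>t. h (x \<bullet> e + t * (- k / m))) has_real_derivative k * (- k / m)) (at 0)"
      by (simp add: k_def)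
    have dF: "(F has_real_derivative (1 / m - k * (- k / m))) (at 0)"
      unfolding F using sh m by (auto intro!: derivative_eq_intros)
    have "(1 / m - k * (- k / m)) = (1 + k * k) / m"
      using m by (simp add: field_simps)
    then have pos: "1 / m - k * (- k / m) > 0" using m by (simp add: add_pos_nonneg)
    have F0: "F 0 = 0" using x by (simp add: F_def frontier_iff)
    obtain d1 where d1: "d1 > 0" "\<And>t. 0 < t \<Longrightarrow> t < d1 \<Longrightarrow> F 0 < F (0 + t)"
      using DERIV_pos_inc_right[OF dF pos] by blast
    obtain d2 where d2: "d2 > 0" "\<And>t. 0 < t \<Longrightarrow> t < d2 \<Longrightarrow> F (0 - t) < F 0"
      using DERIV_pos_inc_left[OF dF pos] by blast
    define \<epsilon> where "\<epsilon> = min (min d1 d2) (r - dist p x)"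
    have "x + t *\<^sub>R \<nu> \<notin> \<Omega> \<and> x - t *\<^sub>R \<nu> \<in> \<Omega>" if t: "t \<in> {0<..<\<epsilon>}" for t
    proof -
      have n1: "norm \<nu> = 1" by (simp add: \<nu>_def norm_graph_normal)
      have "x + t *\<^sub>R \<nu> \<in> ball p r" "x - t *\<^sub>R \<nu> \<in> ball p r"
        using t n1 dist_triangle[of p "x + t *\<^sub>R \<nu>" x] dist_triangle[of p "x - t *\<^sub>R \<nu>" x]
        by (auto simp: \<epsilon>_def dist_norm)
      moreover have "F t > 0" "F (- t) < 0" using t d1(2)[of t] d2(2)[of t] F0 by (auto simp: \<epsilon>_def)
      ultimately show ?thesis
        using dom_iff[of "x + t *\<^sub>R \<nu>"] dom_iff[of "x - t *\<^sub>R \<nu>"] by (simp add: F_def)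
    qed
    moreover have "\<epsilon> > 0" using d1 d2 x by (simp add: \<epsilon>_def)
    ultimately show ?thesis by blast
  qed
  show "outer_normal \<Omega> x = graph_normal e h' x"
    unfolding outer_normal_def \<nu>_def[symmetric]
  proof (rule the_equality, intro conjI allI impI)
    show "norm \<nu> = 1" by (simp add: \<nu>_def norm_graph_normal)
    show "v \<bullet> \<nu> = 0" if "\<gamma> 0 = x \<and> (\<forall>\<^sub>F t in at 0. \<gamma> t \<in> frontier \<Omega>) \<and> (\<gamma> has_vector_derivative v) (at 0)" for \<gamma> v
      using tangent that by blast
    show "\<exists>\<epsilon>>0. \<forall>t\<in>{0<..<\<epsilon>}. x + t *\<^sub>R \<nu> \<notin> \<Omega> \<and> x - t *\<^sub>R \<nu> \<in> \<Omega>" by (rule sides)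
    fix \<mu>
    assume "norm \<mu> = 1 \<and>
     (\<forall>\<gamma> v. \<gamma> 0 = x \<and> (\<forall>\<^sub>F t in at 0. \<gamma> t \<in> frontier \<Omega>) \<and>
        (\<gamma> has_vector_derivative v) (at 0) \<longrightarrow> v \<bullet> \<mu> = 0) \<and>
     (\<exists>\<epsilon>>0. \<forall>t\<in>{0<..<\<epsilon>}. x + t *\<^sub>R \<mu> \<notin> \<Omega> \<and> x - t *\<^sub>R \<mu> \<in> \<Omega>)"
    then have \<mu>: "norm \<mu> = 1" and \<mu>t: "\<And>\<gamma> v. \<gamma> 0 = x \<Longrightarrow> \<forall>\<^sub>F t in at 0. \<gamma> t \<in> frontier \<Omega> \<Longrightarrow>
        (\<gamma> has_vector_derivative v) (at 0) \<Longrightarrow> v \<bullet> \<mu> = 0"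
      and \<mu>s: "\<exists>\<epsilon>>0. \<forall>t\<in>{0<..<\<epsilon>}. x + t *\<^sub>R \<mu> \<notin> \<Omega> \<and> x - t *\<^sub>R \<mu> \<in> \<Omega>"
      by blast+
    define g where "g = (\<lambda>t. (x \<bullet> e + t) *\<^sub>R e + h (x \<bullet> e + t) *\<^sub>R rot90 e)"
    have "(e + k *\<^sub>R rot90 e) \<bullet> \<mu> = 0"
    proof (rule \<mu>t[of g])
      show "g 0 = x" using graph_curve_frontier(1)[OF x] by (simp add: g_def)
      obtain \<epsilon> where "\<epsilon> > 0" "\<forall>s. \<bar>s - x \<bullet> e\<bar> < \<epsilon> \<longrightarrow> s *\<^sub>R e + h s *\<^sub>R rot90 e \<in> frontier \<Omega>"
        using graph_curve_frontier(2)[OF x] by blast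
      then show "\<forall>\<^sub>F t in at 0. g t \<in> frontier \<Omega>"
        unfolding eventually_at by (intro exI[of _ \<epsilon>]) (auto simp: g_def dist_real_def)
      have "((\<lambda>t. x \<bullet> e + t) has_vector_derivative 1) (at 0)"
        unfolding has_real_derivative_iff_has_vector_derivative[symmetric] by (auto intro!: derivative_eq_intros)
      from vector_diff_chain_at[OF this, of "\<lambda>s. s *\<^sub>R e + h s *\<^sub>R rot90 e" "e + k *\<^sub>R rot90 e"]
      show "(g has_vector_derivative e + k *\<^sub>R rot90 e) (at 0)"
        using graph_curve_deriv[of "x \<bullet> e"] by (simp add: g_def[abs_def] o_def k_def)
    qed
    then have "\<mu> \<bullet> e = - k * (\<mu> \<bullet> rot90 e)"
      by (simp add: inner_add_right inner_commute[of _ \<mu>])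
    then have "\<mu> = (\<mu> \<bullet> rot90 e) *\<^sub>R (rot90 e - k *\<^sub>R e)"
      using rotated_basis_expansion[OF e, of \<mu>] by (simp add: algebra_simps)
    then have \<mu>c: "\<mu> = (m * (\<mu> \<bullet> rot90 e)) *\<^sub>R \<nu>" using m by (simp add: \<nu>)
    then have "norm \<mu> = \<bar>m * (\<mu> \<bullet> rot90 e)\<bar> * norm \<nu>" by (metis norm_scaleR)
    then have "m * (\<mu> \<bullet> rot90 e) = 1 \<or> m * (\<mu> \<bullet> rot90 e) = -1"
      using \<mu> norm_graph_normal[of x] unfolding \<nu>_def[symmetric] by (simp; linarith)
    then have "\<mu> = \<nu> \<or> \<mu> = - \<nu>" using \<mu>c by (metis scaleR_minus1_left scaleR_one)
    moreover have "\<mu> \<noteq> - \<nu>"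
    proof
      assume "\<mu> = - \<nu>"
      obtain \<epsilon>1 \<epsilon>2 where \<epsilon>: "\<epsilon>1 > 0" "\<epsilon>2 > 0"
        "\<forall>t\<in>{0<..<\<epsilon>1}. x + t *\<^sub>R \<mu> \<notin> \<Omega>" "\<forall>t\<in>{0<..<\<epsilon>2}. x - t *\<^sub>R \<nu> \<in> \<Omega>"
        using sides \<mu>s by blast
      define t where "t = min \<epsilon>1 \<epsilon>2 / 2"
      have "t \<in> {0<..<\<epsilon>1}" "t \<in> {0<..<\<epsilon>2}" using \<epsilon> by (auto simp: t_def)
      then have "x + t *\<^sub>R \<mu> \<notin> \<Omega>" "x - t *\<^sub>R \<nu> \<in> \<Omega>" using \<epsilon> by blast+
      then show False using \<open>\<mu> = - \<nu>\<close> by simp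
    qed
    ultimately show "\<mu> = \<nu>" by blast
  qed
qed

end

section \<open>Patches around the points of the closure\<close>

lemma (in boundary_chart) patch:
  "\<exists>\<rho>>0. \<rho> \<le> r \<and> (\<exists>a b c. graph_patch \<Omega> (ball p \<rho>) e h h' a b c)"
proof -
  define s0 where "s0 = p \<bullet> e"
  let ?\<Phi> = "\<lambda>z. fst z *\<^sub>R e + (h (fst z) + snd z) *\<^sub>R rot90 e"
  have hs0: "p \<bullet> rot90 e = h s0" using frontier_iff[of p] p r by (simp add: s0_def)
  have \<Phi>0: "?\<Phi> (s0, 0) = p"
    using rotated_basis_expansion[OF e, of p] hs0 by (simp add: s0_def)
  have "open (?\<Phi> -` ball p r)"
    by (intro open_vimage open_ball continuous_intros continuous_on_compose2[OF conth[of UNIV]]) auto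
  moreover have "(s0, 0) \<in> ?\<Phi> -` ball p r" using \<Phi>0 r by simp
  ultimately obtain \<delta> where \<delta>: "\<delta> > 0" "ball (s0, 0) \<delta> \<subseteq> ?\<Phi> -` ball p r"
    by (meson open_contains_ball)
  \<comment> \<open>A point whose coordinates both deviate by at most \<open>\<eta>\<close> is at
    distance at most \<open>2 * \<eta> < \<delta>\<close>, so the closed box is mapped into the ball
    of the chart.\<close>
  define \<eta> where "\<eta> = \<delta> / 3"
  have \<eta>: "\<eta> > 0" using \<delta> by (simp add: \<eta>_def)
  have near: "?\<Phi> (s, t) \<in> ball p r" if "\<bar>s - s0\<bar> \<le> \<eta>" "\<bar>t\<bar> \<le> \<eta>" for s t
  proof -
    have "dist (s0, 0) (s, t) \<le> \<bar>s - s0\<bar> + \<bar>t\<bar>"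
      using sqrt_sum_squares_le_sum_abs[of "s0 - s" "- t"]
      by (simp add: dist_Pair_Pair dist_real_def abs_minus_commute)
    also have "\<dots> < \<delta>" using that \<eta> by (simp add: \<eta>_def)
    finally have "(s, t) \<in> ball (s0, 0) \<delta>" by simp
    then show ?thesis using \<delta>(2) by blast
  qed
  define U where "U = {x. \<bar>x \<bullet> e - s0\<bar> < \<eta>} \<inter> {x. \<bar>x \<bullet> rot90 e - h (x \<bullet> e)\<bar> < \<eta>}"
  have "open U"
    unfolding U_def by (intro open_Int open_Collect_less continuous_intros cont_height)
  moreover have "p \<in> U" using \<eta> hs0 by (simp add: U_def s0_def)
  ultimately obtain \<rho>0 where \<rho>0: "\<rho>0 > 0" "ball p \<rho>0 \<subseteq> U" by (meson open_contains_ball)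
  define \<rho> where "\<rho> = min \<rho>0 r"
  have sub: "ball p \<rho> \<subseteq> U" "ball p \<rho> \<subseteq> ball p r" using \<rho>0(2) by (auto simp: \<rho>_def)
  have expand: "x = (x \<bullet> e) *\<^sub>R e + (h (x \<bullet> e) + (x \<bullet> rot90 e - h (x \<bullet> e))) *\<^sub>R rot90 e" for x
    using rotated_basis_expansion[OF e, of x] by simp
  have coords: "(s *\<^sub>R e + t *\<^sub>R rot90 e) \<bullet> e = s" "(s *\<^sub>R e + t *\<^sub>R rot90 e) \<bullet> rot90 e = t" for s t
    by (simp_all add: inner_add_left ee)
  have "graph_patch \<Omega> (ball p \<rho>) e h h' (s0 - \<eta>) (s0 + \<eta>) (- \<eta>)"
  proof
    show "s *\<^sub>R e + (h s + t) *\<^sub>R rot90 e \<in> \<Omega>" if "s \<in> {s0 - \<eta>..s0 + \<eta>}" "t \<in> {- \<eta>..<0}" for s t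
    proof -
      have "s *\<^sub>R e + (h s + t) *\<^sub>R rot90 e \<in> ball p r" using near[of s t] that by auto
      then show ?thesis using that by (simp add: dom_iff coords del: mem_ball)
    qed
    show "\<exists>s\<in>{s0 - \<eta><..<s0 + \<eta>}. \<exists>t\<in>{- \<eta><..<0}. x = s *\<^sub>R e + (h s + t) *\<^sub>R rot90 e"
      if "x \<in> ball p \<rho>" "x \<in> \<Omega>" for x
    proof (intro bexI)
      have "x \<in> U" "x \<bullet> rot90 e < h (x \<bullet> e)" using that sub dom_iff[of x] by blast+
      then show "x \<bullet> rot90 e - h (x \<bullet> e) \<in> {- \<eta><..<0}" "x \<bullet> e \<in> {s0 - \<eta><..<s0 + \<eta>}"
        by (auto simp: U_def)
    qed (rule expand)
    show "\<exists>s\<in>{s0 - \<eta><..<s0 + \<eta>}. x = s *\<^sub>R e + h s *\<^sub>R rot90 e"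
      if "x \<in> ball p \<rho>" "x \<in> frontier \<Omega>" for x
    proof (intro bexI)
      have "x \<in> U" and eq: "x \<bullet> rot90 e = h (x \<bullet> e)" using that sub frontier_iff[of x] by blast+
      then show "x \<bullet> e \<in> {s0 - \<eta><..<s0 + \<eta>}" by (auto simp: U_def)
      show "x = (x \<bullet> e) *\<^sub>R e + h (x \<bullet> e) *\<^sub>R rot90 e" using expand[of x] eq by simp
    qed
    have "s *\<^sub>R e + h s *\<^sub>R rot90 e \<in> frontier \<Omega>" if "s \<in> {s0 - \<eta>..s0 + \<eta>}" for s
    proof -
      have "s *\<^sub>R e + h s *\<^sub>R rot90 e \<in> ball p r" using near[of s 0] that \<eta> by auto
      then show ?thesis by (simp add: frontier_iff coords del: mem_ball)
    qed
    then show "(\<lambda>s. s *\<^sub>R e + h s *\<^sub>R rot90 e) ` {s0 - \<eta>..s0 + \<eta>} \<subseteq> frontier \<Omega> \<or>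
        ball p \<rho> \<inter> (\<lambda>s. s *\<^sub>R e + h s *\<^sub>R rot90 e) ` {s0 - \<eta>..s0 + \<eta>} = {}"
      by blast
  qed (use open_dom e h conth' \<eta> in auto)
  moreover have "\<rho> > 0" "\<rho> \<le> r" using \<rho>0 r by (auto simp: \<rho>_def)
  ultimately show ?thesis by blast
qed

lemma interior_patch:
  fixes p :: "real \<times> real"
  assumes "open \<Omega>" "p \<in> \<Omega>"
  shows "\<exists>\<rho>>0. ball p \<rho> \<subseteq> \<Omega> \<and>
    (\<exists>a b c. graph_patch \<Omega> (ball p \<rho>) (1, 0) (\<lambda>_. snd p + \<rho>) (\<lambda>_. 0) a b c)"
proof -
  obtain \<delta> where \<delta>: "\<delta> > 0" "ball p \<delta> \<subseteq> \<Omega>" using assms by (meson open_contains_ball)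
  define \<eta> where "\<eta> = \<delta> / 3"
  obtain p1 p2 where p: "p = (p1, p2)" by (cases p)
  have \<eta>: "\<eta> > 0" using \<delta> by (simp add: \<eta>_def)
  have sub: "ball p \<eta> \<subseteq> \<Omega>" using \<delta> by (auto simp: \<eta>_def)
  have r: "rot90 (1, 0) = (0, 1)" by (simp add: rot90_def)
  have fst_le: "\<bar>fst x - p1\<bar> \<le> dist p x" and snd_le: "\<bar>snd x - p2\<bar> \<le> dist p x" for x
    using dist_fst_le[of p x] dist_snd_le[of p x] by (simp_all add: p dist_real_def abs_minus_commute)
  \<comment> \<open>The constant graph is the upper edge of a square of half side
    \<open>\<eta>\<close>, hence the depth \<open>2 * \<eta>\<close>. The open inscribed disk misses
    that edge, so no boundary term will arise.\<close>
  have "graph_patch \<Omega> (ball p \<eta>) (1, 0) (\<lambda>_. snd p + \<eta>) (\<lambda>_. 0) (p1 - \<eta>) (p1 + \<eta>) (- 2 * \<eta>)"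
  proof
    show "s *\<^sub>R (1, 0) + (snd p + \<eta> + t) *\<^sub>R rot90 (1, 0) \<in> \<Omega>"
      if "s \<in> {p1 - \<eta>..p1 + \<eta>}" "t \<in> {- 2 * \<eta>..<0}" for s t
    proof -
      have "dist p (s, p2 + \<eta> + t) \<le> \<bar>s - p1\<bar> + \<bar>\<eta> + t\<bar>"
        using sqrt_sum_squares_le_sum_abs[of "p1 - s" "t + \<eta>"]
        by (simp add: p dist_Pair_Pair dist_real_def abs_minus_commute add.commute)
      also have "\<dots> \<le> \<eta> + \<eta>"
        using that by (intro add_mono) (auto simp: abs_le_iff)
      also have "\<dots> < \<delta>" using \<delta> by (simp add: \<eta>_def)
      finally have "(s, p2 + \<eta> + t) \<in> ball p \<delta>" by simp
      then show ?thesis using \<delta>(2) by (auto simp: r p)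
    qed
    show "\<exists>s\<in>{p1 - \<eta><..<p1 + \<eta>}. \<exists>t\<in>{- 2 * \<eta><..<0}. x = s *\<^sub>R (1, 0) + (snd p + \<eta> + t) *\<^sub>R rot90 (1, 0)"
      if "x \<in> ball p \<eta>" "x \<in> \<Omega>" for x
    proof (intro bexI)
      show "snd x - p2 - \<eta> \<in> {- 2 * \<eta><..<0}" "fst x \<in> {p1 - \<eta><..<p1 + \<eta>}"
        using that(1) fst_le[of x] snd_le[of x] by auto
      show "x = fst x *\<^sub>R (1, 0) + (snd p + \<eta> + (snd x - p2 - \<eta>)) *\<^sub>R rot90 (1, 0)"
        by (simp add: r p prod_eq_iff)
    qed
    have "x \<notin> frontier \<Omega>" if "x \<in> ball p \<eta>" for x
      using that sub assms(1) by (auto simp: frontier_def interior_open)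
    then show "\<exists>s\<in>{p1 - \<eta><..<p1 + \<eta>}. x = s *\<^sub>R (1, 0) + (snd p + \<eta>) *\<^sub>R rot90 (1, 0)"
      if "x \<in> ball p \<eta>" "x \<in> frontier \<Omega>" for x using that by blast
    have "(s, p2 + \<eta>) \<notin> ball p \<eta>" for s using snd_le[of "(s, p2 + \<eta>)"] \<eta> by auto
    then show "(\<lambda>s. s *\<^sub>R (1, 0) + (snd p + \<eta>) *\<^sub>R rot90 (1, 0)) ` {p1 - \<eta>..p1 + \<eta>} \<subseteq> frontier \<Omega> \<or>
        ball p \<eta> \<inter> (\<lambda>s. s *\<^sub>R (1, 0) + (snd p + \<eta>) *\<^sub>R rot90 (1, 0)) ` {p1 - \<eta>..p1 + \<eta>} = {}"
      by (auto simp: r p)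
  qed (use assms \<eta> in auto)
  then show ?thesis using \<eta> sub by blast
qed

text \<open>Interior and boundary points get patches of the same form, so that compactness of the
  closure can be applied once. Around an interior point the clause on \<open>outer_normal\<close> is
  vacuous.\<close>

lemma patch_exists:
  assumes "open \<Omega>" "smooth_boundary \<Omega>" "p \<in> closure \<Omega>"
  shows "\<exists>\<rho> e h h' h'' a b c. \<rho> > 0 \<and> graph_patch \<Omega> (ball p \<rho>) e h h' a b c \<and>
    (\<forall>s. (h' has_real_derivative h'' s) (at s)) \<and> continuous_on UNIV h'' \<and>
    (\<forall>x\<in>frontier \<Omega> \<inter> ball p \<rho>. outer_normal \<Omega> x = graph_normal e h' x)"
proof (cases "p \<in> \<Omega>")
  case True
  obtain \<rho> a b c where \<rho>: "\<rho> > 0" "ball p \<rho> \<subseteq> \<Omega>"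
    "graph_patch \<Omega> (ball p \<rho>) (1, 0) (\<lambda>_. snd p + \<rho>) (\<lambda>_. 0) a b c"
    using interior_patch[OF assms(1) True] by blast
  have "frontier \<Omega> \<inter> ball p \<rho> = {}"
    using \<rho>(2) assms(1) by (auto simp: frontier_def interior_open)
  then show ?thesis
    using \<rho> by (intro exI[of _ \<rho>] exI[of _ "(1, 0)"] exI[of _ "\<lambda>_. snd p + \<rho>"] exI[of _ "\<lambda>_. 0"]
      exI[of _ a] exI[of _ b] exI[of _ c]) auto
next
  case False
  then have "p \<in> frontier \<Omega>" using assms by (simp add: frontier_def interior_open)
  then obtain r e h h' h'' where "boundary_chart \<Omega> p r e h h' h''"
    using boundary_chart_exists assms by blast
  then interpret boundary_chart \<Omega> p r e h h' h'' .
  obtain \<rho> a b c where "\<rho> > 0" "\<rho> \<le> r" "graph_patch \<Omega> (ball p \<rho>) e h h' a b c"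
    using patch by blast
  moreover have "outer_normal \<Omega> x = graph_normal e h' x" if "x \<in> frontier \<Omega> \<inter> ball p \<rho>" for x
    using that \<open>\<rho> \<le> r\<close> by (intro outer_normal_eq) auto
  ultimately show ?thesis using h' h'' by blast
qed

lemma outer_normal_props:
  assumes "open \<Omega>" "smooth_boundary \<Omega>" "x \<in> frontier \<Omega>"
  shows "norm (outer_normal \<Omega> x) = 1"
    and "\<gamma> 0 = x \<Longrightarrow> \<forall>\<^sub>F t in at 0. \<gamma> t \<in> frontier \<Omega> \<Longrightarrow> (\<gamma> has_vector_derivative v) (at 0) \<Longrightarrow>
      v \<bullet> outer_normal \<Omega> x = 0"
proof -
  obtain r e h h' h'' where "boundary_chart \<Omega> x r e h h' h''"
    using boundary_chart_exists assms by blast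
  then interpret boundary_chart \<Omega> x r e h h' h'' .
  have x: "x \<in> frontier \<Omega>" "x \<in> ball x r" using p r by auto
  show "norm (outer_normal \<Omega> x) = 1"
    unfolding outer_normal_eq(1)[OF x] by (rule norm_graph_normal)
  show "\<gamma> 0 = x \<Longrightarrow> \<forall>\<^sub>F t in at 0. \<gamma> t \<in> frontier \<Omega> \<Longrightarrow> (\<gamma> has_vector_derivative v) (at 0) \<Longrightarrow>
      v \<bullet> outer_normal \<Omega> x = 0"
    unfolding outer_normal_eq(1)[OF x] by (rule outer_normal_eq(2)[OF x])
qed

text \<open>Differentiating \<open>\<gamma>' \<bullet> N \<circ> \<gamma> = 0\<close> and \<open>norm (N \<circ> \<gamma>) = 1\<close> along a curve \<open>\<gamma>\<close> in the boundary
  gives the Weingarten equation.\<close>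

lemma derivative_outer_normal:
  assumes dom: "open \<Omega>" "smooth_boundary \<Omega>" and x: "x \<in> frontier \<Omega>"
    and N: "(N has_derivative D) (at x)" "\<And>y. y \<in> frontier \<Omega> \<Longrightarrow> N y = outer_normal \<Omega> y"
  shows "D (rot90 (N x)) = curvature \<Omega> x *\<^sub>R rot90 (N x)"
proof -
  obtain r e h h' h'' where "boundary_chart \<Omega> x r e h h' h''"
    using boundary_chart_exists dom x by blast
  then interpret C: boundary_chart \<Omega> x r e h h' h'' .
  define T where "T = rot90 (N x)"
  interpret D: bounded_linear D using N(1) by (rule has_derivative_bounded_linear)
  have n1: "norm (N x) = 1" using outer_normal_props(1)[OF dom x] N(2)[OF x] by simp
  \<comment> \<open>Stated for an arbitrary curve because it serves twice: for the graph, which is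
    the witness in the description of the curvature, and for the uniqueness of the described value.
    \<open>l\<close> is the signed speed with respect to \<open>T\<close>.\<close>
  have along: "\<exists>l. \<gamma>' 0 = l *\<^sub>R T \<and> l\<^sup>2 = (norm (\<gamma>' 0))\<^sup>2 \<and> l * (N x \<bullet> D T) = 0 \<and>
      (\<forall>a. (\<gamma>' has_vector_derivative a) (at 0) \<longrightarrow> - (a \<bullet> N x) = l\<^sup>2 * (T \<bullet> D T))"
    if "\<epsilon> > 0" and \<gamma>0: "\<gamma> 0 = x"
      and \<gamma>: "\<And>t. t \<in> {-\<epsilon><..<\<epsilon>} \<Longrightarrow> \<gamma> t \<in> frontier \<Omega>"
        "\<And>t. t \<in> {-\<epsilon><..<\<epsilon>} \<Longrightarrow> (\<gamma> has_vector_derivative \<gamma>' t) (at t)" for \<gamma> \<gamma>' \<epsilon>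
  proof -
    have orth: "\<gamma>' t \<bullet> N (\<gamma> t) = 0" if t: "t \<in> {-\<epsilon><..<\<epsilon>}" for t
    proof -
      have "\<gamma>' t \<bullet> outer_normal \<Omega> (\<gamma> t) = 0"
      \<comment> \<open>Tangency is defined through curves that pass the point at time 0, hence the
        shift of the parameter.\<close>
      proof (rule outer_normal_props(2)[OF dom \<gamma>(1)[OF t], of "\<lambda>s. \<gamma> (s + t)"])
        show "\<forall>\<^sub>F s in at 0. \<gamma> (s + t) \<in> frontier \<Omega>"
          unfolding eventually_at
        proof (intro exI[of _ "\<epsilon> - \<bar>t\<bar>"] conjI ballI impI)
          show "\<epsilon> - \<bar>t\<bar> > 0" using t by auto
          fix s :: real assume "s \<noteq> 0 \<and> dist s 0 < \<epsilon> - \<bar>t\<bar>"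
          then have "s + t \<in> {-\<epsilon><..<\<epsilon>}" by (auto simp: dist_real_def)
          then show "\<gamma> (s + t) \<in> frontier \<Omega>" by (rule \<gamma>(1))
        qed
        have "((\<lambda>s. s + t) has_vector_derivative 1) (at 0)"
          unfolding has_real_derivative_iff_has_vector_derivative[symmetric]
          by (auto intro!: derivative_eq_intros)
        from vector_diff_chain_at[OF this, of \<gamma> "\<gamma>' t"]
        show "((\<lambda>s. \<gamma> (s + t)) has_vector_derivative \<gamma>' t) (at 0)"
          using \<gamma>(2)[OF t] by (simp add: o_def)
      qed simp
      then show ?thesis using N(2)[OF \<gamma>(1)[OF t]] by simp
    qed
    have in0: "0 \<in> {-\<epsilon><..<\<epsilon>}" using \<open>\<epsilon> > 0\<close> by simp
    define l where "l = \<gamma>' 0 \<bullet> T"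
    have "\<gamma>' 0 \<bullet> N x = 0" using orth[OF in0] \<gamma>0 by simp
    then have l: "\<gamma>' 0 = l *\<^sub>R T"
      using rotated_basis_expansion[OF n1, of "\<gamma>' 0"] by (simp add: l_def T_def)
    have "norm T = 1" using n1 by (simp add: T_def)
    then have l2: "l\<^sup>2 = (norm (\<gamma>' 0))\<^sup>2" by (simp add: l power2_eq_square)
    have d\<gamma>: "(\<gamma> has_vector_derivative l *\<^sub>R T) (at 0)" using \<gamma>(2)[OF in0] l by simp
    have "((\<lambda>t. N (\<gamma> t)) has_derivative (\<lambda>r. D (r *\<^sub>R (l *\<^sub>R T)))) (at 0)"
      using diff_chain_at[OF d\<gamma>[unfolded has_vector_derivative_def], of N D] N(1) \<gamma>0
      by (simp add: o_def)
    then have dN: "((\<lambda>t. N (\<gamma> t)) has_vector_derivative l *\<^sub>R D T) (at 0)"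
      by (simp add: has_vector_derivative_def D.scaleR)
    have nh: "\<forall>\<^sub>F t in nhds 0. t \<in> {-\<epsilon><..<\<epsilon>}"
      using in0 by (intro eventually_nhds_in_open) auto
    have zero: "d = 0" if "(F has_real_derivative d) (at 0)" "\<And>t. t \<in> {-\<epsilon><..<\<epsilon>} \<Longrightarrow> F t = c" for F d c
    proof -
      have "\<forall>\<^sub>F t in nhds 0. F t = c" using nh by eventually_elim (rule that(2))
      from DERIV_cong_ev[OF refl this refl, of d] that(1)
      have "((\<lambda>_. c) has_real_derivative d) (at 0)" by simp
      then show ?thesis using DERIV_const DERIV_unique by blast
    qed
    have inner: "((\<lambda>t. f t \<bullet> g t) has_real_derivative f 0 \<bullet> g' + f' \<bullet> g 0) (at 0)"
      if "(f has_vector_derivative f') (at 0)" "(g has_vector_derivative g') (at 0)"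
      for f g :: "real \<Rightarrow> real \<times> real" and f' g'
    proof -
      have "(\<lambda>r. f 0 \<bullet> (r *\<^sub>R g') + r *\<^sub>R f' \<bullet> g 0) = (*) (f 0 \<bullet> g' + f' \<bullet> g 0)"
        by (auto simp: fun_eq_iff algebra_simps)
      then show ?thesis
        using has_derivative_inner[OF that[unfolded has_vector_derivative_def]]
        by (simp add: has_field_derivative_def)
    qed
    have "N x \<bullet> (l *\<^sub>R D T) + (l *\<^sub>R D T) \<bullet> N x = 0"
    proof (rule zero[where c = 1])
      show "((\<lambda>t. N (\<gamma> t) \<bullet> N (\<gamma> t)) has_real_derivative N x \<bullet> (l *\<^sub>R D T) + (l *\<^sub>R D T) \<bullet> N x) (at 0)"
        using inner[OF dN dN] by (simp add: \<gamma>0)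
      show "N (\<gamma> t) \<bullet> N (\<gamma> t) = 1" if "t \<in> {-\<epsilon><..<\<epsilon>}" for t
        using outer_normal_props(1)[OF dom \<gamma>(1)[OF that]] N(2)[OF \<gamma>(1)[OF that]]
        by (simp add: norm_eq_1)
    qed
    then have ND: "l * (N x \<bullet> D T) = 0" by (simp add: inner_commute)
    have "- (a \<bullet> N x) = l\<^sup>2 * (T \<bullet> D T)" if "(\<gamma>' has_vector_derivative a) (at 0)" for a
    proof -
      have "\<gamma>' 0 \<bullet> (l *\<^sub>R D T) + a \<bullet> N x = 0"
      proof (rule zero[where c = 0])
        show "((\<lambda>t. \<gamma>' t \<bullet> N (\<gamma> t)) has_real_derivative \<gamma>' 0 \<bullet> (l *\<^sub>R D T) + a \<bullet> N x) (at 0)"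
          using inner[OF that dN] by (simp add: \<gamma>0)
      qed (rule orth)
      then show ?thesis by (simp add: l power2_eq_square)
    qed
    then show ?thesis using l l2 ND by blast
  qed
  define g where "g = (\<lambda>t. (x \<bullet> e + t) *\<^sub>R e + h (x \<bullet> e + t) *\<^sub>R rot90 e)"
  define g' where "g' = (\<lambda>t. e + h' (x \<bullet> e + t) *\<^sub>R rot90 e)"
  have xr: "x \<in> ball x r" using C.r by simp
  have g0: "g 0 = x" using C.graph_curve_frontier(1)[OF x xr] by (simp add: g_def)
  obtain \<epsilon> where \<epsilon>: "\<epsilon> > 0" "\<And>t. t \<in> {-\<epsilon><..<\<epsilon>} \<Longrightarrow> g t \<in> frontier \<Omega>"
  proof -
    obtain \<epsilon> where "\<epsilon> > 0" "\<forall>s. \<bar>s - x \<bullet> e\<bar> < \<epsilon> \<longrightarrow> s *\<^sub>R e + h s *\<^sub>R rot90 e \<in> frontier \<Omega>"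
      using C.graph_curve_frontier(2)[OF x xr] by blast
    then show ?thesis by (intro that[of \<epsilon>]) (auto simp: g_def)
  qed
  have shift: "((\<lambda>t. x \<bullet> e + t) has_vector_derivative 1) (at t)" for t
    unfolding has_real_derivative_iff_has_vector_derivative[symmetric]
    by (auto intro!: derivative_eq_intros)
  have dg: "(g has_vector_derivative g' t) (at t)" for t
    using vector_diff_chain_at[OF shift[of t] C.graph_curve_deriv]
    by (simp add: g_def[abs_def] g'_def o_def)
  have dg': "(g' has_vector_derivative h'' (x \<bullet> e) *\<^sub>R rot90 e) (at 0)"
  proof -
    have "((\<lambda>s. e + h' s *\<^sub>R rot90 e) has_vector_derivative h'' (x \<bullet> e) *\<^sub>R rot90 e) (at (x \<bullet> e))"
      unfolding has_vector_derivative_def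
      using C.h'[of "x \<bullet> e", unfolded has_field_derivative_def]
      by (auto intro!: derivative_eq_intros simp: algebra_simps)
    with vector_diff_chain_at[OF shift[of 0], of "\<lambda>s. e + h' s *\<^sub>R rot90 e"]
    show ?thesis by (simp add: g'_def[abs_def] o_def)
  qed
  have g'0: "g' 0 \<noteq> 0"
  proof
    assume "g' 0 = 0"
    moreover have "g' 0 \<bullet> e = 1" by (simp add: g'_def inner_add_left C.ee)
    ultimately show False by simp
  qed
  have curv: "curvature \<Omega> x = T \<bullet> D T"
    unfolding curvature_def
  proof (rule the_equality)
    obtain l where l: "g' 0 = l *\<^sub>R T" "l\<^sup>2 = (norm (g' 0))\<^sup>2"
      "- (h'' (x \<bullet> e) *\<^sub>R rot90 e \<bullet> N x) = l\<^sup>2 * (T \<bullet> D T)"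
      using along[OF \<epsilon>(1) g0 \<epsilon>(2) dg] dg' by blast
    have "T \<bullet> D T = - (h'' (x \<bullet> e) *\<^sub>R rot90 e \<bullet> outer_normal \<Omega> x) / (norm (g' 0))\<^sup>2"
      using l(2,3) g'0 N(2)[OF x] by simp
    then show "\<exists>\<gamma> \<gamma>' a. \<exists>\<epsilon>>0. \<gamma> 0 = x \<and>
        (\<forall>t\<in>{-\<epsilon><..<\<epsilon>}. \<gamma> t \<in> frontier \<Omega> \<and> (\<gamma> has_vector_derivative \<gamma>' t) (at t)) \<and>
        \<gamma>' 0 \<noteq> 0 \<and> (\<gamma>' has_vector_derivative a) (at 0) \<and>
        T \<bullet> D T = - (a \<bullet> outer_normal \<Omega> x) / (norm (\<gamma>' 0))\<^sup>2"
      using \<epsilon> g0 dg dg' g'0 by blast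
  next
    fix k
    assume "\<exists>\<gamma> \<gamma>' a. \<exists>\<epsilon>>0. \<gamma> 0 = x \<and>
        (\<forall>t\<in>{-\<epsilon><..<\<epsilon>}. \<gamma> t \<in> frontier \<Omega> \<and> (\<gamma> has_vector_derivative \<gamma>' t) (at t)) \<and>
        \<gamma>' 0 \<noteq> 0 \<and> (\<gamma>' has_vector_derivative a) (at 0) \<and>
        k = - (a \<bullet> outer_normal \<Omega> x) / (norm (\<gamma>' 0))\<^sup>2"
    then obtain \<gamma> \<gamma>' a \<epsilon> where *: "\<epsilon> > 0" "\<gamma> 0 = x"
      "\<And>t. t \<in> {-\<epsilon><..<\<epsilon>} \<Longrightarrow> \<gamma> t \<in> frontier \<Omega>"
      "\<And>t. t \<in> {-\<epsilon><..<\<epsilon>} \<Longrightarrow> (\<gamma> has_vector_derivative \<gamma>' t) (at t)"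
      and a: "\<gamma>' 0 \<noteq> 0" "(\<gamma>' has_vector_derivative a) (at 0)"
        "k = - (a \<bullet> outer_normal \<Omega> x) / (norm (\<gamma>' 0))\<^sup>2" by blast
    obtain l where "l\<^sup>2 = (norm (\<gamma>' 0))\<^sup>2" "- (a \<bullet> N x) = l\<^sup>2 * (T \<bullet> D T)"
      using along[OF *] a(2) by blast
    then show "k = T \<bullet> D T" using a(1,3) N(2)[OF x] by simp
  qed
  obtain l where l: "g' 0 = l *\<^sub>R T" "l * (N x \<bullet> D T) = 0"
    using along[OF \<epsilon>(1) g0 \<epsilon>(2) dg] by blast
  then have "N x \<bullet> D T = 0" using g'0 by auto
  then have "D T = (D T \<bullet> T) *\<^sub>R T"
    using rotated_basis_expansion[OF n1, of "D T"] by (simp add: T_def inner_commute)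
  then show ?thesis using curv by (simp add: T_def inner_commute)
qed

section \<open>Green's formula on a smooth domain\<close>

lemma C1_on_subset: "C1_on C A p g \<Longrightarrow> D \<subseteq> C \<Longrightarrow> B \<subseteq> A \<Longrightarrow> C1_on D B p g"
  unfolding C1_on_def by (auto intro: continuous_on_subset)

lemma C1_on_const: "C1_on C A (\<lambda>_. k) (\<lambda>_. 0)"
  by (simp add: C1_on_def)

lemma C1_on_inner: "C1_on C A (\<lambda>x. x \<bullet> w) (\<lambda>_. w)"
  unfolding C1_on_def
  by (auto intro!: continuous_intros derivative_eq_intros simp: inner_commute)

lemma C1_on_add:
  assumes "C1_on C A p g" "C1_on C A q k"
  shows "C1_on C A (\<lambda>x. p x + q x) (\<lambda>x. g x + k x)"
  using assms unfolding C1_on_def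
  by (auto intro!: continuous_intros derivative_eq_intros simp: inner_add_left)

lemma C1_on_mult:
  assumes "C1_on C A p g" "C1_on C A q k"
  shows "C1_on C A (\<lambda>x. p x * q x) (\<lambda>x. p x *\<^sub>R k x + q x *\<^sub>R g x)"
  using assms unfolding C1_on_def
  by (auto intro!: continuous_intros derivative_eq_intros simp: inner_add_left mult.commute)

lemma C1_on_sum:
  assumes "\<And>i. i \<in> I \<Longrightarrow> C1_on C A (p i) (g i)"
  shows "C1_on C A (\<lambda>x. \<Sum>i\<in>I. p i x) (\<lambda>x. \<Sum>i\<in>I. g i x)"
proof -
  have "((\<lambda>x. \<Sum>i\<in>I. p i x) has_derivative (\<lambda>v. \<Sum>i\<in>I. g i x \<bullet> v)) (at x)" if "x \<in> A" for x
    using assms that unfolding C1_on_def by (intro has_derivative_sum) auto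
  then have "((\<lambda>x. \<Sum>i\<in>I. p i x) has_derivative (\<lambda>v. (\<Sum>i\<in>I. g i x) \<bullet> v)) (at x)" if "x \<in> A" for x
    using that by (simp only: inner_sum_left)
  then show ?thesis
    using assms unfolding C1_on_def by (intro conjI ballI continuous_on_sum) auto
qed

lemma C1_on_compose:
  assumes p: "C1_on C A p g"
    and f: "\<And>y. y \<in> T \<Longrightarrow> (f has_real_derivative f' y) (at y)" "continuous_on T f'"
    and T: "p ` C \<subseteq> T" "p ` A \<subseteq> T"
  shows "C1_on C A (\<lambda>x. f (p x)) (\<lambda>x. f' (p x) *\<^sub>R g x)"
proof -
  have "continuous_on T f"
    using f(1) by (meson DERIV_isCont continuous_at_imp_continuous_on)
  moreover have d: "((\<lambda>x. f (p x)) has_derivative (\<lambda>v. f' (p x) *\<^sub>R g x \<bullet> v)) (at x)" if "x \<in> A" for x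
  proof -
    have "(f has_derivative (*) (f' (p x))) (at (p x))"
      using f(1)[of "p x"] that T by (auto simp: has_field_derivative_def)
    moreover have "(p has_derivative (\<lambda>v. g x \<bullet> v)) (at x)" using p that by (auto simp: C1_on_def)
    ultimately show ?thesis using diff_chain_at[of p _ x f] by (simp add: o_def)
  qed
  ultimately show ?thesis
    using p T f(2) unfolding C1_on_def
    by (intro conjI ballI d continuous_on_scaleR) (auto intro: continuous_on_compose2)
qed

text \<open>Serves to identify the sum of the gradients of the localised pieces of a function with
  its own gradient.\<close>

lemma C1_on_unique:
  assumes "C1_on C A p g" "C1_on C A q k" "open A" "\<And>x. x \<in> A \<Longrightarrow> p x = q x" "x \<in> A"
  shows "g x = k x"
proof -
  have "(p has_derivative (\<lambda>v. g x \<bullet> v)) (at x)" "(q has_derivative (\<lambda>v. k x \<bullet> v)) (at x)"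
    using assms by (auto simp: C1_on_def)
  moreover from this(2) have "(p has_derivative (\<lambda>v. k x \<bullet> v)) (at x)"
    by (rule has_derivative_transform_within_open[OF _ \<open>open A\<close> \<open>x \<in> A\<close>]) (simp add: assms(4))
  ultimately have "(\<lambda>v. g x \<bullet> v) = (\<lambda>v. k x \<bullet> v)" using has_derivative_unique by blast
  then show ?thesis by (metis vector_eq_rdot)
qed

section \<open>Bump functions and the normal field\<close>

lemma has_real_derivative_pos_part_square:
  "((\<lambda>y. (max 0 y)\<^sup>2) has_real_derivative 2 * max 0 y) (at y)" for y :: real
proof (cases y "0::real" rule: linorder_cases)
  case less
  have "((\<lambda>_. 0) has_real_derivative 0) (at y)" by simp
  then show ?thesis
    using less has_field_derivative_transform_within_open[of "\<lambda>_. 0" 0 y "{..<0}" "\<lambda>y. (max 0 y)\<^sup>2"]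
    by auto
next
  case greater
  have "((\<lambda>y. y\<^sup>2) has_real_derivative 2 * y) (at y)" by (auto intro!: derivative_eq_intros)
  then show ?thesis
    using greater has_field_derivative_transform_within_open[of "\<lambda>y. y\<^sup>2" "2 * y" y "{0<..}" "\<lambda>y. (max 0 y)\<^sup>2"]
    by auto
next
  case equal
  have "((\<lambda>z. max 0 z :: real) \<longlongrightarrow> 0) (at 0)"
    using tendsto_max[OF tendsto_const[of 0] tendsto_ident_at[of "0::real" UNIV]] by simp
  then have "((\<lambda>z::real. (max 0 z)\<^sup>2 / z) \<longlongrightarrow> 0) (at 0)"
    by (rule Lim_transform_eventually)
      (auto simp: eventually_at max_def power2_eq_square intro!: exI[of _ 1])
  then show ?thesis by (simp add: equal has_field_derivative_iff)
qed

text \<open>Squaring the positive part removes the kink at radius \<open>\<rho>\<close> and gives a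
  C1 function with an explicit gradient.\<close>

definition bump :: "real \<times> real \<Rightarrow> real \<Rightarrow> real \<times> real \<Rightarrow> real" where
  "bump c \<rho> x = (max 0 (\<rho>\<^sup>2 - (x - c) \<bullet> (x - c)))\<^sup>2"

text \<open>The factor 4 is 2 from the outer square times 2 from the gradient of
  \<open>(x - c) \<bullet> (x - c)\<close>.\<close>

definition grad_bump :: "real \<times> real \<Rightarrow> real \<Rightarrow> real \<times> real \<Rightarrow> real \<times> real" where
  "grad_bump c \<rho> x = (- 4 * max 0 (\<rho>\<^sup>2 - (x - c) \<bullet> (x - c))) *\<^sub>R (x - c)"

lemma C1_on_bump: "C1_on C A (bump c \<rho>) (grad_bump c \<rho>)"
proof -
  have "C1_on C A (\<lambda>x. \<rho>\<^sup>2 - (x - c) \<bullet> (x - c)) (\<lambda>x. - 2 *\<^sub>R (x - c))"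
    unfolding C1_on_def
    by (auto intro!: continuous_intros derivative_eq_intros simp: inner_commute algebra_simps)
  from C1_on_compose[OF this has_real_derivative_pos_part_square, where T = UNIV]
  show ?thesis
    unfolding bump_def[abs_def] grad_bump_def[abs_def]
    by (simp add: continuous_intros mult.assoc)
qed

lemma bump_nonneg: "bump c \<rho> x \<ge> 0"
  by (simp add: bump_def)

lemma inner_less_iff_mem_ball: "\<rho> > 0 \<Longrightarrow> (x - c) \<bullet> (x - c) < \<rho>\<^sup>2 \<longleftrightarrow> x \<in> ball c \<rho>"
  by (simp add: dist_norm norm_minus_commute flip: power2_norm_eq_inner)
    (smt (verit) norm_ge_zero power2_less_imp_less power_strict_mono zero_less_numeral)

lemma bump_pos_iff: "\<rho> > 0 \<Longrightarrow> bump c \<rho> x > 0 \<longleftrightarrow> x \<in> ball c \<rho>"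
  using inner_less_iff_mem_ball[of \<rho> x c] by (auto simp: bump_def max_def)

lemma bump_outside:
  assumes "\<rho> > 0" "x \<notin> ball c \<rho>"
  shows "bump c \<rho> x = 0" "grad_bump c \<rho> x = 0"
  using inner_less_iff_mem_ball[of \<rho> x c] assms by (auto simp: bump_def grad_bump_def max_def)

text \<open>Each component is a smooth function of \<open>h' (x \<bullet> e)\<close>, so its
  gradient exists by the chain rule and contains \<open>h''\<close>.\<close>

lemma C1_on_graph_normal:
  assumes h': "\<And>s. (h' has_real_derivative h'' s) (at s)" "continuous_on UNIV h''"
  shows "\<exists>g. C1_on C A (\<lambda>x. graph_normal e h' x \<bullet> w) g"
proof -
  define f where "f = (\<lambda>y::real. inverse (sqrt (1 + y\<^sup>2)))"
  define f' where "f' = (\<lambda>y::real. - (y * inverse (sqrt (1 + y\<^sup>2)) ^ 3))"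
  have pos: "1 + y\<^sup>2 > 0" for y :: real by (simp add: add_pos_nonneg)
  have f: "(f has_real_derivative f' y) (at y)" for y
  proof -
    have "((\<lambda>y. sqrt (1 + y\<^sup>2)) has_real_derivative y * inverse (sqrt (1 + y\<^sup>2))) (at y)"
      using pos[of y] by (auto intro!: derivative_eq_intros simp: field_simps)
    then show ?thesis
      unfolding f_def f'_def using pos[of y]
      by (auto intro!: derivative_eq_intros simp: power3_eq_cube)
  qed
  have f'c: "continuous_on UNIV f'"
    unfolding f'_def using pos by (intro continuous_intros) (auto simp: less_imp_neq[symmetric])
  have k: "C1_on C A (\<lambda>x. h' (x \<bullet> e)) (\<lambda>x. h'' (x \<bullet> e) *\<^sub>R e)"
    by (rule C1_on_compose[OF C1_on_inner h']) auto
  have a: "C1_on C A (\<lambda>x. f (h' (x \<bullet> e))) (\<lambda>x. f' (h' (x \<bullet> e)) *\<^sub>R (h'' (x \<bullet> e) *\<^sub>R e))"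
    by (rule C1_on_compose[OF k f f'c]) auto
  from C1_on_mult[OF a C1_on_add[OF C1_on_const[of _ _ "rot90 e \<bullet> w"] C1_on_mult[OF k C1_on_const[of _ _ "- (e \<bullet> w)"]]]]
  obtain g where "C1_on C A (\<lambda>x. f (h' (x \<bullet> e)) * (rot90 e \<bullet> w + h' (x \<bullet> e) * - (e \<bullet> w))) g"
    by blast
  moreover have "(\<lambda>x. f (h' (x \<bullet> e)) * (rot90 e \<bullet> w + h' (x \<bullet> e) * - (e \<bullet> w))) =
      (\<lambda>x. graph_normal e h' x \<bullet> w)"
    by (auto simp: graph_normal_def f_def inner_diff_left inverse_eq_divide)
  ultimately show ?thesis by auto
qed

lemma set_integrable_continuous_closure:
  fixes F :: "'a::euclidean_space \<Rightarrow> real"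
  assumes "open \<Omega>" "bounded \<Omega>" "continuous_on (closure \<Omega>) F"
  shows "set_integrable lborel \<Omega> F"
proof (rule set_integrable_subset)
  show "set_integrable lborel (closure \<Omega>) F"
    unfolding set_integrable_def
    by (rule borel_integrable_compact) (use assms in \<open>auto simp: compact_closure\<close>)
qed (use assms closure_subset in auto)

text \<open>Finitely many patches cover the compact closure. Dividing their bump functions by the
  sum \<open>S\<close>, which is positive on the open set \<open>U\<close>, makes them a partition
  of unity. The patch normals averaged with these weights form \<open>N\<close>: at a frontier point
  every patch of nonzero weight contributes the same outer normal. That \<open>N\<close> is C1 on a
  full neighbourhood of the closure makes it differentiable at the frontier points
  themselves.\<close>

lemma green_domain:
  assumes \<Omega>: "bounded_smooth_domain \<Omega>" and \<sigma>: "arc_length_measure (frontier \<Omega>) \<sigma>"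
  obtains U N g1 g2 where "open U" "closure \<Omega> \<subseteq> U"
    "C1_on U U (\<lambda>x. fst (N x)) g1" "C1_on U U (\<lambda>x. snd (N x)) g2"
    "\<And>x. x \<in> frontier \<Omega> \<Longrightarrow> N x = outer_normal \<Omega> x"
    "\<And>g :: real \<times> real \<Rightarrow> real. continuous_on (frontier \<Omega>) g \<Longrightarrow> set_integrable \<sigma> (frontier \<Omega>) g"
    "\<And>P gP q gq. C1_on (closure \<Omega>) \<Omega> P gP \<Longrightarrow> C1_on (closure \<Omega>) \<Omega> q gq \<Longrightarrow>
      (LINT x:\<Omega>|lborel. rot90 (gP x) \<bullet> gq x) = (LINT x:frontier \<Omega>|\<sigma>. P x * (gq x \<bullet> rot90 (N x)))"
proof -
  have op: "open \<Omega>" and sm: "smooth_boundary \<Omega>" and bd: "bounded \<Omega>"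
    using \<Omega> by (auto simp: bounded_smooth_domain_def)
  define Q where "Q = (\<lambda>p \<rho> e h h' h'' a b c. \<rho> > 0 \<and> graph_patch \<Omega> (ball p \<rho>) e h h' a b c \<and>
    (\<forall>s. (h' has_real_derivative h'' s) (at s)) \<and> continuous_on UNIV h'' \<and>
    (\<forall>x\<in>frontier \<Omega> \<inter> ball p \<rho>. outer_normal \<Omega> x = graph_normal e h' x))"
  have "\<forall>p\<in>closure \<Omega>. \<exists>\<rho> e h h' h'' a b c. Q p \<rho> e h h' h'' a b c"
    unfolding Q_def using patch_exists[OF op sm] by blast
  then obtain \<rho> e h h' h'' a b c where
    Q: "\<And>p. p \<in> closure \<Omega> \<Longrightarrow> Q p (\<rho> p) (e p) (h p) (h' p) (h'' p) (a p) (b p) (c p)"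
    by metis
  have \<rho>: "\<rho> p > 0" if "p \<in> closure \<Omega>" for p using Q[OF that] by (simp add: Q_def)
  obtain I where I: "I \<subseteq> closure \<Omega>" "finite I" "closure \<Omega> \<subseteq> (\<Union>p\<in>I. ball p (\<rho> p))"
  proof (rule compactE_image[of "closure \<Omega>" "closure \<Omega>" "\<lambda>p. ball p (\<rho> p)"])
    show "closure \<Omega> \<subseteq> (\<Union>p\<in>closure \<Omega>. ball p (\<rho> p))" using \<rho> by auto
  qed (use bd in \<open>auto simp: compact_closure\<close>)
  define \<phi> where "\<phi> = (\<lambda>p. bump p (\<rho> p))"
  define g\<phi> where "g\<phi> = (\<lambda>p. grad_bump p (\<rho> p))"
  define S where "S = (\<lambda>x. \<Sum>p\<in>I. \<phi> p x)"
  define U where "U = {x. 0 < S x}"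
  have \<phi>C1: "C1_on C A (\<phi> p) (g\<phi> p)" for C A p unfolding \<phi>_def g\<phi>_def by (rule C1_on_bump)
  have SC1: "C1_on C A S (\<lambda>x. \<Sum>p\<in>I. g\<phi> p x)" for C A
    unfolding S_def by (rule C1_on_sum) (rule \<phi>C1)
  have "continuous_on UNIV S" using SC1[of UNIV UNIV] by (simp add: C1_on_def)
  then have openU: "open U" unfolding U_def by (intro open_Collect_less continuous_intros)
  have clU: "closure \<Omega> \<subseteq> U"
  proof
    fix x assume "x \<in> closure \<Omega>"
    then obtain p where p: "p \<in> I" "x \<in> ball p (\<rho> p)" using I(3) by blast
    then have "\<phi> p x > 0" using bump_pos_iff[OF \<rho>, of p p x] I(1) by (auto simp: \<phi>_def)
    then have "S x > 0"
      unfolding S_def using p(1) I(2) by (intro sum_pos2) (auto simp: \<phi>_def bump_nonneg)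
    then show "x \<in> U" by (simp add: U_def)
  qed
  define R where "R = (\<lambda>x. inverse (S x))"
  obtain gR where RC1: "C1_on U U R gR"
  proof -
    have "C1_on U U (\<lambda>x. inverse (S x)) (\<lambda>x. (- (inverse (S x) ^ Suc (Suc 0))) *\<^sub>R (\<Sum>p\<in>I. g\<phi> p x))"
    proof (rule C1_on_compose[OF SC1, where T = "{0<..}"])
      show "(inverse has_real_derivative - (inverse y ^ Suc (Suc 0))) (at y)" if "y \<in> {0<..}" for y :: real
        using that by (intro DERIV_inverse) auto
    qed (auto simp: U_def intro!: continuous_intros)
    then show ?thesis using that unfolding R_def by blast
  qed
  have RS: "R x * S x = 1" if "x \<in> U" for x using that by (simp add: R_def U_def)
  define N where "N = (\<lambda>x. R x *\<^sub>R (\<Sum>p\<in>I. \<phi> p x *\<^sub>R graph_normal (e p) (h' p) x))"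
  have NC1: "\<exists>g. C1_on U U (\<lambda>x. N x \<bullet> w) g" for w
  proof -
    have "\<exists>g. C1_on U U (\<lambda>x. graph_normal (e p) (h' p) x \<bullet> w) g" if "p \<in> I" for p
      using Q[of p] that I(1) by (intro C1_on_graph_normal[where h'' = "h'' p"]) (auto simp: Q_def)
    then obtain g where g: "\<And>p. p \<in> I \<Longrightarrow> C1_on U U (\<lambda>x. graph_normal (e p) (h' p) x \<bullet> w) (g p)"
      by metis
    have "\<exists>g. C1_on U U (\<lambda>x. R x * (\<Sum>p\<in>I. \<phi> p x * (graph_normal (e p) (h' p) x \<bullet> w))) g"
      by (rule exI, rule C1_on_mult[OF RC1 C1_on_sum], rule C1_on_mult[OF \<phi>C1 g])
    then show ?thesis by (simp add: N_def inner_sum_left)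
  qed
  obtain g1 where g1: "C1_on U U (\<lambda>x. fst (N x)) g1"
    using NC1[of "(1, 0)"] by (auto simp: inner_prod_def)
  obtain g2 where g2: "C1_on U U (\<lambda>x. snd (N x)) g2"
    using NC1[of "(0, 1)"] by (auto simp: inner_prod_def)
  have N: "N x = outer_normal \<Omega> x" if x: "x \<in> frontier \<Omega>" for x
  proof -
    have "\<phi> p x *\<^sub>R graph_normal (e p) (h' p) x = \<phi> p x *\<^sub>R outer_normal \<Omega> x" if "p \<in> I" for p
    proof (cases "x \<in> ball p (\<rho> p)")
      case True
      then show ?thesis using Q[of p] that I(1) x by (auto simp: Q_def)
    next
      case False
      then show ?thesis using bump_outside(1)[OF \<rho> False] that I(1) by (auto simp: \<phi>_def)
    qed
    then have "N x = R x *\<^sub>R (\<Sum>p\<in>I. \<phi> p x *\<^sub>R outer_normal \<Omega> x)"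
      unfolding N_def by (metis (mono_tags, lifting) sum.cong)
    also have "\<dots> = (R x * S x) *\<^sub>R outer_normal \<Omega> x" by (simp add: S_def flip: scaleR_sum_left)
    finally show ?thesis using RS[of x] x clU by (auto simp: frontier_def)
  qed
  have fc: "frontier \<Omega> \<subseteq> closure \<Omega>" by (simp add: frontier_def)
  have contN: "continuous_on (frontier \<Omega>) N"
  proof -
    have "continuous_on U (\<lambda>x. fst (N x))" "continuous_on U (\<lambda>x. snd (N x))"
      using g1 g2 by (auto simp: C1_on_def)
    from continuous_on_Pair[OF this] have "continuous_on U N" by simp
    then show ?thesis using fc clU by (auto intro: continuous_on_subset)
  qed
  have patch_int: "set_integrable \<sigma> (frontier \<Omega>) (\<lambda>x. \<phi> p x * g x)"
    if "p \<in> I" "continuous_on (frontier \<Omega>) g" for p and g :: "real \<times> real \<Rightarrow> real"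
  proof -
    interpret graph_patch \<Omega> "ball p (\<rho> p)" "e p" "h p" "h' p" "a p" "b p" "c p"
      using Q[of p] that I(1) by (auto simp: Q_def)
    show ?thesis
    proof (rule boundary_integral(1)[OF \<sigma>])
      show "continuous_on (frontier \<Omega>) (\<lambda>x. \<phi> p x * g x)"
        using \<phi>C1[of "frontier \<Omega>" "{}" p] that by (auto simp: C1_on_def intro!: continuous_intros)
      show "\<phi> p x * g x = 0" if "x \<notin> ball p (\<rho> p)" for x
        using bump_outside(1)[OF \<rho> that] \<open>p \<in> I\<close> I(1) by (auto simp: \<phi>_def)
    qed
  qed
  have contR: "continuous_on (frontier \<Omega>) R"
    using RC1 fc clU by (auto simp: C1_on_def intro: continuous_on_subset)
  have int: "set_integrable \<sigma> (frontier \<Omega>) g"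
    if "continuous_on (frontier \<Omega>) g" for g :: "real \<times> real \<Rightarrow> real"
  proof -
    have "set_integrable \<sigma> (frontier \<Omega>) (\<lambda>x. \<Sum>p\<in>I. \<phi> p x * (R x * g x))"
    proof -
      have "set_integrable \<sigma> (frontier \<Omega>) (\<lambda>x. \<phi> p x * (R x * g x))" if "p \<in> I" for p
        by (intro patch_int that continuous_intros contR) fact
      then show ?thesis
        unfolding set_integrable_def scaleR_sum_right by (intro Bochner_Integration.integrable_sum)
    qed
    moreover have "(\<Sum>p\<in>I. \<phi> p x * (R x * g x)) = g x" if "x \<in> frontier \<Omega>" for x
    proof -
      have "(\<Sum>p\<in>I. \<phi> p x * (R x * g x)) = (R x * S x) * g x"
        by (simp add: S_def sum_distrib_left sum_distrib_right mult_ac)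
      then show ?thesis using RS[of x] that fc clU by auto
    qed
    ultimately show ?thesis
      by (subst (asm) set_integrable_cong[OF refl refl]) auto
  qed
  have green: "(LINT x:\<Omega>|lborel. rot90 (gP x) \<bullet> gq x) = (LINT x:frontier \<Omega>|\<sigma>. P x * (gq x \<bullet> rot90 (N x)))"
    if P: "C1_on (closure \<Omega>) \<Omega> P gP" and q: "C1_on (closure \<Omega>) \<Omega> q gq" for P gP q gq
  proof -
    have \<Omega>U: "\<Omega> \<subseteq> U" using clU closure_subset by blast
    \<comment> \<open>The normalising factor is put into \<open>P\<close> once. Each piece is then a
      bump function times a fixed C1 function, and vanishes outside its ball together with its
      gradient.\<close>
    obtain gW where W: "C1_on (closure \<Omega>) \<Omega> (\<lambda>x. R x * P x) gW"
      using C1_on_mult[OF C1_on_subset[OF RC1 clU \<Omega>U] P] by blast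
    define Pp where "Pp = (\<lambda>p x. \<phi> p x * (R x * P x))"
    define gp where "gp = (\<lambda>p x. \<phi> p x *\<^sub>R gW x + (R x * P x) *\<^sub>R g\<phi> p x)"
    have Pp: "C1_on (closure \<Omega>) \<Omega> (Pp p) (gp p)" for p
      unfolding Pp_def gp_def by (rule C1_on_mult[OF \<phi>C1 W])
    have sumP: "(\<Sum>p\<in>I. Pp p x) = P x" if "x \<in> closure \<Omega>" for x
    proof -
      have "(\<Sum>p\<in>I. Pp p x) = (R x * S x) * P x"
        by (simp add: Pp_def S_def sum_distrib_left sum_distrib_right mult_ac)
      then show ?thesis using RS[of x] that clU by auto
    qed
    have sumg: "(\<Sum>p\<in>I. gp p x) = gP x" if "x \<in> \<Omega>" for x
    proof (rule C1_on_unique[OF C1_on_sum P op _ that])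
      show "C1_on (closure \<Omega>) \<Omega> (Pp p) (gp p)" for p by (rule Pp)
      show "(\<Sum>p\<in>I. Pp p y) = P y" if "y \<in> \<Omega>" for y
        using sumP[of y] that closure_subset[of \<Omega>] by blast
    qed
    have patch: "(LINT x:\<Omega>|lborel. rot90 (gp p x) \<bullet> gq x) =
        (LINT x:frontier \<Omega>|\<sigma>. Pp p x * (gq x \<bullet> rot90 (N x)))" if "p \<in> I" for p
    proof -
      interpret graph_patch \<Omega> "ball p (\<rho> p)" "e p" "h p" "h' p" "a p" "b p" "c p"
        using Q[of p] that I(1) by (auto simp: Q_def)
      have out: "\<phi> p x = 0" "g\<phi> p x = 0" if "x \<notin> ball p (\<rho> p)" for x
        using bump_outside[OF \<rho> that] \<open>p \<in> I\<close> I(1) by (auto simp: \<phi>_def g\<phi>_def)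
      show ?thesis
      proof (rule green_patch[OF \<sigma> Pp q _ _ contN])
        show "Pp p x = 0" "gp p x = 0" if "x \<notin> ball p (\<rho> p)" for x
          using out[OF that] by (simp_all add: Pp_def gp_def)
        fix s assume s: "\<gamma> s \<in> ball p (\<rho> p)" "\<gamma> s \<in> frontier \<Omega>"
        have "N (\<gamma> s) = graph_normal (e p) (h' p) (\<gamma> s)"
          using N[OF s(2)] Q[of p] that I(1) s by (auto simp: Q_def)
        also have "\<gamma> s \<bullet> e p = s" by (simp add: \<gamma>_eq \<Phi>_coords)
        then have "graph_normal (e p) (h' p) (\<gamma> s) =
            (1 / sqrt (1 + (h' p s)\<^sup>2)) *\<^sub>R (rot90 (e p) - h' p s *\<^sub>R e p)"
          by (simp add: graph_normal_def)
        finally show "N (\<gamma> s) = (1 / sqrt (1 + (h' p s)\<^sup>2)) *\<^sub>R (rot90 (e p) - h' p s *\<^sub>R e p)" .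
      qed
    qed
    have contd: "continuous_on (closure \<Omega>) (\<lambda>x. rot90 (gp p x) \<bullet> gq x)" for p
      unfolding rot90_def using Pp[of p] q by (auto simp: C1_on_def intro!: continuous_intros)
    have contb: "continuous_on (frontier \<Omega>) (\<lambda>x. R x * P x * (gq x \<bullet> rot90 (N x)))"
      unfolding rot90_def using P q contN contR unfolding C1_on_def
      by (intro continuous_intros) (auto intro: continuous_on_subset[OF _ fc])
    have "(LINT x:\<Omega>|lborel. rot90 (gP x) \<bullet> gq x) = (LINT x:\<Omega>|lborel. \<Sum>p\<in>I. rot90 (gp p x) \<bullet> gq x)"
    proof (rule set_lebesgue_integral_cong)
      have "rot90 (\<Sum>p\<in>J. gp p x) = (\<Sum>p\<in>J. rot90 (gp p x))" for J x
        by (induction J rule: infinite_finite_induct) auto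
      then have "rot90 (gP x) = (\<Sum>p\<in>I. rot90 (gp p x))" if "x \<in> \<Omega>" for x
        using sumg[OF that] by metis
      then show "\<forall>x. x \<in> \<Omega> \<longrightarrow> rot90 (gP x) \<bullet> gq x = (\<Sum>p\<in>I. rot90 (gp p x) \<bullet> gq x)"
        by (simp add: inner_sum_left)
    qed (use op in auto)
    also have "\<dots> = (\<Sum>p\<in>I. LINT x:\<Omega>|lborel. rot90 (gp p x) \<bullet> gq x)"
      unfolding set_lebesgue_integral_def scaleR_sum_right
      using set_integrable_continuous_closure[OF op bd contd]
      by (intro Bochner_Integration.integral_sum) (auto simp: set_integrable_def)
    also have "\<dots> = (\<Sum>p\<in>I. LINT x:frontier \<Omega>|\<sigma>. Pp p x * (gq x \<bullet> rot90 (N x)))"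
      by (intro sum.cong patch) auto
    also have "\<dots> = (LINT x:frontier \<Omega>|\<sigma>. \<Sum>p\<in>I. Pp p x * (gq x \<bullet> rot90 (N x)))"
      unfolding set_lebesgue_integral_def scaleR_sum_right
      using patch_int[OF _ contb]
      by (intro Bochner_Integration.integral_sum[symmetric]) (auto simp: set_integrable_def Pp_def mult.assoc)
    also have "\<dots> = (LINT x:frontier \<Omega>|\<sigma>. P x * (gq x \<bullet> rot90 (N x)))"
    proof -
      have "(\<Sum>p\<in>I. Pp p x * (gq x \<bullet> rot90 (N x))) = P x * (gq x \<bullet> rot90 (N x))" if "x \<in> frontier \<Omega>" for x
        using sumP[of x] that fc by (auto simp flip: sum_distrib_right)
      then show ?thesis
        unfolding set_lebesgue_integral_def
        by (intro Bochner_Integration.integral_cong) (auto simp: indicator_def)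
    qed
    finally show ?thesis .
  qed
  show ?thesis by (rule that[OF openU clU g1 g2 N int green])
qed

section \<open>Functions that are smooth up to the boundary\<close>

lemma partial_deriv_cong:
  assumes "open \<Omega>" "\<And>x. x \<in> \<Omega> \<Longrightarrow> u x = v x" "x \<in> \<Omega>"
  shows "partial_deriv b u x = partial_deriv b v x"
    and "u differentiable (at x) \<longleftrightarrow> v differentiable (at x)"
proof -
  have eq: "(u has_derivative D) (at x) \<longleftrightarrow> (v has_derivative D) (at x)" for D
    using assms has_derivative_transform_within_open[of u D x UNIV \<Omega> v]
      has_derivative_transform_within_open[of v D x UNIV \<Omega> u] by auto
  then show "partial_deriv b u x = partial_deriv b v x"
    by (simp add: partial_deriv_def frechet_derivative_def)
  show "u differentiable (at x) \<longleftrightarrow> v differentiable (at x)"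
    by (simp add: differentiable_def eq)
qed

text \<open>Lets the regularity of \<open>partial_deriv b u\<close> pass to a component of the
  extended gradient, which is known to agree with it in \<open>\<Omega>\<close>.\<close>

lemma derivs_extend_cong:
  assumes "open \<Omega>" "\<And>x. x \<in> \<Omega> \<Longrightarrow> u x = v x"
  shows "derivs_extend k \<Omega> u \<longleftrightarrow> derivs_extend k \<Omega> v"
  using assms(2)
proof (induction k arbitrary: u v)
  case 0
  then show ?case by simp
next
  case (Suc k)
  have "derivs_extend k \<Omega> (partial_deriv b u) \<longleftrightarrow> derivs_extend k \<Omega> (partial_deriv b v)" for b
    by (rule Suc.IH) (rule partial_deriv_cong(1)[OF assms(1) Suc.prems])
  moreover have "u differentiable (at x) \<longleftrightarrow> v differentiable (at x)" if "x \<in> \<Omega>" for x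
    by (rule partial_deriv_cong(2)[OF assms(1) Suc.prems that])
  ultimately show ?case using Suc.prems by simp
qed

lemma C1_on_partial_deriv:
  assumes "C1_on C A p g" "x \<in> A"
  shows "partial_deriv b p x = g x \<bullet> b"
  using assms frechet_derivative_at[of p "\<lambda>v. g x \<bullet> v" x]
  by (auto simp: C1_on_def partial_deriv_def)

lemma C1_on_grad:
  assumes "C1_on C A p g" "x \<in> A"
  shows "grad p x = g x"
  using C1_on_partial_deriv[OF assms] by (simp add: grad_def euclidean_representation)

lemma C1_on_imp_C_closure:
  assumes "C1_on (closure \<Omega>) \<Omega> p g"
  shows "C_closure 1 \<Omega> p"
proof -
  have "continuous_on (closure \<Omega>) p" "continuous_on (closure \<Omega>) g"
    and "p differentiable (at x)" if "x \<in> \<Omega>" for x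
    using assms that unfolding C1_on_def differentiable_def by blast+
  moreover have "\<exists>v. continuous_on (closure \<Omega>) v \<and> (\<forall>x\<in>\<Omega>. v x = partial_deriv b p x)" for b
    using assms C1_on_partial_deriv[OF assms, of _ b]
    by (intro exI[of _ "\<lambda>x. g x \<bullet> b"]) (auto simp: C1_on_def intro!: continuous_intros)
  ultimately show ?thesis
    using assms unfolding C_closure_def One_nat_def C1_on_def by auto
qed

text \<open>The extensions of the partial derivatives are assembled into one field; by linearity of
  the Frechet derivative it represents the derivative in \<open>\<Omega>\<close>.\<close>

lemma derivs_extend_imp_C1_on:
  fixes \<Omega> :: "'a::euclidean_space set"
  assumes "continuous_on (closure \<Omega>) p" "derivs_extend (Suc 0) \<Omega> p"
  obtains g where "C1_on (closure \<Omega>) \<Omega> p g"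
proof -
  have "\<exists>v. continuous_on (closure \<Omega>) v \<and> (\<forall>x\<in>\<Omega>. v x = partial_deriv b p x)" if "b \<in> Basis" for b
    using assms(2) that by auto
  then obtain v where v: "\<And>b. b \<in> Basis \<Longrightarrow> continuous_on (closure \<Omega>) (v b)"
    "\<And>b x. b \<in> Basis \<Longrightarrow> x \<in> \<Omega> \<Longrightarrow> v b x = partial_deriv b p x" by metis
  define g where "g = (\<lambda>x. \<Sum>b\<in>Basis. v b x *\<^sub>R b)"
  have "(p has_derivative (\<lambda>y. g x \<bullet> y)) (at x)" if x: "x \<in> \<Omega>" for x
  proof -
    have d: "(p has_derivative frechet_derivative p (at x)) (at x)"
      using assms(2) x by (simp add: frechet_derivative_works)
    then have lin: "linear (frechet_derivative p (at x))"
      by (rule has_derivative_linear)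
    have "frechet_derivative p (at x) y = g x \<bullet> y" for y
    proof -
      have "frechet_derivative p (at x) y = frechet_derivative p (at x) (\<Sum>b\<in>Basis. (y \<bullet> b) *\<^sub>R b)"
        by (simp add: euclidean_representation)
      also have "\<dots> = (\<Sum>b\<in>Basis. (y \<bullet> b) * v b x)"
        using lin x v(2) by (simp add: linear_sum linear_scale partial_deriv_def)
      also have "\<dots> = g x \<bullet> y"
        unfolding g_def inner_sum_left by (simp add: inner_commute mult.commute)
      finally show ?thesis .
    qed
    then have "frechet_derivative p (at x) = (\<lambda>y. g x \<bullet> y)" by blast
    with d show ?thesis by simp
  qed
  moreover have "continuous_on (closure \<Omega>) g"
    unfolding g_def using v(1) by (intro continuous_intros) auto
  ultimately show ?thesis using assms(1) that[of g] by (simp add: C1_on_def)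
qed

text \<open>Both mixed derivatives have the same integral over every rectangle.\<close>

lemma mixed_partial_derivatives_eq:
  fixes u :: "real \<times> real \<Rightarrow> real"
  assumes "open \<Omega>" and u: "C1_on C \<Omega> u w"
    and H1: "C1_on C \<Omega> (\<lambda>x. fst (w x)) H1" and H2: "C1_on C \<Omega> (\<lambda>x. snd (w x)) H2"
    and "\<Omega> \<subseteq> C" "x \<in> \<Omega>"
  shows "snd (H1 x) = fst (H2 x)"
proof (rule ccontr)
  assume ne: "snd (H1 x) \<noteq> fst (H2 x)"
  define k where "k = (\<lambda>z. snd (H1 z) - fst (H2 z))"
  have cont1: "continuous_on S (\<lambda>z. snd (H1 z))" and cont2: "continuous_on S (\<lambda>z. fst (H2 z))"
    if "S \<subseteq> \<Omega>" for S
    using H1 H2 that \<open>\<Omega> \<subseteq> C\<close> unfolding C1_on_def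
    by (auto intro!: continuous_on_snd continuous_on_fst intro: continuous_on_subset)
  have deriv: "((\<lambda>s. p (s,t)) has_vector_derivative fst (g (s,t))) (at s within S)"
    "((\<lambda>t. p (s,t)) has_vector_derivative snd (g (s,t))) (at t within S)"
    if "C1_on C \<Omega> p g" "(s,t) \<in> \<Omega>" for p g s t S
  proof -
    have d: "(p has_derivative (\<lambda>v. g (s,t) \<bullet> v)) (at (s,t))" using that by (auto simp: C1_on_def)
    have "((\<lambda>s. (s,t)) has_vector_derivative (1,0)) (at s)"
      "((\<lambda>t. (s,t)) has_vector_derivative (0,1)) (at t)"
      unfolding has_vector_derivative_def by (auto intro!: derivative_eq_intros)
    from has_real_derivative_along_curve[of p _ "\<lambda>s. (s,t)", OF d this(1)]
      has_real_derivative_along_curve[of p _ "\<lambda>t. (s,t)", OF d this(2)]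
    show "((\<lambda>s. p (s,t)) has_vector_derivative fst (g (s,t))) (at s within S)"
      "((\<lambda>t. p (s,t)) has_vector_derivative snd (g (s,t))) (at t within S)"
      by (auto simp: inner_prod_def has_real_derivative_iff_has_vector_derivative
          intro: has_vector_derivative_at_within)
  qed
  \<comment> \<open>Each double integral, taken in the order that first undoes the outer
    differentiation, equals the alternating sum of \<open>u\<close> over the four corners.\<close>
  have zero: "integral (cbox (a,c) (b,d)) k = 0"
    if sub: "cbox (a,c) (b,d) \<subseteq> \<Omega>" and "a \<le> b" "c \<le> d" for a b c d
  proof -
    have in\<Omega>: "(s,t) \<in> \<Omega>" if "s \<in> {a..b}" "t \<in> {c..d}" for s t using sub that by auto
    have "integral (cbox (a,c) (b,d)) (\<lambda>z. snd (H1 z)) =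
        integral (cbox a b) (\<lambda>s. integral (cbox c d) (\<lambda>t. snd (H1 (s,t))))"
      by (rule integral_prod_continuous[OF cont1[OF sub]])
    also have "\<dots> = integral (cbox a b) (\<lambda>s. fst (w (s,d)) - fst (w (s,c)))"
      using in\<Omega> \<open>c \<le> d\<close>
      by (intro integral_cong integral_unique) (auto intro!: fundamental_theorem_of_calculus deriv[OF H1])
    also have "\<dots> = (u (b,d) - u (b,c)) - (u (a,d) - u (a,c))"
      using in\<Omega> \<open>a \<le> b\<close> \<open>c \<le> d\<close>
      by (intro integral_unique)
        (auto intro!: fundamental_theorem_of_calculus has_vector_derivative_diff deriv[OF u])
    finally have 1: "integral (cbox (a,c) (b,d)) (\<lambda>z. snd (H1 z)) =
        (u (b,d) - u (b,c)) - (u (a,d) - u (a,c))" .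
    have "integral (cbox (a,c) (b,d)) (\<lambda>z. fst (H2 z)) =
        integral (cbox a b) (\<lambda>s. integral (cbox c d) (\<lambda>t. fst (H2 (s,t))))"
      by (rule integral_prod_continuous[OF cont2[OF sub]])
    also have "\<dots> = integral (cbox c d) (\<lambda>t. integral (cbox a b) (\<lambda>s. fst (H2 (s,t))))"
      by (rule integral_swap_continuous) (use cont2[OF sub] in \<open>simp add: case_prod_unfold\<close>)
    also have "\<dots> = integral (cbox c d) (\<lambda>t. snd (w (b,t)) - snd (w (a,t)))"
      using in\<Omega> \<open>a \<le> b\<close>
      by (intro integral_cong integral_unique) (auto intro!: fundamental_theorem_of_calculus deriv[OF H2])
    also have "\<dots> = (u (b,d) - u (a,d)) - (u (b,c) - u (a,c))"
      using in\<Omega> \<open>a \<le> b\<close> \<open>c \<le> d\<close>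
      by (intro integral_unique)
        (auto intro!: fundamental_theorem_of_calculus has_vector_derivative_diff deriv[OF u])
    finally have 2: "integral (cbox (a,c) (b,d)) (\<lambda>z. fst (H2 z)) =
        (u (b,d) - u (a,d)) - (u (b,c) - u (a,c))" .
    show ?thesis
      unfolding k_def
      by (subst integral_diff; (intro integrable_continuous cont1 cont2 sub)?) (simp add: 1 2)
  qed
  \<comment> \<open>On a small square \<open>k\<close> stays within half of
    \<open>\<bar>k x\<bar>\<close> of \<open>k x\<close>, so its mean there cannot be zero.\<close>
  define \<epsilon> where "\<epsilon> = \<bar>k x\<bar> / 2"
  have \<epsilon>: "\<epsilon> > 0" using ne by (simp add: \<epsilon>_def k_def)
  have contk: "continuous_on \<Omega> k" unfolding k_def by (intro continuous_intros cont1 cont2) auto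
  obtain d1 where d1: "d1 > 0" "ball x d1 \<subseteq> \<Omega>"
    using \<open>open \<Omega>\<close> \<open>x \<in> \<Omega>\<close> by (meson open_contains_ball)
  obtain d2 where d2: "d2 > 0" "\<And>y. y \<in> \<Omega> \<Longrightarrow> dist y x < d2 \<Longrightarrow> dist (k y) (k x) < \<epsilon>"
    using contk \<open>x \<in> \<Omega>\<close> \<epsilon> unfolding continuous_on_iff by metis
  define \<eta> where "\<eta> = min d1 d2 / 3"
  define B where "B = cbox (fst x - \<eta>, snd x - \<eta>) (fst x + \<eta>, snd x + \<eta>)"
  have \<eta>: "\<eta> > 0" using d1 d2 by (simp add: \<eta>_def)
  have near: "dist y x < min d1 d2" if "y \<in> B" for y
  proof -
    have "dist y x \<le> \<bar>fst y - fst x\<bar> + \<bar>snd y - snd x\<bar>"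
      using sqrt_sum_squares_le_sum_abs[of "fst y - fst x" "snd y - snd x"]
      by (simp add: dist_prod_def dist_real_def)
    also have "\<dots> \<le> \<eta> + \<eta>"
      using that by (intro add_mono) (auto simp: B_def mem_box abs_le_iff cbox_Pair_eq)
    also have "\<dots> < min d1 d2"
    proof -
      have "min d1 d2 > 0" using d1 d2 by simp
      then show ?thesis unfolding \<eta>_def by linarith
    qed
    finally show ?thesis .
  qed
  have BO: "B \<subseteq> \<Omega>" using near d1(2) by (force simp: dist_commute)
  have content: "measure lborel B = (2 * \<eta>) * (2 * \<eta>)"
    using \<eta> by (simp add: B_def content_Pair)
  have i0: "(k has_integral 0) B"
  proof -
    have "k integrable_on B"
      unfolding B_def by (intro integrable_continuous continuous_on_subset[OF contk]) (use BO in \<open>simp add: B_def\<close>)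
    moreover have "integral B k = 0" unfolding B_def by (rule zero) (use BO \<eta> in \<open>auto simp: B_def\<close>)
    ultimately show ?thesis using integrable_integral by fastforce
  qed
  have "((\<lambda>y. k y - k x) has_integral (0 - measure lborel B *\<^sub>R k x)) B"
    using i0 unfolding B_def by (intro has_integral_diff has_integral_const)
  then have "norm (0 - measure lborel B *\<^sub>R k x) \<le> \<epsilon> * measure lborel B"
    unfolding B_def
  proof (rule has_integral_bound[rotated])
    fix y assume "y \<in> cbox (fst x - \<eta>, snd x - \<eta>) (fst x + \<eta>, snd x + \<eta>)"
    then have "y \<in> B" by (simp add: B_def)
    then show "norm (k y - k x) \<le> \<epsilon>" using d2(2)[of y] near[of y] BO by (force simp: dist_real_def)
  qed (use \<epsilon> in simp)
  then have "measure lborel B * \<bar>k x\<bar> \<le> \<epsilon> * measure lborel B" by (simp add: abs_mult)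
  moreover have "measure lborel B > 0" using \<eta> by (simp add: content)
  ultimately have "\<bar>k x\<bar> \<le> \<epsilon>" by (simp add: mult.commute)
  then show False using \<epsilon> by (simp add: \<epsilon>_def)
qed

section \<open>Instability\<close>

text \<open>A frontier point of an open set lies in the closure but not in the set, so limits along
  the set are unique there, and that of the gradient is the value of its continuous
  extension.\<close>

lemma normal_deriv_eq:
  assumes "open \<Omega>" and u: "C1_on (closure \<Omega>) \<Omega> u w" and x: "x \<in> frontier \<Omega>"
  shows "normal_deriv \<Omega> u x = w x \<bullet> outer_normal \<Omega> x"
proof -
  have x': "x \<in> closure \<Omega>" "x \<notin> \<Omega>"
    using x \<open>open \<Omega>\<close> by (auto simp: frontier_def interior_open)
  have "(w \<longlongrightarrow> w x) (at x within closure \<Omega>)"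
    using u x' by (auto simp: C1_on_def continuous_on_def)
  then have "(w \<longlongrightarrow> w x) (at x within \<Omega>)"
    by (rule tendsto_within_subset[OF _ closure_subset])
  then have "(grad u \<longlongrightarrow> w x) (at x within \<Omega>)"
    by (rule Lim_transform_eventually)
      (auto simp: eventually_at C1_on_grad[OF u] intro!: exI[of _ 1])
  moreover have "at x within \<Omega> \<noteq> bot"
    using x' by (auto simp: closure_def trivial_limit_within islimpt_def)
  ultimately show ?thesis
    by (simp add: normal_deriv_def tendsto_Lim)
qed

theorem theorem1p6:
  fixes \<Omega> :: "(real \<times> real) set"
    and \<sigma> :: "(real \<times> real) measure"
    and f :: "real \<Rightarrow> real"
    and \<alpha> :: real
    and u :: "real \<times> real \<Rightarrow> real"
  assumes "bounded_smooth_domain \<Omega>"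
    and "arc_length_measure (frontier \<Omega>) \<sigma>"
    and "f C1_differentiable_on UNIV"
    and "C_closure 2 \<Omega> u"
    and "\<forall>x\<in>\<Omega>. laplacian u x + f (u x) = 0"
    and "\<forall>x\<in>frontier \<Omega>. normal_deriv \<Omega> u x + \<alpha> * u x = 0"
    and "(LINT x:frontier \<Omega>|\<sigma>.
            \<alpha> * u x * f (u x) - curvature \<Omega> x * \<alpha>\<^sup>2 * (u x)\<^sup>2 + \<alpha>^3 * (u x)\<^sup>2) < 0"
    and "\<forall>x\<in>frontier \<Omega>. \<alpha> + curvature \<Omega> x \<ge> 0"
  shows "unstable \<Omega> \<sigma> f \<alpha> u"
proof
  assume stable: "stable \<Omega> \<sigma> f \<alpha> u"
  have op: "open \<Omega>" and sm: "smooth_boundary \<Omega>" and bd: "bounded \<Omega>"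
    using assms(1) by (auto simp: bounded_smooth_domain_def)
  have sub: "\<Omega> \<subseteq> closure \<Omega>" and fc: "frontier \<Omega> \<subseteq> closure \<Omega>"
    by (simp_all add: closure_subset frontier_def)

  \<comment> \<open>Regularity of \<open>f\<close> and \<open>u\<close>\<close>
  obtain F where F: "\<And>y. (f has_real_derivative F y) (at y)" "continuous_on UNIV F"
    using assms(3) by (auto simp: C1_differentiable_on_def has_real_derivative_iff_has_vector_derivative)
  have "deriv f = F" using F(1) by (intro ext DERIV_imp_deriv)
  then have f: "(f has_real_derivative deriv f y) (at y)" and f': "continuous_on UNIV (deriv f)" for y
    using F by simp_all

  have contu: "continuous_on (closure \<Omega>) u" and du: "derivs_extend (Suc (Suc 0)) \<Omega> u"
    using assms(4) by (auto simp: C_closure_def numeral_2_eq_2)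
  have du1: "derivs_extend (Suc 0) \<Omega> (partial_deriv b u)" if "b \<in> Basis" for b
    using du that by simp
  have "derivs_extend (Suc 0) \<Omega> u"
    using du by simp
  then obtain w where w: "C1_on (closure \<Omega>) \<Omega> u w"
    using derivs_extend_imp_C1_on[OF contu] by blast
  have contw: "continuous_on (closure \<Omega>) w" using w by (simp add: C1_on_def)
  have B: "(1, 0) \<in> (Basis :: (real \<times> real) set)" "(0, 1) \<in> (Basis :: (real \<times> real) set)"
    by (auto simp: Basis_prod_def)
  have w1: "fst (w x) = partial_deriv (1, 0) u x" and w2: "snd (w x) = partial_deriv (0, 1) u x"
    if "x \<in> \<Omega>" for x
    using C1_on_partial_deriv[OF w that] by (simp_all add: inner_prod_def)
  have "derivs_extend (Suc 0) \<Omega> (\<lambda>x. fst (w x))"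
    using derivs_extend_cong[OF op, of "\<lambda>x. fst (w x)" "partial_deriv (1, 0) u"] w1 du1[OF B(1)] by blast
  then obtain H1 where H1: "C1_on (closure \<Omega>) \<Omega> (\<lambda>x. fst (w x)) H1"
    using derivs_extend_imp_C1_on[OF continuous_on_fst[OF contw]] by blast
  have "derivs_extend (Suc 0) \<Omega> (\<lambda>x. snd (w x))"
    using derivs_extend_cong[OF op, of "\<lambda>x. snd (w x)" "partial_deriv (0, 1) u"] w2 du1[OF B(2)] by blast
  then obtain H2 where H2: "C1_on (closure \<Omega>) \<Omega> (\<lambda>x. snd (w x)) H2"
    using derivs_extend_imp_C1_on[OF continuous_on_snd[OF contw]] by blast
  have sym: "snd (H1 x) = fst (H2 x)" if "x \<in> \<Omega>" for x
    by (rule mixed_partial_derivatives_eq[OF op w H1 H2 sub that])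
  have lap: "fst (H1 x) + snd (H2 x) = - f (u x)" if x: "x \<in> \<Omega>" for x
  proof -
    have "fst (H1 x) = partial_deriv (1, 0) (partial_deriv (1, 0) u) x"
      using C1_on_partial_deriv[OF H1 x] partial_deriv_cong(1)[OF op, of "\<lambda>x. fst (w x)" "partial_deriv (1, 0) u" x "(1, 0)"] w1 x
      by (simp add: inner_prod_def)
    moreover have "snd (H2 x) = partial_deriv (0, 1) (partial_deriv (0, 1) u) x"
      using C1_on_partial_deriv[OF H2 x] partial_deriv_cong(1)[OF op, of "\<lambda>x. snd (w x)" "partial_deriv (0, 1) u" x "(0, 1)"] w2 x
      by (simp add: inner_prod_def)
    ultimately have "laplacian u x = fst (H1 x) + snd (H2 x)"
      by (simp add: laplacian_def Basis_prod_def)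
    then show ?thesis using assms(5) x by (metis add_eq_0_iff2)
  qed

  \<comment> \<open>Frame, curvature and boundary condition on the frontier\<close>
  obtain U N g1 g2 where U: "open U" "closure \<Omega> \<subseteq> U"
    and g1: "C1_on U U (\<lambda>x. fst (N x)) g1" and g2: "C1_on U U (\<lambda>x. snd (N x)) g2"
    and N: "\<And>x. x \<in> frontier \<Omega> \<Longrightarrow> N x = outer_normal \<Omega> x"
    and int: "\<And>g :: real \<times> real \<Rightarrow> real. continuous_on (frontier \<Omega>) g \<Longrightarrow> set_integrable \<sigma> (frontier \<Omega>) g"
    and green: "\<And>P gP q gq. C1_on (closure \<Omega>) \<Omega> P gP \<Longrightarrow> C1_on (closure \<Omega>) \<Omega> q gq \<Longrightarrow>
      (LINT x:\<Omega>|lborel. rot90 (gP x) \<bullet> gq x) = (LINT x:frontier \<Omega>|\<sigma>. P x * (gq x \<bullet> rot90 (N x)))"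
    using green_domain[OF assms(1,2)] by blast
  have \<Omega>U: "\<Omega> \<subseteq> U" using U sub by blast
  note N1 = C1_on_subset[OF g1 U(2) \<Omega>U] and N2 = C1_on_subset[OF g2 U(2) \<Omega>U]
  define T where "T = (\<lambda>x. rot90 (N x))"
  \<comment> \<open>\<open>h\<close> is the derivative of the gradient \<open>w\<close> along
    \<open>T\<close>; it carries the second derivatives of \<open>u\<close> in the boundary
    integrals.\<close>
  define h where "h = (\<lambda>x. (H1 x \<bullet> T x, H2 x \<bullet> T x))"
  \<comment> \<open>Unlike \<open>curvature \<Omega>\<close>, this expression is visibly continuous
    on the closure, so boundary integrals containing it can be split. On the frontier both
    agree.\<close>
  define \<kappa> where "\<kappa> = (\<lambda>x. T x \<bullet> (g1 x \<bullet> T x, g2 x \<bullet> T x))"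
  have wein: "(g1 x \<bullet> T x, g2 x \<bullet> T x) = curvature \<Omega> x *\<^sub>R T x"
    and normN: "N x \<bullet> N x = 1" if x: "x \<in> frontier \<Omega>" for x
  proof -
    have "x \<in> U" using x fc U(2) by blast
    then have "((\<lambda>y. (fst (N y), snd (N y))) has_derivative (\<lambda>v. (g1 x \<bullet> v, g2 x \<bullet> v))) (at x)"
      using g1 g2 by (intro has_derivative_Pair) (auto simp: C1_on_def)
    then have "(N has_derivative (\<lambda>v. (g1 x \<bullet> v, g2 x \<bullet> v))) (at x)" by simp
    from derivative_outer_normal[OF op sm x this N]
    show "(g1 x \<bullet> T x, g2 x \<bullet> T x) = curvature \<Omega> x *\<^sub>R T x" by (simp add: T_def)
    show "N x \<bullet> N x = 1"
      using outer_normal_props(1)[OF op sm x] N[OF x] by (simp add: norm_eq_1)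
  qed
  have curv: "curvature \<Omega> x = \<kappa> x" if "x \<in> frontier \<Omega>" for x
    using normN[OF that] by (simp add: \<kappa>_def wein[OF that]) (simp add: T_def)
  have bc: "w x \<bullet> N x = - \<alpha> * u x" if "x \<in> frontier \<Omega>" for x
    using assms(6) normal_deriv_eq[OF op w that] N[OF that] that by (auto simp: add_eq_0_iff2)

  \<comment> \<open>Continuity, integrability and linearity of the integrals\<close>
  have cont: "continuous_on (closure \<Omega>) u" "continuous_on (closure \<Omega>) (\<lambda>x. f (u x))"
    "continuous_on (closure \<Omega>) (\<lambda>x. deriv f (u x))"
    "continuous_on (closure \<Omega>) w" "continuous_on (closure \<Omega>) H1" "continuous_on (closure \<Omega>) H2"
    "continuous_on (closure \<Omega>) g1" "continuous_on (closure \<Omega>) g2" "continuous_on (closure \<Omega>) N"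
  proof -
    have "continuous_on UNIV f"
      using f by (meson DERIV_isCont continuous_at_imp_continuous_on)
    then show "continuous_on (closure \<Omega>) (\<lambda>x. f (u x))"
      by (rule continuous_on_compose2[OF _ contu]) simp
    show "continuous_on (closure \<Omega>) (\<lambda>x. deriv f (u x))"
      by (rule continuous_on_compose2[OF f' contu]) simp
    have "continuous_on (closure \<Omega>) (\<lambda>x. (fst (N x), snd (N x)))"
      using N1 N2 unfolding C1_on_def by (intro continuous_on_Pair) auto
    then show "continuous_on (closure \<Omega>) N" by simp
  qed (use contu contw H1 H2 N1 N2 in \<open>simp_all add: C1_on_def\<close>)
  have contT: "continuous_on (closure \<Omega>) T"
    unfolding T_def rot90_def by (intro continuous_intros cont)
  have conth: "continuous_on (closure \<Omega>) h" and cont\<kappa>: "continuous_on (closure \<Omega>) \<kappa>"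
    unfolding h_def \<kappa>_def by (intro continuous_intros cont contT)+
  note conts = cont contT conth cont\<kappa>
  have intD: "set_integrable lborel \<Omega> F" if "continuous_on (closure \<Omega>) F" for F :: "real \<times> real \<Rightarrow> real"
    by (rule set_integrable_continuous_closure[OF op bd that])
  have intB: "set_integrable \<sigma> (frontier \<Omega>) F" if "continuous_on (closure \<Omega>) F" for F :: "real \<times> real \<Rightarrow> real"
    by (rule int[OF continuous_on_subset[OF that fc]])
  have congD: "(LINT x:\<Omega>|lborel. F x) = (LINT x:\<Omega>|lborel. G x)"
    if "\<And>x. x \<in> \<Omega> \<Longrightarrow> F x = G x" for F G :: "real \<times> real \<Rightarrow> real"
    unfolding set_lebesgue_integral_def using that
    by (intro Bochner_Integration.integral_cong) (auto simp: indicator_def)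
  have congB: "(LINT x:frontier \<Omega>|\<sigma>. F x) = (LINT x:frontier \<Omega>|\<sigma>. G x)"
    if "\<And>x. x \<in> frontier \<Omega> \<Longrightarrow> F x = G x" for F G :: "real \<times> real \<Rightarrow> real"
    unfolding set_lebesgue_integral_def using that
    by (intro Bochner_Integration.integral_cong) (auto simp: indicator_def)

  define D where "D = (\<lambda>F. LINT x:\<Omega>|lborel. (F x :: real))"
  define I where "I = (\<lambda>F. LINT x:frontier \<Omega>|\<sigma>. (F x :: real))"
  have green: "D (\<lambda>x. rot90 (gP x) \<bullet> gq x) = I (\<lambda>x. P x * (gq x \<bullet> T x))"
    if "C1_on (closure \<Omega>) \<Omega> P gP" "C1_on (closure \<Omega>) \<Omega> q gq" for P gP q gq
    using green[OF that] by (simp add: D_def I_def T_def)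
  have D_lin: "D (\<lambda>x. F x + G x) = D F + D G" "D (\<lambda>x. F x - G x) = D F - D G"
    if "continuous_on (closure \<Omega>) F" "continuous_on (closure \<Omega>) G" for F G
    unfolding D_def using intD[OF that(1)] intD[OF that(2)] by (auto intro: set_integral_add set_integral_diff)
  have I_lin: "I (\<lambda>x. F x + G x) = I F + I G" "I (\<lambda>x. F x - G x) = I F - I G"
    if "continuous_on (closure \<Omega>) F" "continuous_on (closure \<Omega>) G" for F G
    unfolding I_def using intB[OF that(1)] intB[OF that(2)] by (auto intro: set_integral_add set_integral_diff)
  have I_scale: "I (\<lambda>x. r * F x) = r * I F" and D_scale: "D (\<lambda>x. r * F x) = r * D F" for r F
    by (simp_all add: I_def D_def)

  define a where "a = (\<lambda>x. w x \<bullet> T x)"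
  have aw: "w x \<bullet> T x = a x" for x by (simp add: a_def)
  define J where "J = (\<lambda>x. fst (w x) * snd (h x) - snd (w x) * fst (h x))"
  have contJ: "continuous_on (closure \<Omega>) J" and conta: "continuous_on (closure \<Omega>) a"
    unfolding J_def a_def by (intro continuous_intros conts)+

  \<comment> \<open>Four integral identities\<close>
  have G1: "D (\<lambda>x. deriv f (u x) * (w x \<bullet> w x) - (f (u x))\<^sup>2) = I (\<lambda>x. f (u x) * (w x \<bullet> N x))"
  proof -
    have F: "C1_on (closure \<Omega>) \<Omega> (\<lambda>x. f (u x)) (\<lambda>x. deriv f (u x) *\<^sub>R w x)"
      by (rule C1_on_compose[OF w f f']) auto
    define G1 where "G1 = (\<lambda>x. f (u x) *\<^sub>R H1 x + fst (w x) *\<^sub>R (deriv f (u x) *\<^sub>R w x))"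
    define G2 where "G2 = (\<lambda>x. f (u x) *\<^sub>R H2 x + snd (w x) *\<^sub>R (deriv f (u x) *\<^sub>R w x))"
    \<comment> \<open>With the coordinate functions as \<open>q\<close>, Green's formula becomes the
      divergence theorem, here for the field \<open>f (u x) *\<^sub>R w x\<close>.\<close>
    have 1: "D (\<lambda>x. rot90 (G1 x) \<bullet> (0, 1)) = I (\<lambda>x. f (u x) * fst (w x) * ((0, 1) \<bullet> T x))"
      unfolding G1_def by (rule green[OF C1_on_mult[OF F H1] C1_on_inner])
    have 2: "D (\<lambda>x. rot90 (G2 x) \<bullet> (1, 0)) = I (\<lambda>x. f (u x) * snd (w x) * ((1, 0) \<bullet> T x))"
      unfolding G2_def by (rule green[OF C1_on_mult[OF F H2] C1_on_inner])
    have contG: "continuous_on (closure \<Omega>) (\<lambda>x. rot90 (G1 x) \<bullet> (0, 1))"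
      "continuous_on (closure \<Omega>) (\<lambda>x. rot90 (G2 x) \<bullet> (1, 0))"
      unfolding G1_def G2_def rot90_def by (intro continuous_intros conts)+
    have "D (\<lambda>x. rot90 (G1 x) \<bullet> (0, 1) - rot90 (G2 x) \<bullet> (1, 0)) =
        I (\<lambda>x. f (u x) * fst (w x) * ((0, 1) \<bullet> T x) - f (u x) * snd (w x) * ((1, 0) \<bullet> T x))"
      unfolding D_lin(2)[OF contG] 1 2
      by (rule I_lin(2)[symmetric]) (intro continuous_intros conts)+
    also have "\<dots> = I (\<lambda>x. f (u x) * (w x \<bullet> N x))"
      unfolding I_def by (rule congB) (simp add: T_def rot90_def inner_prod_def algebra_simps)
    also have "D (\<lambda>x. rot90 (G1 x) \<bullet> (0, 1) - rot90 (G2 x) \<bullet> (1, 0)) =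
        D (\<lambda>x. deriv f (u x) * (w x \<bullet> w x) - (f (u x))\<^sup>2)"
      unfolding D_def
    proof (rule congD)
      fix x assume x: "x \<in> \<Omega>"
      have "rot90 (G1 x) \<bullet> (0, 1) - rot90 (G2 x) \<bullet> (1, 0) =
          f (u x) * (fst (H1 x) + snd (H2 x)) + deriv f (u x) * (w x \<bullet> w x)"
        by (simp add: G1_def G2_def rot90_def inner_prod_def algebra_simps)
      then show "rot90 (G1 x) \<bullet> (0, 1) - rot90 (G2 x) \<bullet> (1, 0) =
          deriv f (u x) * (w x \<bullet> w x) - (f (u x))\<^sup>2"
        by (simp add: lap[OF x] power2_eq_square)
    qed
    finally show ?thesis .
  qed
  \<comment> \<open>Exchanging the two functions in Green's formula changes the sign of the area
    integral. Combining both versions yields \<open>J\<close>, the determinant of \<open>w\<close>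
    and its tangential derivative, which can be evaluated in the frame \<open>N\<close>,
    \<open>T\<close>.\<close>
  have G2: "2 * D (\<lambda>x. rot90 (H1 x) \<bullet> H2 x) = I J"
  proof -
    have 1: "D (\<lambda>x. rot90 (H1 x) \<bullet> H2 x) = I (\<lambda>x. fst (w x) * (H2 x \<bullet> T x))"
      by (rule green[OF H1 H2])
    have 2: "D (\<lambda>x. rot90 (H2 x) \<bullet> H1 x) = I (\<lambda>x. snd (w x) * (H1 x \<bullet> T x))"
      by (rule green[OF H2 H1])
    have "rot90 (H2 x) \<bullet> H1 x = (-1) * (rot90 (H1 x) \<bullet> H2 x)" for x
      by (simp add: rot90_def inner_prod_def algebra_simps)
    then have "D (\<lambda>x. rot90 (H2 x) \<bullet> H1 x) = - D (\<lambda>x. rot90 (H1 x) \<bullet> H2 x)"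
      using D_scale[of "-1"] by simp
    then have "2 * D (\<lambda>x. rot90 (H1 x) \<bullet> H2 x) =
        I (\<lambda>x. fst (w x) * (H2 x \<bullet> T x)) - I (\<lambda>x. snd (w x) * (H1 x \<bullet> T x))"
      using 1 2 by simp
    also have "\<dots> = I (\<lambda>x. fst (w x) * (H2 x \<bullet> T x) - snd (w x) * (H1 x \<bullet> T x))"
      by (rule I_lin(2)[symmetric]) (intro continuous_intros conts)+
    finally show ?thesis by (simp add: J_def h_def)
  qed
  \<comment> \<open>The term with \<open>\<kappa>\<close> comes from differentiating
    \<open>T\<close>, whose derivative along itself is \<open>- \<kappa> N\<close>.\<close>
  have aC1: "\<exists>ga. C1_on (closure \<Omega>) \<Omega> a ga \<and>
      (\<forall>x\<in>frontier \<Omega>. ga x \<bullet> T x = h x \<bullet> T x - \<kappa> x * (w x \<bullet> N x))"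
  proof -
    \<comment> \<open>The zero summand and the factor \<open>- 1\<close> have the shape in which
      \<open>C1_on_mult\<close> delivers the gradient of a product with a constant.\<close>
    define ga where "ga = (\<lambda>x. (snd (w x) *\<^sub>R g1 x + fst (N x) *\<^sub>R H2 x) +
      ((fst (w x) * snd (N x)) *\<^sub>R 0 + (- 1) *\<^sub>R (fst (w x) *\<^sub>R g2 x + snd (N x) *\<^sub>R H1 x)))"
    have "C1_on (closure \<Omega>) \<Omega> (\<lambda>x. snd (w x) * fst (N x) + (fst (w x) * snd (N x)) * - 1) ga"
      unfolding ga_def
      by (intro C1_on_add C1_on_mult H1 H2 N1 N2 C1_on_const)
    moreover have "(\<lambda>x. snd (w x) * fst (N x) + (fst (w x) * snd (N x)) * - 1) = a"
      by (simp add: a_def T_def rot90_def inner_prod_def fun_eq_iff)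
    moreover have "ga x \<bullet> T x = h x \<bullet> T x - \<kappa> x * (w x \<bullet> N x)" if x: "x \<in> frontier \<Omega>" for x
    proof -
      have "g1 x \<bullet> T x = - (\<kappa> x * snd (N x))" "g2 x \<bullet> T x = \<kappa> x * fst (N x)"
        using wein[OF x] curv[OF x] by (simp_all add: T_def rot90_def)
      then have "ga x \<bullet> T x = - (\<kappa> x * snd (N x)) * snd (w x) + fst (N x) * (H2 x \<bullet> T x)
          - (\<kappa> x * fst (N x)) * fst (w x) - snd (N x) * (H1 x \<bullet> T x)"
        by (simp add: ga_def inner_add_left inner_diff_left mult_ac)
      also have "\<dots> = h x \<bullet> T x - \<kappa> x * (w x \<bullet> N x)"
        by (simp add: h_def T_def rot90_def inner_prod_def algebra_simps)
      finally show ?thesis .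
    qed
    ultimately show ?thesis by auto
  qed
  then obtain ga where aC1: "C1_on (closure \<Omega>) \<Omega> a ga"
    and ga: "\<And>x. x \<in> frontier \<Omega> \<Longrightarrow> ga x \<bullet> T x = h x \<bullet> T x - \<kappa> x * (w x \<bullet> N x)" by blast

  text \<open>The function \<open>b\<close> vanishes on the boundary. That its tangential derivative vanishes too is only
    needed in integrated form, which follows from the antisymmetry of Green's formula.\<close>

  have G3: "I (\<lambda>x. a x * (h x \<bullet> N x + (\<kappa> x + \<alpha>) * a x)) = 0"
  proof -
    define b where "b = (\<lambda>x. (fst (w x) * fst (N x) + snd (w x) * snd (N x)) + \<alpha> * u x)"
    define gb where "gb = (\<lambda>x. ((fst (w x) *\<^sub>R g1 x + fst (N x) *\<^sub>R H1 x) +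
      (snd (w x) *\<^sub>R g2 x + snd (N x) *\<^sub>R H2 x)) + (\<alpha> *\<^sub>R w x + u x *\<^sub>R 0))"
    have bC1: "C1_on (closure \<Omega>) \<Omega> b gb"
      unfolding b_def gb_def
      by (intro C1_on_add C1_on_mult H1 H2 N1 N2 C1_on_const w)
    have b0: "b x = 0" if "x \<in> frontier \<Omega>" for x
      using bc[OF that] by (simp add: b_def inner_prod_def)
    have gbT: "gb x \<bullet> T x = h x \<bullet> N x + (\<kappa> x + \<alpha>) * a x" if x: "x \<in> frontier \<Omega>" for x
    proof -
      have "g1 x \<bullet> T x = \<kappa> x * fst (T x)" "g2 x \<bullet> T x = \<kappa> x * snd (T x)"
        using wein[OF x] curv[OF x] by (simp_all add: prod_eq_iff)
      then have "gb x \<bullet> T x = fst (w x) * (\<kappa> x * fst (T x)) + fst (N x) * (H1 x \<bullet> T x)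
          + (snd (w x) * (\<kappa> x * snd (T x)) + snd (N x) * (H2 x \<bullet> T x)) + \<alpha> * (w x \<bullet> T x)"
        by (simp add: gb_def inner_add_left)
      also have "\<dots> = h x \<bullet> N x + (\<kappa> x + \<alpha>) * a x"
        by (simp add: h_def a_def inner_prod_def algebra_simps)
      finally show ?thesis .
    qed
    have "I (\<lambda>x. a x * (h x \<bullet> N x + (\<kappa> x + \<alpha>) * a x)) = I (\<lambda>x. a x * (gb x \<bullet> T x))"
      unfolding I_def by (rule congB) (simp add: gbT)
    also have "\<dots> = D (\<lambda>x. rot90 (ga x) \<bullet> gb x)" by (rule green[OF aC1 bC1, symmetric])
    also have "\<dots> = D (\<lambda>x. - 1 * (rot90 (gb x) \<bullet> ga x))"
      unfolding D_def by (rule congD) (simp add: rot90_def inner_prod_def algebra_simps)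
    also have "\<dots> = - I (\<lambda>x. b x * (ga x \<bullet> T x))"
      unfolding D_scale green[OF bC1 aC1] by simp
    also have "I (\<lambda>x. b x * (ga x \<bullet> T x)) = I (\<lambda>x. 0)"
      unfolding I_def by (rule congB) (simp add: b0)
    finally show ?thesis by (simp add: I_def)
  qed
  \<comment> \<open>With the constant 1 as \<open>P\<close>, Green's formula says that a tangential
    derivative integrates to 0 over the boundary; it is applied to \<open>u x * a x\<close>.\<close>
  have G4: "I (\<lambda>x. (a x)\<^sup>2 + u x * (h x \<bullet> T x + \<alpha> * \<kappa> x * u x)) = 0"
  proof -
    have "D (\<lambda>x. rot90 0 \<bullet> (u x *\<^sub>R ga x + a x *\<^sub>R w x)) = I (\<lambda>x. 1 * ((u x *\<^sub>R ga x + a x *\<^sub>R w x) \<bullet> T x))"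
      by (rule green[OF C1_on_const C1_on_mult[OF w aC1]])
    moreover have "I (\<lambda>x. 1 * ((u x *\<^sub>R ga x + a x *\<^sub>R w x) \<bullet> T x)) =
        I (\<lambda>x. (a x)\<^sup>2 + u x * (h x \<bullet> T x + \<alpha> * \<kappa> x * u x))"
      unfolding I_def
      by (rule congB) (simp add: inner_add_left ga bc aw power2_eq_square algebra_simps)
    ultimately show ?thesis by (simp add: D_def)
  qed

  \<comment> \<open>The sum of the two quadratic forms\<close>
  define Q where "Q = (\<lambda>(H :: real \<times> real \<Rightarrow> real \<times> real) p. D (\<lambda>x. H x \<bullet> H x) + \<alpha> * I (\<lambda>x. (p x)\<^sup>2) - D (\<lambda>x. deriv f (u x) * (p x)\<^sup>2))"
  have Q: "Q H p \<ge> 0" if "C1_on (closure \<Omega>) \<Omega> p H" for H p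
  proof -
    have "(LINT x:\<Omega>|lborel. (norm (grad p x))\<^sup>2) = D (\<lambda>x. H x \<bullet> H x)"
      unfolding D_def by (rule congD) (simp add: C1_on_grad[OF that] power2_norm_eq_inner)
    moreover have "(LINT x:\<Omega>|lborel. (norm (grad p x))\<^sup>2) + \<alpha> * (LINT x:frontier \<Omega>|\<sigma>. (p x)\<^sup>2)
        - (LINT x:\<Omega>|lborel. deriv f (u x) * (p x)\<^sup>2) \<ge> 0"
      using stable C1_on_imp_C_closure[OF that] unfolding stable_def by blast
    ultimately show ?thesis by (simp add: Q_def D_def I_def)
  qed
  have "0 \<le> Q H1 (\<lambda>x. fst (w x)) + Q H2 (\<lambda>x. snd (w x))"
    using Q[OF H1] Q[OF H2] by simp
  also have "\<dots> = D (\<lambda>x. H1 x \<bullet> H1 x + H2 x \<bullet> H2 x - (deriv f (u x) * (fst (w x))\<^sup>2 + deriv f (u x) * (snd (w x))\<^sup>2))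
      + \<alpha> * I (\<lambda>x. (fst (w x))\<^sup>2 + (snd (w x))\<^sup>2)"
  proof -
    have c: "continuous_on (closure \<Omega>) (\<lambda>x. H1 x \<bullet> H1 x)" "continuous_on (closure \<Omega>) (\<lambda>x. H2 x \<bullet> H2 x)"
      "continuous_on (closure \<Omega>) (\<lambda>x. (fst (w x))\<^sup>2)" "continuous_on (closure \<Omega>) (\<lambda>x. (snd (w x))\<^sup>2)"
      "continuous_on (closure \<Omega>) (\<lambda>x. deriv f (u x) * (fst (w x))\<^sup>2)"
      "continuous_on (closure \<Omega>) (\<lambda>x. deriv f (u x) * (snd (w x))\<^sup>2)"
      by (intro continuous_intros conts)+
    show ?thesis
      unfolding Q_def D_lin(2)[OF continuous_on_add[OF c(1,2)] continuous_on_add[OF c(5,6)]]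
        D_lin(1)[OF c(1,2)] D_lin(1)[OF c(5,6)] I_lin(1)[OF c(3,4)]
      by (simp add: algebra_simps)
  qed
  also have "D (\<lambda>x. H1 x \<bullet> H1 x + H2 x \<bullet> H2 x - (deriv f (u x) * (fst (w x))\<^sup>2 + deriv f (u x) * (snd (w x))\<^sup>2)) =
      D (\<lambda>x. - 2 * (rot90 (H1 x) \<bullet> H2 x) - (deriv f (u x) * (w x \<bullet> w x) - (f (u x))\<^sup>2))"
    unfolding D_def
  proof (rule congD)
    fix x assume x: "x \<in> \<Omega>"
    have f2: "(f (u x))\<^sup>2 = (fst (H1 x) + snd (H2 x))\<^sup>2" by (simp add: lap[OF x])
    show "H1 x \<bullet> H1 x + H2 x \<bullet> H2 x - (deriv f (u x) * (fst (w x))\<^sup>2 + deriv f (u x) * (snd (w x))\<^sup>2) =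
        - 2 * (rot90 (H1 x) \<bullet> H2 x) - (deriv f (u x) * (w x \<bullet> w x) - (f (u x))\<^sup>2)"
      unfolding f2 by (simp add: sym[OF x] rot90_def inner_prod_def power2_eq_square algebra_simps)
  qed
  also have "\<dots> = - I J - I (\<lambda>x. f (u x) * (w x \<bullet> N x))"
  proof -
    have c: "continuous_on (closure \<Omega>) (\<lambda>x. - 2 * (rot90 (H1 x) \<bullet> H2 x))"
      "continuous_on (closure \<Omega>) (\<lambda>x. deriv f (u x) * (w x \<bullet> w x) - (f (u x))\<^sup>2)"
      unfolding rot90_def by (intro continuous_intros conts)+
    show ?thesis unfolding D_lin(2)[OF c] D_scale G1 G2[symmetric] by simp
  qed
  \<comment> \<open>The vanishing integrals are subtracted with coefficients that make the unknown
    components of \<open>h\<close> cancel in the integrand: \<open>G3\<close> meets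
    \<open>h x \<bullet> N x\<close> in \<open>J\<close>, and \<open>\<alpha>\<close> times
    \<open>G4\<close> meets \<open>h x \<bullet> T x\<close>, whose coefficient in \<open>J\<close>
    is \<open>w x \<bullet> N x = - \<alpha> * u x\<close>.\<close>
  finally have "0 \<le> - I J - I (\<lambda>x. f (u x) * (w x \<bullet> N x)) + \<alpha> * I (\<lambda>x. (fst (w x))\<^sup>2 + (snd (w x))\<^sup>2)
      - I (\<lambda>x. a x * (h x \<bullet> N x + (\<kappa> x + \<alpha>) * a x))
      - \<alpha> * I (\<lambda>x. (a x)\<^sup>2 + u x * (h x \<bullet> T x + \<alpha> * \<kappa> x * u x))"
    using G3 G4 by simp
  also have "\<dots> = I (\<lambda>x. \<alpha> * ((fst (w x))\<^sup>2 + (snd (w x))\<^sup>2) - J x - f (u x) * (w x \<bullet> N x)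
      - a x * (h x \<bullet> N x + (\<kappa> x + \<alpha>) * a x) - \<alpha> * ((a x)\<^sup>2 + u x * (h x \<bullet> T x + \<alpha> * \<kappa> x * u x)))"
  proof -
    have c: "continuous_on (closure \<Omega>) (\<lambda>x. \<alpha> * ((fst (w x))\<^sup>2 + (snd (w x))\<^sup>2))"
      "continuous_on (closure \<Omega>) (\<lambda>x. f (u x) * (w x \<bullet> N x))"
      "continuous_on (closure \<Omega>) (\<lambda>x. a x * (h x \<bullet> N x + (\<kappa> x + \<alpha>) * a x))"
      "continuous_on (closure \<Omega>) (\<lambda>x. \<alpha> * ((a x)\<^sup>2 + u x * (h x \<bullet> T x + \<alpha> * \<kappa> x * u x)))"
      by (intro continuous_intros conts conta)+
    note c1 = continuous_on_diff[OF c(1) contJ]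
    note c2 = continuous_on_diff[OF c1 c(2)]
    note c3 = continuous_on_diff[OF c2 c(3)]
    show ?thesis
      unfolding I_lin(2)[OF c3 c(4)] I_lin(2)[OF c2 c(3)] I_lin(2)[OF c1 c(2)] I_lin(2)[OF c(1) contJ] I_scale
      by simp
  qed
  also have "\<dots> = I (\<lambda>x. (\<alpha> * u x * f (u x) - \<kappa> x * \<alpha>\<^sup>2 * (u x)\<^sup>2 + \<alpha>^3 * (u x)\<^sup>2)
      - (\<alpha> + \<kappa> x) * (a x)\<^sup>2)"
    unfolding I_def
  proof (rule congB)
    fix x assume x: "x \<in> frontier \<Omega>"
    have n1: "norm (N x) = 1" using normN[OF x] by (simp add: norm_eq_1)
    have J: "J x = (w x \<bullet> N x) * (h x \<bullet> T x) - a x * (h x \<bullet> N x)"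
    proof -
      have "J x = rot90 (w x) \<bullet> h x" by (simp add: J_def rot90_def inner_prod_def)
      then show ?thesis by (simp add: inner_rot90_rotated_basis[OF n1] a_def T_def)
    qed
    have w2: "(fst (w x))\<^sup>2 + (snd (w x))\<^sup>2 = (w x \<bullet> N x)\<^sup>2 + (a x)\<^sup>2"
    proof -
      have "(fst (w x))\<^sup>2 + (snd (w x))\<^sup>2 = w x \<bullet> w x" by (simp add: inner_prod_def power2_eq_square)
      also have "\<dots> = w x \<bullet> ((w x \<bullet> N x) *\<^sub>R N x + (w x \<bullet> T x) *\<^sub>R T x)"
        using rotated_basis_expansion[OF n1, of "w x"] by (simp add: T_def)
      finally show ?thesis by (simp add: inner_add_right a_def power2_eq_square)
    qed
    show "\<alpha> * ((fst (w x))\<^sup>2 + (snd (w x))\<^sup>2) - J x - f (u x) * (w x \<bullet> N x)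
        - a x * (h x \<bullet> N x + (\<kappa> x + \<alpha>) * a x) - \<alpha> * ((a x)\<^sup>2 + u x * (h x \<bullet> T x + \<alpha> * \<kappa> x * u x)) =
        (\<alpha> * u x * f (u x) - \<kappa> x * \<alpha>\<^sup>2 * (u x)\<^sup>2 + \<alpha>^3 * (u x)\<^sup>2) - (\<alpha> + \<kappa> x) * (a x)\<^sup>2"
      unfolding w2 J bc[OF x] by (simp add: algebra_simps power2_eq_square power3_eq_cube)
  qed
  \<comment> \<open>Here the sign condition on the sum of \<open>\<alpha>\<close> and the curvature
    discards the term with the tangential derivative of \<open>u\<close>, leaving the integral
    assumed to be negative.\<close>
  also have "\<dots> \<le> I (\<lambda>x. \<alpha> * u x * f (u x) - \<kappa> x * \<alpha>\<^sup>2 * (u x)\<^sup>2 + \<alpha>^3 * (u x)\<^sup>2)"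
    unfolding I_def
  proof (rule set_integral_mono)
    fix x assume "x \<in> frontier \<Omega>"
    then have "(\<alpha> + \<kappa> x) * (a x)\<^sup>2 \<ge> 0" using assms(8) curv by auto
    then show "(\<alpha> * u x * f (u x) - \<kappa> x * \<alpha>\<^sup>2 * (u x)\<^sup>2 + \<alpha>^3 * (u x)\<^sup>2) - (\<alpha> + \<kappa> x) * (a x)\<^sup>2 \<le>
        \<alpha> * u x * f (u x) - \<kappa> x * \<alpha>\<^sup>2 * (u x)\<^sup>2 + \<alpha>^3 * (u x)\<^sup>2" by simp
  qed (intro intB continuous_intros conts conta)+
  also have "\<dots> = (LINT x:frontier \<Omega>|\<sigma>.
      \<alpha> * u x * f (u x) - curvature \<Omega> x * \<alpha>\<^sup>2 * (u x)\<^sup>2 + \<alpha>^3 * (u x)\<^sup>2)"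
    unfolding I_def by (rule congB) (simp add: curv)
  finally show False using assms(7) by simp
qed

end
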